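(* Let $R=k[x,y,z]$ be a polynomial ring over an infinite field $k$, $\mathfrak m=(x,y,z)$, and let $$I=(x^n,y^n,z^n,\{x^{n-k_i}y^{k_i}\},\{x^{n-\ell_i}z^{\ell_i}\},\{y^{n-m_i}z^{m_i}\})\neq R.$$ Write $a=\gcd(n,k_i\text{'s},\ell_i\text{'s})$, $b=\gcd(n,k_i\text{'s},m_i\text{'s})$, $c=\gcd(n,\ell_i\text{'s},m_i\text{'s})$, and $S=k[x^a,y^b,z^c]$. Let $K$ be the $R$-ideal generated by the monomials in $S$ of degree $n$, and $L$ the $R$-ideal generated by $S_{\ge n}$. If $a=b=c=1$, then (a) $\check I=K=L=\mathfrak m^n$; (b) $\mathrm{core}(I)=\mathfrak m^{3n-2}=\mathrm{adj}(I^3)$.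
   Context: The families $\{k_i\}$, $\{\ell_i\}$, $\{m_i\}$ are finite (possibly empty) families of integers between $0$ and $n$. The ring $S$ is graded by the standard total degree of $R$, and $S_{\ge j}=\bigoplus_{\ell\ge j}S_\ell$. A subideal $J$ of an ideal $I$ is a reduction of $I$ if $I^{r+1}=JI^r$ for some integer $r\ge0$. $\mathrm{core}(I)$ is the intersection of all reductions of $I$. Definition of $\check I$: let $J=(x^n,y^n,z^n)$ (a reduction of $I$), $t$ an indeterminate, $A=R[Jt,t^{-1}]\subset B=R[It,t^{-1}]\subset R[t,t^{-1}]$, graded with $\deg t=1$, and $D=A:_{R[t,t^{-1}]}(A:_{R[t,t^{-1}]}B)$ (an $S_2$-ification of $B$). Then $\check I$ is the $R$-ideal with $[D]_1=\check I\,t$, where $[D]_1$ is the degree-one component of $D$; it is the first coefficient ideal of $I$. $\mathrm{adj}(L)$ denotes the adjoint of $L$ in the sense of Lipman: for a regular domain $R$ with fraction field $Q$, $\mathrm{adj}(L)=\bigcap_v\{r\in Q: v(r)\ge v(L)-v(\mathcal J_{R_v/R})\}$, where $v$ ranges over all divisorial valuations of $Q$ nonnegative on $R$ with valuation ring $R_v$ essentially of finite type over $R$, and $\mathcal J_{R_v/R}$ is the Jacobian ideal (the $0$-th Fitting ideal of $\Omega_{R_v/R}$). For a monomial ideal $L$ in a polynomial ring in $d$ variables, a theorem of Howald (see also Huneke–Swanson) describes $\mathrm{adj}(L)$ as the monomial ideal with exponent set $\{\alpha\in\mathbb Z_{\ge0}^d:\alpha+(1,\ldots,1)\in \mathrm{NP}^{\circ}(L)\}$,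 where $\mathrm{NP}^\circ(L)$ is the interior of the Newton polyhedron of $L$ (the convex hull in $\mathbb R^d$ of the exponents of all monomials in $L$). *)

theory Defs
  imports
    "HOL-Library.Poly_Mapping"
    "HOL-Library.Numeral_Type"
    "HOL-Library.Extended_Nat"
    "HOL-Computational_Algebra.Fraction_Field"
    "Jordan_Normal_Form.Determinant"
begin

section \<open>Ideals, reductions and the core\<close>

text \<open>Ideals of a whole ring type are the submodules of the ring over itself.\<close>

abbreviation is_ideal :: "'a::comm_ring_1 set \<Rightarrow> bool" where
  "is_ideal \<equiv> Modules.module.subspace (*)"

abbreviation ideal_gen :: "'a::comm_ring_1 set \<Rightarrow> 'a set" where
  "ideal_gen \<equiv> Modules.module.span (*)"

definition ideal_mult :: "'a::comm_ring_1 set \<Rightarrow> 'a set \<Rightarrow> 'a set" where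
  "ideal_mult I J = ideal_gen {a * b | a b. a \<in> I \<and> b \<in> J}"

primrec ideal_pow :: "'a::comm_ring_1 set \<Rightarrow> nat \<Rightarrow> 'a set" where
  "ideal_pow I 0 = UNIV"
| "ideal_pow I (Suc r) = ideal_mult I (ideal_pow I r)"

definition is_reduction :: "'a::comm_ring_1 set \<Rightarrow> 'a set \<Rightarrow> bool" where
  "is_reduction J I \<longleftrightarrow>
     is_ideal J \<and> J \<subseteq> I \<and> (\<exists>r. ideal_pow I (r + 1) = ideal_mult J (ideal_pow I r))"

definition core :: "'a::comm_ring_1 set \<Rightarrow> 'a set" where
  "core I = \<Inter>{J. is_reduction J I}"

section \<open>The first coefficient ideal\<close>

definition is_subring :: "'a::comm_ring_1 set \<Rightarrow> bool" where
  "is_subring A \<longleftrightarrow> 1 \<in> A \<and> (\<forall>a\<in>A. \<forall>b\<in>A. a - b \<in> A \<and> a * b \<in> A)"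

text \<open>The Laurent polynomial ring \<open>R[t, t\<inverse>]\<close> is the type \<open>int \<Rightarrow>\<^sub>0 'a\<close>: the element
  \<open>single d r\<close> is \<open>r t^d\<close>, and multiplication is convolution.\<close>

definition ext_Rees :: "'a::comm_ring_1 set \<Rightarrow> (int \<Rightarrow>\<^sub>0 'a) set" where
  "ext_Rees J = is_subring hull
     (range (Poly_Mapping.single 0) \<union> Poly_Mapping.single 1 ` J \<union> {Poly_Mapping.single (-1) 1})"

definition colon :: "'a::comm_ring_1 set \<Rightarrow> 'a set \<Rightarrow> 'a set" where
  "colon A M = {f. \<forall>g\<in>M. f * g \<in> A}"

text \<open>\<open>first_coeff_ideal J I\<close> is the first coefficient ideal of \<open>I\<close>, computed with the reduction
  \<open>J\<close> of \<open>I\<close>.\<close>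

definition first_coeff_ideal :: "'a::comm_ring_1 set \<Rightarrow> 'a set \<Rightarrow> 'a set" where
  "first_coeff_ideal J I =
     (let A = ext_Rees J; B = ext_Rees I; D = colon A (colon A B)
      in {r. Poly_Mapping.single 1 r \<in> D})"

section \<open>Submodules, Kaehler differentials and Fitting ideals over a subring\<close>

text \<open>The valuation rings of a field are subsets of that field, so modules over them are taken
  over a subring \<open>B\<close> of the ring of scalars.\<close>

definition submodule_over ::
    "'a::comm_ring_1 set \<Rightarrow> ('a \<Rightarrow> 'm::ab_group_add \<Rightarrow> 'm) \<Rightarrow> 'm set \<Rightarrow> bool" where
  "submodule_over B scale N \<longleftrightarrow>
     0 \<in> N \<and> (\<forall>x\<in>N. \<forall>y\<in>N. x + y \<in> N) \<and> (\<forall>c\<in>B. \<forall>x\<in>N. scale c x \<in> N)"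

text \<open>The zeroth Fitting ideal of the finitely generated \<open>B\<close>-module \<open>F / N\<close>, where \<open>N \<subseteq> F\<close> are
  \<open>B\<close>-submodules of an ambient module: for generators \<open>g\<^sub>0, \<dots>, g\<^sub>n\<^sub>-\<^sub>1\<close> it is generated by the
  determinants of the \<open>n \<times> n\<close> matrices whose rows are relations among the generators.  Since the
  result does not depend on the generators, all finite generating families are used at once.\<close>

definition Fitting0 ::
    "'a::comm_ring_1 set \<Rightarrow> ('a \<Rightarrow> 'm::ab_group_add \<Rightarrow> 'm) \<Rightarrow> 'm set \<Rightarrow> 'm set \<Rightarrow> 'a set" where
  "Fitting0 B scale F N = submodule_over B (*) hull
     {det A | A gs.
        set gs \<subseteq> F \<and> submodule_over B scale hull (set gs \<union> N) = F \<and>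
        A \<in> carrier_mat (length gs) (length gs) \<and> elements_mat A \<subseteq> B \<and>
        (\<forall>i < length gs. (\<Sum>j < length gs. scale (A $$ (i, j)) (gs ! j)) \<in> N)}"

text \<open>\<open>\<Omega>\<^bsub>B/R\<^esub>\<close> is presented as \<open>kaehler_free B / kaehler_rel R B\<close>: the free \<open>B\<close>-module on symbols
  \<open>d b\<close> for \<open>b \<in> B\<close> (here \<open>single b 1\<close>), modulo additivity, the Leibniz rule and \<open>d r = 0\<close> for
  \<open>r \<in> R\<close>.  The additive structure on the indices of \<open>'a \<Rightarrow>\<^sub>0 'a\<close> plays no role.\<close>

definition pm_scale :: "'a::comm_ring_1 \<Rightarrow> ('b \<Rightarrow>\<^sub>0 'a) \<Rightarrow> ('b \<Rightarrow>\<^sub>0 'a)" where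
  "pm_scale c f = Poly_Mapping.map ((*) c) f"

definition kaehler_free :: "'a::comm_ring_1 set \<Rightarrow> ('a \<Rightarrow>\<^sub>0 'a) set" where
  "kaehler_free B =
     {f. Poly_Mapping.keys f \<subseteq> B \<and> (\<forall>b. Poly_Mapping.lookup f b \<in> B)}"

definition kaehler_rel :: "'a::comm_ring_1 set \<Rightarrow> 'a set \<Rightarrow> ('a \<Rightarrow>\<^sub>0 'a) set" where
  "kaehler_rel R B = (let d = (\<lambda>b. Poly_Mapping.single b 1) in
     submodule_over B pm_scale hull
       ({d (b + c) - d b - d c | b c. b \<in> B \<and> c \<in> B} \<union>
        {d (b * c) - pm_scale b (d c) - pm_scale c (d b) | b c. b \<in> B \<and> c \<in> B} \<union>
        d ` R))"

definition Jacobian_ideal :: "'a::comm_ring_1 set \<Rightarrow> 'a set \<Rightarrow> 'a set" where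
  "Jacobian_ideal R B = Fitting0 B pm_scale (kaehler_free B) (kaehler_rel R B)"

section \<open>Divisorial valuations and the adjoint\<close>

text \<open>Normalized discrete valuations of rank one; the value at \<open>0\<close> (which should be \<open>\<infinity>\<close>) is
  irrelevant.\<close>

definition discrete_valuation :: "('q::field \<Rightarrow> int) \<Rightarrow> bool" where
  "discrete_valuation v \<longleftrightarrow>
     (\<forall>a b. a \<noteq> 0 \<and> b \<noteq> 0 \<longrightarrow> v (a * b) = v a + v b) \<and>
     (\<forall>a b. a \<noteq> 0 \<and> b \<noteq> 0 \<and> a + b \<noteq> 0 \<longrightarrow> min (v a) (v b) \<le> v (a + b)) \<and>
     v ` (- {0}) = UNIV"

definition val_ring :: "('q::field \<Rightarrow> int) \<Rightarrow> 'q set" where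
  "val_ring v = {a. a = 0 \<or> 0 \<le> v a}"

definition val_max :: "('q::field \<Rightarrow> int) \<Rightarrow> 'q set" where
  "val_max v = {a. a = 0 \<or> 0 < v a}"

text \<open>The minimum of \<open>v\<close> on a nonzero ideal of a ring on which \<open>v\<close> is nonnegative.\<close>

definition val_ideal :: "('q::field \<Rightarrow> int) \<Rightarrow> 'q set \<Rightarrow> int" where
  "val_ideal v L = Inf (v ` (L - {0}))"

definition is_prime_in :: "'a::comm_ring_1 set \<Rightarrow> 'a set \<Rightarrow> bool" where
  "is_prime_in R P \<longleftrightarrow>
     P \<subset> R \<and> submodule_over R (*) P \<and> (\<forall>a\<in>R. \<forall>b\<in>R. a * b \<in> P \<longrightarrow> a \<in> P \<or> b \<in> P)"

definition height :: "'a::comm_ring_1 set \<Rightarrow> 'a set \<Rightarrow> enat" where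
  "height R P = Sup {enat r | r c.
     (\<forall>i\<le>r. is_prime_in R (c i)) \<and> (\<forall>i<r. c i \<subset> c (Suc i)) \<and> c r = P}"

definition mpoly_eval :: "'a::comm_ring_1 list \<Rightarrow> ((nat \<Rightarrow>\<^sub>0 nat) \<Rightarrow>\<^sub>0 'a) \<Rightarrow> 'a" where
  "mpoly_eval us f = (\<Sum>e\<in>Poly_Mapping.keys f.
     Poly_Mapping.lookup f e * (\<Prod>i<length us. us ! i ^ Poly_Mapping.lookup e i))"

text \<open>The residues in \<open>R\<^sub>v / \<mm>\<^sub>v\<close> of elements \<open>us\<close> of \<open>R\<^sub>v\<close> are algebraically independent over the
  field of fractions of \<open>R / \<pp>\<close>, with \<open>\<pp> = R \<inter> \<mm>\<^sub>v\<close> the center of \<open>v\<close>; denominators are cleared.\<close>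

definition residues_alg_indep :: "'q::field set \<Rightarrow> ('q \<Rightarrow> int) \<Rightarrow> 'q list \<Rightarrow> bool" where
  "residues_alg_indep R v us \<longleftrightarrow>
     (\<forall>f. (\<forall>e. Poly_Mapping.lookup f e \<in> R) \<and>
          (\<forall>e\<in>Poly_Mapping.keys f. Poly_Mapping.keys e \<subseteq> {..<length us}) \<and>
          mpoly_eval us f \<in> val_max v
        \<longrightarrow> (\<forall>e. Poly_Mapping.lookup f e \<in> val_max v))"

definition residue_trdeg :: "'q::field set \<Rightarrow> ('q \<Rightarrow> int) \<Rightarrow> enat" where
  "residue_trdeg R v =
     Sup {enat (length us) | us. set us \<subseteq> val_ring v \<and> residues_alg_indep R v us}"

text \<open>Divisorial valuations (prime divisors) with respect to \<open>R\<close>: \<open>v\<close> is nonnegative on \<open>R\<close> and the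
  residue field of \<open>v\<close> has transcendence degree \<open>ht \<pp> - 1\<close> over that of the center \<open>\<pp>\<close>.\<close>

definition divisorial_valuation :: "'q::field set \<Rightarrow> ('q \<Rightarrow> int) \<Rightarrow> bool" where
  "divisorial_valuation R v \<longleftrightarrow>
     discrete_valuation v \<and> R \<subseteq> val_ring v \<and>
     height R (R \<inter> val_max v) = residue_trdeg R v + 1"

text \<open>A subring \<open>B\<close> of a field is essentially of finite type over \<open>R\<close> if it is a localization
  of some \<open>R[G]\<close>, \<open>G\<close> finite.\<close>

definition ess_finite_type :: "'q::field set \<Rightarrow> 'q set \<Rightarrow> bool" where
  "ess_finite_type R B \<longleftrightarrow>
     (\<exists>G W. finite G \<and> W \<subseteq> is_subring hull (R \<union> G) \<and>
        1 \<in> W \<and> 0 \<notin> W \<and> (\<forall>s\<in>W. \<forall>t\<in>W. s * t \<in> W) \<and>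
        B = {a / s | a s. a \<in> is_subring hull (R \<union> G) \<and> s \<in> W})"

text \<open>The adjoint of a nonzero ideal \<open>L\<close> of a regular domain \<open>R\<close>, given as a subring of its field of
  fractions.\<close>

definition adjoint :: "'q::field set \<Rightarrow> 'q set \<Rightarrow> 'q set" where
  "adjoint R L = {r. \<forall>v. divisorial_valuation R v \<and> ess_finite_type R (val_ring v) \<longrightarrow>
     r = 0 \<or> v r \<ge> val_ideal v L - val_ideal v (Jacobian_ideal R (val_ring v))}"

section \<open>The polynomial ring in three variables\<close>

type_synonym 'k poly3 = "(3 \<Rightarrow>\<^sub>0 nat) \<Rightarrow>\<^sub>0 'k"

text \<open>\<open>mon i j l\<close> is \<open>x^i y^j z^l\<close>.\<close>

definition mon :: "nat \<Rightarrow> nat \<Rightarrow> nat \<Rightarrow> 'k::field poly3" where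
  "mon i j l = Poly_Mapping.single
     (Poly_Mapping.single 0 i + Poly_Mapping.single 1 j + Poly_Mapping.single 2 l) 1"

definition tdeg :: "(3 \<Rightarrow>\<^sub>0 nat) \<Rightarrow> nat" where
  "tdeg e = (\<Sum>i\<in>UNIV. Poly_Mapping.lookup e i)"

definition max_ideal :: "'k::field poly3 set" where
  "max_ideal = ideal_gen {mon 1 0 0, mon 0 1 0, mon 0 0 1}"

definition pure_power_ideal :: "nat \<Rightarrow> 'k::field poly3 set" where
  "pure_power_ideal n = ideal_gen {mon n 0 0, mon 0 n 0, mon 0 0 n}"

definition edge_ideal :: "nat \<Rightarrow> nat set \<Rightarrow> nat set \<Rightarrow> nat set \<Rightarrow> 'k::field poly3 set" where
  "edge_ideal n ks ls ms = ideal_gen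
     ({mon n 0 0, mon 0 n 0, mon 0 0 n} \<union>
      (\<lambda>k. mon (n - k) k 0) ` ks \<union> (\<lambda>l. mon (n - l) 0 l) ` ls \<union> (\<lambda>m. mon 0 (n - m) m) ` ms)"

definition subalg :: "nat \<Rightarrow> nat \<Rightarrow> nat \<Rightarrow> 'k::field poly3 set" where
  "subalg a b c = is_subring hull
     (range (Poly_Mapping.single 0) \<union> {mon a 0 0, mon 0 b 0, mon 0 0 c})"

definition K_ideal :: "nat \<Rightarrow> 'k::field poly3 set \<Rightarrow> 'k poly3 set" where
  "K_ideal n S = ideal_gen {mon i j l | i j l. mon i j l \<in> S \<and> i + j + l = n}"

text \<open>The generating set is \<open>S\<^sub>\<ge>\<^sub>n\<close>, for a graded subring \<open>S\<close>.\<close>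

definition L_ideal :: "nat \<Rightarrow> 'k::field poly3 set \<Rightarrow> 'k poly3 set" where
  "L_ideal n S = ideal_gen {f \<in> S. \<forall>e\<in>Poly_Mapping.keys f. n \<le> tdeg e}"

end

theory Submission
  imports Defs
    "HOL-Computational_Algebra.Computational_Algebra"
    "HOL-Computational_Algebra.Field_as_Ring"
    "HOL-Algebra.Exponent"
    "HOL-Number_Theory.Cong"
begin

text \<open>
  Write \<open>J = (x^n, y^n, z^n)\<close>. The condition \<open>a = b = c = 1\<close> enters twice: modulo \<open>n\<close>, every exponent of
  total degree divisible by \<open>n\<close> is a sum of exponents of generators of \<open>I\<close>; and for every prime \<open>p\<close>
  two suitable sides of the triangle carry generators whose position is not divisible by \<open>p\<close>.

  (a) A monomial \<open>x^e\<close> lies in \<open>J^j\<close> iff \<open>\<Sum>\<lfloor>e_i / n\<rfloor> \<ge> j\<close>. Among exponents of given degree this only depends on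
  the residues modulo \<open>n\<close>, so by the first fact an element of \<open>A : B\<close> multiplies every monomial of degree \<open>n\<close>,
  placed in degree one, into \<open>A\<close>; hence \<open>\<mm>^n\<close> is contained in the first coefficient ideal.

  (b) Let \<open>V\<close> be the space of forms of degree \<open>n\<close> occurring in a reduction. Two general elements of \<open>V\<close> have no
  common factor on the line \<open>x = 0\<close>, so modulo them multiplication by \<open>x\<close> is injective, and surjective onto
  degrees \<open>\<ge> 2n - 1\<close>. Since \<open>V\<close> generates a power of \<open>\<mm>\<close>, it generates \<open>\<mm>^(3n-2)\<close>.
  Conversely, for almost all \<open>\<tau>\<close> the ideal \<open>(x_i^n - \<tau> g_i)\<close>, with \<open>g_i\<close> in the span of the generators, is a
  reduction, so the residue of \<open>u dx dy dz\<close> with respect to it vanishes for a form \<open>u\<close> of degree \<open>3n - 3\<close> in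
  the core. Expanding in \<open>\<tau>\<close> and varying the \<open>g_i\<close>, with exponents chosen so that the binomial
  coefficients that occur are units (second fact), isolates every coefficient of \<open>u\<close>.

  For the adjoint, Howald's theorem is replaced by explicit valuations. If \<open>\<mu>\<close> is the least value of a variable, the
  derivations \<open>\<partial>/\<partial>X_i\<close> show that the Jacobian ideal has value at least \<open>2 \<mu>\<close>, while \<open>I^3\<close> has value at most
  \<open>3n \<mu>\<close>; this gives \<open>\<mm>^(3n-2) \<subseteq> adj(I^3)\<close>. The other inclusion only needs the valuations at prime elements,
  whose Jacobian ideals are trivial, and the order valuation at the origin, whose Jacobian ideal contains \<open>x^2\<close>.
\<close>

text \<open>The number \<open>3n - 3 = 3(n - 1)\<close> is the degree of \<open>(xyz)^(n-1)\<close>,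
  the socle monomial modulo \<open>(x^n, y^n, z^n)\<close>: it bounds the total of three remainders
  modulo \<open>n\<close>, and it is the degree on which the residue lives. The residue is at first
  only a power series in \<tau>, whereas being a reduction concerns single values of \<tau>. The two
  are joined by inverting a matrix \<open>1 - \<tau> N\<close> through its adjugate: up to the
  series of \<open>(xyz)^(n-1)\<close> and a determinant with value 1 at 0, residues of forms are
  polynomials in \<tau>, and these vanish if they have infinitely many zeros. The same inversion
  shows that almost all perturbations are reductions. Isolating coefficients is obstructed by
  positive characteristic \<open>p\<close>, where binomial coefficients vanish. Monomials are split
  off in powers of some \<open>q = p^T\<close>; since \<open>q\<close> is 1 modulo two edge
  positions \<open>c1\<close>, \<open>c3\<close>, weighted sums of exponents solve the same
  congruences as plain sums. Hence \<open>c1\<close> and \<open>c3\<close> must be prime to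
  \<open>p\<close>. In (a), the inclusion in \<open>\<mm>^n\<close> is asymptotic:
  \<open>x^(3n-3)\<close> multiplies \<open>B\<close> into \<open>A\<close> and \<open>D\<close>
  acts on \<open>A : B\<close>, so for \<open>r t\<close> in \<open>D\<close> all products
  \<open>r^s x^(3n-3)\<close> have order at least \<open>n s\<close>.\<close>

abbreviation "lookup \<equiv> Poly_Mapping.lookup"
abbreviation "keys \<equiv> Poly_Mapping.keys"
abbreviation "single \<equiv> Poly_Mapping.single"

text \<open>A copy of a field with the classes of a Euclidean ring with gcd, so that iterated polynomial
  rings over it are factorial rings in the sense of the library.\<close>

typedef 'k fc = "UNIV :: 'k set" by auto
setup_lifting type_definition_fc

instantiation fc :: (field) field
begin
lift_definition zero_fc :: "'a fc" is 0 .
lift_definition one_fc :: "'a fc" is 1 .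
lift_definition plus_fc :: "'a fc \<Rightarrow> 'a fc \<Rightarrow> 'a fc" is "(+)" .
lift_definition minus_fc :: "'a fc \<Rightarrow> 'a fc \<Rightarrow> 'a fc" is "(-)" .
lift_definition times_fc :: "'a fc \<Rightarrow> 'a fc \<Rightarrow> 'a fc" is "(*)" .
lift_definition divide_fc :: "'a fc \<Rightarrow> 'a fc \<Rightarrow> 'a fc" is "(/)" .
lift_definition uminus_fc :: "'a fc \<Rightarrow> 'a fc" is uminus .
lift_definition inverse_fc :: "'a fc \<Rightarrow> 'a fc" is inverse .
instance
  by standard (transfer; auto simp: algebra_simps divide_inverse)+
end

instantiation fc :: (field) "{unique_euclidean_ring, normalization_euclidean_semiring, normalization_semidom_multiplicative}"
begin
definition [simp]: "normalize_fc = (normalize_field :: 'a fc \<Rightarrow> _)"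
definition [simp]: "unit_factor_fc = (unit_factor_field :: 'a fc \<Rightarrow> _)"
definition [simp]: "modulo_fc = (mod_field :: 'a fc \<Rightarrow> _)"
definition [simp]: "euclidean_size_fc = (euclidean_size_field :: 'a fc \<Rightarrow> _)"
definition [simp]: "division_segment (x :: 'a fc) = 1"
instance
  by standard
    (simp_all add: dvd_field_iff field_split_simps split: if_splits)
end

instantiation fc :: (field) euclidean_ring_gcd
begin
definition gcd_fc :: "'a fc \<Rightarrow> 'a fc \<Rightarrow> 'a fc" where
  "gcd_fc = Euclidean_Algorithm.gcd"
definition lcm_fc :: "'a fc \<Rightarrow> 'a fc \<Rightarrow> 'a fc" where
  "lcm_fc = Euclidean_Algorithm.lcm"
definition Gcd_fc :: "'a fc set \<Rightarrow> 'a fc" where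
  "Gcd_fc = Euclidean_Algorithm.Gcd"
definition Lcm_fc :: "'a fc set \<Rightarrow> 'a fc" where
  "Lcm_fc = Euclidean_Algorithm.Lcm"
instance by standard (simp_all add: gcd_fc_def lcm_fc_def Gcd_fc_def Lcm_fc_def)
end

instance fc :: (field) field_gcd ..

section \<open>Monomial ideals\<close>

declare One_nat_def [simp del]

interpretation ideal: Modules.module "(*) :: 'a::comm_ring_1 \<Rightarrow> 'a \<Rightarrow> 'a"
  by standard (auto simp: algebra_simps)

text \<open>As a rewrite rule, this instance of associativity loops with \<open>mult.assoc\<close>.\<close>
declare ideal.scale_scale [simp del]

lemma UNIV_3: "UNIV = {0, 1, 2 :: 3}"
proof -
  have "card {0, 1, 2 :: 3} = 3" by simp
  then show ?thesis
    by (intro card_seteq[symmetric]) auto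
qed

lemma pm_induct [case_names single add]:
  assumes "\<And>e c. P (single e c)" "\<And>f g. P f \<Longrightarrow> P g \<Longrightarrow> P (f + g)"
  shows "P (f :: 'a \<Rightarrow>\<^sub>0 'b::comm_monoid_add)"
proof -
  have 0: "P 0" using assms(1)[of undefined 0] by simp
  have eq: "f = (\<Sum>e\<in>keys f. single e (lookup f e))" for f :: "'a \<Rightarrow>\<^sub>0 'b"
    by (rule poly_mapping_eqI) (auto simp: lookup_sum lookup_single when_def in_keys_iff)
  have "P (\<Sum>e\<in>A. single e (g e))" if "finite A" for A g
    using that by induction (auto intro: assms 0)
  then show ?thesis by (metis eq finite_keys)
qed

text \<open>Additive extension from monomials. Evaluations, graded components, partial derivatives
  and maps on differentials are all built from it, so additivity is checked once, in
  \<open>lin_add\<close>.\<close>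

definition lin :: "('a \<Rightarrow> 'b \<Rightarrow> 'c) \<Rightarrow> ('a \<Rightarrow>\<^sub>0 'b::zero) \<Rightarrow> 'c::comm_monoid_add" where
  "lin g f = (\<Sum>e\<in>keys f. g e (lookup f e))"

lemma lin_superset:
  assumes "\<And>e. g e 0 = 0" "finite A" "keys f \<subseteq> A"
  shows "lin g f = (\<Sum>e\<in>A. g e (lookup f e))"
  unfolding lin_def by (rule sum.mono_neutral_left) (use assms in \<open>auto simp: in_keys_iff\<close>)

lemma lin_single [simp]: "g e 0 = 0 \<Longrightarrow> lin g (single e c) = g e c"
  by (auto simp: lin_def)

lemma lin_add:
  fixes g :: "'a \<Rightarrow> 'b::comm_monoid_add \<Rightarrow> 'c::comm_monoid_add"
  assumes "\<And>e. g e 0 = 0" "\<And>e a b. g e (a + b) = g e a + g e b"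
  shows "lin g (p + q) = lin g p + lin g q"
proof -
  let ?A = "keys p \<union> keys q"
  have "lin g (p + q) = (\<Sum>e\<in>?A. g e (lookup (p + q) e))"
    by (rule lin_superset) (use assms keys_add[of p q] in auto)
  then show ?thesis
    by (simp add: lookup_add assms sum.distrib lin_superset[where A = ?A])
qed

lemma prod_3: "prod f (UNIV :: 3 set) = f 0 * f 1 * (f 2 :: 'a::comm_monoid_mult)"
  unfolding UNIV_3 by (simp add: mult.assoc)

lemma sum_3: "sum f (UNIV :: 3 set) = f 0 + f 1 + (f 2 :: 'a::comm_monoid_add)"
  unfolding UNIV_3 by (simp add: add.assoc)

lemma all_3: "(\<forall>i::3. P i) \<longleftrightarrow> P 0 \<and> P 1 \<and> P 2"
  using UNIV_3 by (metis UNIV_I empty_iff insert_iff)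

lemma ex3_eqI:
  "lookup e 0 = lookup f 0 \<Longrightarrow> lookup e 1 = lookup f 1
    \<Longrightarrow> lookup e 2 = lookup f 2 \<Longrightarrow> e = (f :: 3 \<Rightarrow>\<^sub>0 nat)"
  using all_3[of "\<lambda>i. lookup e i = lookup f i"] by (auto intro: poly_mapping_eqI)

locale ring_map =
  fixes h :: "'a::comm_ring_1 \<Rightarrow> 'b::comm_ring_1"
  assumes h_add: "h (a + b) = h a + h b" and h_mult: "h (a * b) = h a * h b" and h_1: "h 1 = 1"
begin
lemma h_0 [simp]: "h 0 = 0" using h_add[of 0 0] by simp
lemma h_minus: "h (- a) = - h a" using h_add[of a "-a"] by (simp add: eq_neg_iff_add_eq_0 add.commute)
lemma h_diff: "h (a - b) = h a - h b" using h_add[of a "-b"] by (simp add: h_minus)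
end

definition ev :: "('a::comm_ring_1 \<Rightarrow> 'b::comm_ring_1) \<Rightarrow> (3 \<Rightarrow> 'b) \<Rightarrow> ((3 \<Rightarrow>\<^sub>0 nat) \<Rightarrow>\<^sub>0 'a) \<Rightarrow> 'b" where
  "ev h x = lin (\<lambda>e c. h c * (\<Prod>i\<in>UNIV. x i ^ lookup e i))"

lemma (in ring_map) ev_single [simp]:
  "ev h x (single e c) = h c * (\<Prod>i\<in>UNIV. x i ^ lookup e i)"
  unfolding ev_def by (subst lin_single) auto

lemma (in ring_map) ev_ring_map: "ring_map (ev h x)"
proof
  show add: "ev h x (a + b) = ev h x a + ev h x b" for a b
    unfolding ev_def by (rule lin_add) (auto simp: h_add algebra_simps)
  show "ev h x 1 = 1" using ev_single[of x 0 1] by (simp add: h_1)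
  show "ev h x (a * b) = ev h x a * ev h x b" for a b
  proof (induction a rule: pm_induct)
    case (single e c)
    show ?case
      by (induction b rule: pm_induct)
        (auto simp: mult_single h_mult lookup_add power_add prod.distrib distrib_left add)
  qed (auto simp: add distrib_right)
qed

type_synonym ex3 = "3 \<Rightarrow>\<^sub>0 nat"

abbreviation mo :: "ex3 \<Rightarrow> 'k::field poly3" where "mo e \<equiv> single e 1"
abbreviation eps :: "3 \<Rightarrow> ex3" where "eps i \<equiv> single i 1"
abbreviation cst :: "'k \<Rightarrow> 'k::field poly3" where "cst c \<equiv> single 0 c"

lemma tdeg_3: "tdeg e = lookup e 0 + lookup e 1 + lookup e 2"
  by (simp add: tdeg_def sum_3)

lemma tdeg_add [simp]: "tdeg (e + f) = tdeg e + tdeg f"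
  by (simp add: tdeg_def lookup_add sum.distrib)

lemma tdeg_0 [simp]: "tdeg 0 = 0"
  by (simp add: tdeg_def)

lemma tdeg_eq_0_iff: "tdeg e = 0 \<longleftrightarrow> e = 0"
  by (auto simp: tdeg_3 intro!: ex3_eqI)

lemma tdeg_single [simp]: "tdeg (single i m) = m"
  by (simp add: tdeg_def lookup_single when_def)

lemma single_eq_mult: "single e c = cst c * mo e"
  by (simp add: mult_single)

lemma poly3_sum: "f = (\<Sum>e\<in>keys f. single e (lookup f e))"
  by (rule poly_mapping_eqI) (auto simp: lookup_sum lookup_single when_def in_keys_iff)

lemma lookup_mo_mult [simp]: "lookup (mo e * f) (e + d) = lookup f d"
proof (induction f rule: pm_induct)
  case (single d' c)
  show ?case by (auto simp: mult_single lookup_single when_def)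
qed (simp add: distrib_left lookup_add)

lemma keys_mo_mult: "keys (mo e * f) = (+) e ` keys f"
proof
  show "keys (mo e * f) \<subseteq> (+) e ` keys f"
    using keys_mult[of "mo e" f] by auto
qed (auto simp: in_keys_iff)

text \<open>The monomial ideal with generating exponents \<open>G\<close>, described by supports so
  that membership is a question about exponents; \<open>ideal_gen_mo\<close> identifies it with the
  generated ideal.\<close>

definition mi :: "ex3 set \<Rightarrow> 'k::field poly3 set" where
  "mi G = {f. \<forall>e\<in>keys f. \<exists>g\<in>G. \<exists>h. e = g + h}"

definition setadd :: "ex3 set \<Rightarrow> ex3 set \<Rightarrow> ex3 set" where
  "setadd G H = {g + h | g h. g \<in> G \<and> h \<in> H}"

text \<open>Exponents of products of \<open>r\<close> generators. By \<open>ideal_pow_mi\<close>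
  they generate the \<open>r\<close>-th power of \<open>mi G\<close>, which turns powers of ideals
  into sums of exponents.\<close>

primrec nsum :: "nat \<Rightarrow> ex3 set \<Rightarrow> ex3 set" where
  "nsum 0 G = {0}"
| "nsum (Suc r) G = setadd G (nsum r G)"

lemma ideal_mi: "is_ideal (mi G)"
  unfolding ideal.subspace_def
proof (safe)
  show "0 \<in> mi G" by (simp add: mi_def)
  show "x + y \<in> mi G" if "x \<in> mi G" "y \<in> mi G" for x y
    using that keys_add[of x y] unfolding mi_def by blast
  show "c * x \<in> mi G" if "x \<in> mi G" for c x
  proof -
    have "\<exists>g\<in>G. \<exists>h. e = g + h" if e: "e \<in> keys (c * x)" for e
    proof -
      obtain a b where ab: "e = a + b" "b \<in> keys x"
        using e keys_mult[of c x] by blast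
      then obtain g h where "g \<in> G" "b = g + h" using \<open>x \<in> mi G\<close> by (auto simp: mi_def)
      then show ?thesis using ab by (metis add.left_commute)
    qed
    then show ?thesis by (simp add: mi_def)
  qed
qed

lemma single_in_mi: "g \<in> G \<Longrightarrow> single (g + h) c \<in> mi G"
  by (auto simp: mi_def)

lemma mi_subset_ideal:
  assumes "is_ideal A" "\<And>g. g \<in> G \<Longrightarrow> mo g \<in> A" shows "mi G \<subseteq> A"
proof
  fix f :: "'a poly3" assume f: "f \<in> mi G"
  have "single e (lookup f e) \<in> A" if "e \<in> keys f" for e
  proof -
    obtain g h where g: "g \<in> G" "e = g + h" using f \<open>e \<in> _\<close> by (auto simp: mi_def)
    have "single e (lookup f e) = single h (lookup f e) * mo g"
      by (simp add: mult_single g add.commute)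
    then show ?thesis using assms g by (metis ideal.subspace_scale)
  qed
  then have "(\<Sum>e\<in>keys f. single e (lookup f e)) \<in> A"
    using assms(1) by (intro ideal.subspace_sum) auto
  then show "f \<in> A" using poly3_sum[of f] by simp
qed

lemma ideal_gen_mo: "ideal_gen (mo ` G) = mi G"
proof
  show "ideal_gen (mo ` G) \<subseteq> mi G"
    by (rule ideal.span_minimal) (auto simp: ideal_mi intro: single_in_mi[of _ _ 0, simplified])
  show "mi G \<subseteq> ideal_gen (mo ` G)"
    by (rule mi_subset_ideal) (auto intro: ideal.span_base ideal.subspace_span)
qed

lemma is_ideal_mult: "is_ideal (ideal_mult I J)"
  unfolding ideal_mult_def by (rule ideal.subspace_span)

lemma ideal_multI: "a \<in> I \<Longrightarrow> b \<in> J \<Longrightarrow> a * b \<in> ideal_mult I J"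
  unfolding ideal_mult_def by (rule ideal.span_base) auto

lemma ideal_mult_minimal:
  "is_ideal A \<Longrightarrow> (\<And>a b. a \<in> I \<Longrightarrow> b \<in> J \<Longrightarrow> a * b \<in> A) \<Longrightarrow> ideal_mult I J \<subseteq> A"
  unfolding ideal_mult_def by (rule ideal.span_minimal) auto

lemma ideal_mult_mono: "I \<subseteq> I' \<Longrightarrow> J \<subseteq> J' \<Longrightarrow> ideal_mult I J \<subseteq> ideal_mult I' J'"
  by (rule ideal_mult_minimal) (auto intro: is_ideal_mult ideal_multI)

lemma is_ideal_pow: "is_ideal (ideal_pow I r)"
  by (cases r) (auto simp: ideal.subspace_UNIV is_ideal_mult)

lemma ideal_pow_mono: "I \<subseteq> I' \<Longrightarrow> ideal_pow I r \<subseteq> ideal_pow I' r"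
  by (induction r) (simp_all add: ideal_mult_mono)

lemma ideal_mult_mi: "ideal_mult (mi G) (mi H) = mi (setadd G H)"
proof
  show "ideal_mult (mi G :: 'a poly3 set) (mi H) \<subseteq> mi (setadd G H)"
  proof (rule ideal_mult_minimal[OF ideal_mi])
    fix a b :: "'a poly3" assume ab: "a \<in> mi G" "b \<in> mi H"
    show "a * b \<in> mi (setadd G H)"
      unfolding mi_def mem_Collect_eq
    proof
      fix e assume "e \<in> keys (a * b)"
      then obtain x y where xy: "e = x + y" "x \<in> keys a" "y \<in> keys b"
        using subsetD[OF keys_mult[of a b], of e] by blast
      then obtain g h g' h' where "x = g + h" "g \<in> G" "y = g' + h'" "g' \<in> H"
        using ab unfolding mi_def by blast
      then have "e = (g + g') + (h + h')" "g + g' \<in> setadd G H"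
        using xy by (auto simp: setadd_def ac_simps)
      then show "\<exists>g\<in>setadd G H. \<exists>h. e = g + h" by blast
    qed
  qed
  show "mi (setadd G H) \<subseteq> ideal_mult (mi G :: 'a poly3 set) (mi H)"
  proof (rule mi_subset_ideal[OF is_ideal_mult])
    fix e assume "e \<in> setadd G H"
    then obtain g h where gh: "e = g + h" "g \<in> G" "h \<in> H" by (auto simp: setadd_def)
    then have "mo g * mo h \<in> ideal_mult (mi G :: 'a poly3 set) (mi H)"
      by (intro ideal_multI) (auto intro: single_in_mi[of _ _ 0, simplified])
    then show "mo e \<in> ideal_mult (mi G :: 'a poly3 set) (mi H)"
      by (simp add: gh mult_single)
  qed
qed

lemma ideal_pow_mi: "ideal_pow (mi G) r = mi (nsum r G)"
proof (induction r)
  case 0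
  show ?case by (simp add: mi_def)
qed (simp add: ideal_mult_mi)

text \<open>The power \<open>\<mm>^d\<close> (see \<open>max_ideal_pow\<close>), in the form in
  which orders and lowest forms can be read off.\<close>

definition Mge :: "nat \<Rightarrow> 'k::field poly3 set" where
  "Mge d = {f. \<forall>e\<in>keys f. d \<le> tdeg e}"

lemma ex3_decomp:
  assumes "d \<le> tdeg e" shows "\<exists>g h. e = g + h \<and> tdeg g = d"
  using assms
proof (induction d)
  case (Suc d)
  then obtain g h where gh: "e = g + h" "tdeg g = d" by auto
  then have "tdeg h > 0" using Suc.prems by simp
  then obtain i where i: "lookup h i > 0" unfolding tdeg_def by (metis gr_zeroI less_irrefl sum.neutral)
  define h' where "h' = h - eps i"
  have "h = eps i + h'"
    by (rule poly_mapping_eqI) (use i in \<open>auto simp: h'_def lookup_add lookup_minus lookup_single when_def\<close>)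
  then show ?case using gh by (intro exI[of _ "g + eps i"] exI[of _ h']) (auto simp: ac_simps)
qed (auto intro: exI[of _ 0])

lemma Mge_mi: "Mge d = mi {e. tdeg e = d}"
proof -
  have "d \<le> tdeg e \<longleftrightarrow> (\<exists>g\<in>{e. tdeg e = d}. \<exists>h. e = g + h)" for e
    using ex3_decomp[of d e] by auto
  then show ?thesis unfolding Mge_def mi_def by blast
qed

lemma sums_eps: "nsum d (range eps) = {e. tdeg e = d}"
proof (induction d)
  case (Suc d)
  have "\<exists>i h. e = eps i + h \<and> tdeg h = d" if e: "tdeg e = Suc d" for e :: ex3
  proof -
    obtain g h where gh: "e = g + h" "tdeg g = 1" using ex3_decomp[of 1 e] e by (auto simp: One_nat_def)
    then obtain i where "g = eps i"
    proof -
      have "\<exists>i. lookup g i > 0" using gh unfolding tdeg_def by (metis gr_zeroI sum.neutral zero_neq_one)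
      then obtain i where i: "lookup g i > 0" ..
      have "g = eps i + (g - eps i)"
        by (rule poly_mapping_eqI) (use i in \<open>auto simp: lookup_add lookup_minus lookup_single when_def\<close>)
      moreover from this have "tdeg (g - eps i) = 0" using gh(2) by (metis add_left_cancel add.right_neutral tdeg_add tdeg_single)
      ultimately have "g = eps i" using tdeg_eq_0_iff by (metis add.right_neutral)
      then show thesis using that by blast
    qed
    then show ?thesis using gh e by auto
  qed
  then show ?case using Suc by (auto simp: setadd_def) (blast+)?
qed (auto simp: tdeg_eq_0_iff)

lemma max_ideal_mi: "max_ideal = mi (range eps)"
proof -
  have "range eps = {eps 0, eps 1, eps 2}" by (simp add: UNIV_3)
  then show ?thesis
    unfolding max_ideal_def mon_def ideal_gen_mo[symmetric] by simp
qed

lemma max_ideal_pow: "ideal_pow max_ideal d = Mge d"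
  by (simp add: max_ideal_mi ideal_pow_mi sums_eps Mge_mi)

lemma ideal_Mge: "is_ideal (Mge d)" by (simp add: Mge_mi ideal_mi)

lemma Mge_0 [simp]: "Mge 0 = UNIV" by (simp add: Mge_def)

lemma Mge_antimono: "d \<le> d' \<Longrightarrow> Mge d' \<subseteq> Mge d"
  by (force simp: Mge_def)

lemma Mge_mult: "f \<in> Mge a \<Longrightarrow> g \<in> Mge b \<Longrightarrow> f * g \<in> Mge (a + b)"
  using keys_mult[of f g] unfolding Mge_def by (fastforce intro: add_mono)

lemma Mge_power: "f \<in> Mge a \<Longrightarrow> f ^ m \<in> Mge (m * a)"
  by (induction m) (auto intro: Mge_mult)

lemma Mge_prod: "finite A \<Longrightarrow> (\<And>x. x \<in> A \<Longrightarrow> f x \<in> Mge (d x)) \<Longrightarrow> prod f A \<in> Mge (sum d A)"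
  by (induction A rule: finite_induct) (auto intro: Mge_mult)

section \<open>Homogeneous components\<close>

definition hc :: "nat \<Rightarrow> 'k::field poly3 \<Rightarrow> 'k poly3" where
  "hc d f = lin (\<lambda>e c. if tdeg e = d then single e c else 0) f"

lemma hc_add: "hc d (f + g) = hc d f + hc d g"
  unfolding hc_def by (rule lin_add) (auto simp: single_add)

lemma lookup_hc: "lookup (hc d f) e = (if tdeg e = d then lookup f e else 0)"
proof (induction f rule: pm_induct)
  case (single e' c)
  show ?case unfolding hc_def by (subst lin_single) (auto simp: lookup_single when_def)
qed (auto simp: hc_add lookup_add)

lemma hc_0 [simp]: "hc d 0 = 0" by (simp add: hc_def lin_def)

lemma hc_sum: "hc d (sum f A) = (\<Sum>x\<in>A. hc d (f x))"
  by (induction A rule: infinite_finite_induct) (auto simp: hc_add)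

definition hom :: "nat \<Rightarrow> 'k::field poly3 set" where
  "hom d = {f. \<forall>e\<in>keys f. tdeg e = d}"

lemma hc_hom: "hc d f \<in> hom d"
  by (auto simp: hom_def in_keys_iff lookup_hc split: if_splits)

lemma hc_eq: "f \<in> hom d \<Longrightarrow> hc d f = f"
  by (rule poly_mapping_eqI) (auto simp: lookup_hc hom_def in_keys_iff)

lemma hom_Mge: "hom d \<subseteq> Mge d"
  by (auto simp: hom_def Mge_def)

lemma hom_0 [simp]: "0 \<in> hom d" by (simp add: hom_def)

lemma hom_add: "f \<in> hom d \<Longrightarrow> g \<in> hom d \<Longrightarrow> f + g \<in> hom d"
  using keys_add[of f g] by (auto simp: hom_def)

lemma hom_sum: "(\<And>x. x \<in> A \<Longrightarrow> f x \<in> hom d) \<Longrightarrow> sum f A \<in> hom d"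
  by (induction A rule: infinite_finite_induct) (auto intro: hom_add)

lemma hom_mult: "f \<in> hom a \<Longrightarrow> g \<in> hom b \<Longrightarrow> f * g \<in> hom (a + b)"
  using keys_mult[of f g] by (fastforce simp: hom_def)

lemma hom_uminus: "f \<in> hom d \<Longrightarrow> - f \<in> hom d"
  by (auto simp: hom_def in_keys_iff)

lemma hom_diff: "f \<in> hom d \<Longrightarrow> g \<in> hom d \<Longrightarrow> f - g \<in> hom d"
  using hom_add[of f d "- g"] hom_uminus[of g d] by simp

lemma hom_single: "tdeg e = d \<Longrightarrow> single e c \<in> hom d"
  by (auto simp: hom_def)

lemma hc_Mge_Suc: "f \<in> Mge (Suc d) \<Longrightarrow> hc d f = 0"
proof (rule poly_mapping_eqI)
  fix e assume "f \<in> Mge (Suc d)"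
  then have "tdeg e = d \<Longrightarrow> e \<notin> keys f" by (auto simp: Mge_def)
  then show "lookup (hc d f) e = lookup 0 e"
    by (simp add: lookup_hc in_keys_iff)
qed

lemma diff_hc: "f \<in> Mge d \<Longrightarrow> f - hc d f \<in> Mge (Suc d)"
  by (force simp: Mge_def in_keys_iff lookup_minus lookup_hc split: if_splits)

lemma Mge_Suc_iff: "f \<in> Mge (Suc d) \<longleftrightarrow> f \<in> Mge d \<and> hc d f = 0"
  using diff_hc[of f d] hc_Mge_Suc[of f d] Mge_antimono[of d "Suc d"] by auto

text \<open>Lowest forms multiply: the remainders \<open>f - hc a f\<close> and
  \<open>g - hc b g\<close> contribute in higher degree only.\<close>

lemma hc_mult:
  assumes "f \<in> Mge a" "g \<in> Mge b" shows "hc (a + b) (f * g) = hc a f * hc b g"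
proof -
  define f' g' where "f' = f - hc a f" and "g' = g - hc b g"
  have f': "f' \<in> Mge (Suc a)" and g': "g' \<in> Mge (Suc b)"
    using assms by (auto simp: f'_def g'_def diff_hc)
  have "f * g = hc a f * hc b g + (hc a f * g' + f' * g)"
    by (simp add: f'_def g'_def algebra_simps)
  moreover have "hc a f * g' \<in> Mge (Suc (a + b))"
    using Mge_mult[OF subsetD[OF hom_Mge hc_hom[of a f]] g'] by simp
  moreover have "f' * g \<in> Mge (Suc (a + b))"
    using Mge_mult[OF f' assms(2)] by simp
  ultimately show ?thesis
    by (simp add: hc_add hc_Mge_Suc hc_eq hom_mult hc_hom)
qed

text \<open>Order at the origin. At 0 it is the minimum of an empty set, so statements about it are
  restricted to nonzero polynomials.\<close>

definition ordm :: "'k::field poly3 \<Rightarrow> nat" where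
  "ordm f = Min (tdeg ` keys f)"

lemma Mge_iff_ordm: "f \<noteq> 0 \<Longrightarrow> f \<in> Mge d \<longleftrightarrow> d \<le> ordm f"
  by (auto simp: ordm_def Mge_def)

lemma ordm_unique: "hc d f \<noteq> 0 \<Longrightarrow> f \<in> Mge d \<Longrightarrow> ordm f = d"
  using Mge_iff_ordm[of f "Suc d"] Mge_iff_ordm[of f d] Mge_Suc_iff[of f d]
  by (metis hc_0 le_antisym not_less_eq_eq)

lemma hc_ordm: "f \<noteq> 0 \<Longrightarrow> hc (ordm f) f \<noteq> 0"
  using Mge_iff_ordm[of f "Suc (ordm f)"] Mge_iff_ordm[of f "ordm f"] Mge_Suc_iff[of f "ordm f"] by auto

lemma ordm_mult: "f \<noteq> 0 \<Longrightarrow> g \<noteq> 0 \<Longrightarrow> ordm (f * g) = ordm f + ordm g"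
proof (rule ordm_unique)
  assume nz: "f \<noteq> 0" "g \<noteq> 0"
  then have m: "f \<in> Mge (ordm f)" "g \<in> Mge (ordm g)" by (auto simp: Mge_iff_ordm)
  then show "f * g \<in> Mge (ordm f + ordm g)" by (rule Mge_mult)
  show "hc (ordm f + ordm g) (f * g) \<noteq> 0" using nz by (simp add: hc_mult m hc_ordm)
qed

lemma inj_ex3: "inj (\<lambda>e::ex3. (lookup e 0, lookup e 1, lookup e 2))"
  by (rule injI) (auto intro: ex3_eqI)

lemma finite_box: "finite {e::ex3. \<forall>i. lookup e i < m}"
  and card_box: "card {e::ex3. \<forall>i. lookup e i < m} \<le> m ^ 3"
proof -
  let ?f = "\<lambda>e::ex3. (lookup e 0, lookup e 1, lookup e 2)"
  let ?B = "{e::ex3. \<forall>i. lookup e i < m}"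
  have sub: "?f ` ?B \<subseteq> {..<m} \<times> {..<m} \<times> {..<m}" by auto
  have inj: "inj_on ?f ?B" using inj_ex3 inj_on_subset by blast
  show "finite ?B" by (rule inj_on_finite[OF inj sub]) auto
  show "card ?B \<le> m ^ 3"
    using card_inj_on_le[OF inj sub] by (simp add: power3_eq_cube mult.assoc)
qed

lemma finite_tdeg [simp]: "finite {e. tdeg e = d}"
  and card_tdeg: "card {e. tdeg e = d} \<le> (d + 1) ^ 2"
proof -
  let ?f = "\<lambda>e::ex3. (lookup e 0, lookup e 1)"
  let ?B = "{e. tdeg e = d}"
  have sub: "?f ` ?B \<subseteq> {..<d + 1} \<times> {..<d + 1}" by (auto simp: tdeg_3)
  have inj: "inj_on ?f ?B" by (rule inj_onI) (auto simp: tdeg_3 intro: ex3_eqI)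
  show "finite ?B" by (rule inj_on_finite[OF inj sub]) auto
  show "card ?B \<le> (d + 1) ^ 2"
    using card_inj_on_le[OF inj sub] by (simp add: power2_eq_square)
qed

section \<open>Part (a): Rees algebras, the first coefficient ideal, and the arithmetic of the
  exponents\<close>

section \<open>Extended Rees algebras\<close>

lemma is_subring_hull: "is_subring (is_subring hull S)"
  by (rule hull_in) (auto simp: is_subring_def)

lemma subring_0: "is_subring A \<Longrightarrow> 0 \<in> A"
  unfolding is_subring_def by (metis diff_self)

lemma subring_uminus: "is_subring A \<Longrightarrow> a \<in> A \<Longrightarrow> - a \<in> A"
  using subring_0[of A] unfolding is_subring_def by (metis diff_0)

lemma subring_add: "is_subring A \<Longrightarrow> a \<in> A \<Longrightarrow> b \<in> A \<Longrightarrow> a + b \<in> A"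
  using subring_uminus[of A b] unfolding is_subring_def by (metis diff_minus_eq_add)

lemma subring_diff: "is_subring A \<Longrightarrow> a \<in> A \<Longrightarrow> b \<in> A \<Longrightarrow> a - b \<in> A"
  and subring_mult: "is_subring A \<Longrightarrow> a \<in> A \<Longrightarrow> b \<in> A \<Longrightarrow> a * b \<in> A"
  and subring_1: "is_subring A \<Longrightarrow> 1 \<in> A"
  by (auto simp: is_subring_def)

lemma subring_sum: "is_subring A \<Longrightarrow> (\<And>x. x \<in> X \<Longrightarrow> f x \<in> A) \<Longrightarrow> sum f X \<in> A"
  by (induction X rule: infinite_finite_induct) (auto simp: subring_0 subring_add)

lemma subring_power: "is_subring A \<Longrightarrow> a \<in> A \<Longrightarrow> a ^ m \<in> A"
  by (induction m) (auto simp: subring_1 subring_mult)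

lemma subring_prod: "is_subring A \<Longrightarrow> (\<And>x. x \<in> X \<Longrightarrow> f x \<in> A) \<Longrightarrow> prod f X \<in> A"
  by (induction X rule: infinite_finite_induct) (auto simp: subring_1 subring_mult)

lemma ideal_pow_add_mem: "a \<in> ideal_pow J i \<Longrightarrow> b \<in> ideal_pow J j \<Longrightarrow> a * b \<in> ideal_pow J (i + j)"
proof (induction i arbitrary: a b)
  case 0
  then show ?case by (simp add: ideal.subspace_scale is_ideal_pow)
next
  case (Suc i)
  have "is_ideal K \<Longrightarrow> is_ideal {a. a * b \<in> K}" for K
    unfolding ideal.subspace_def mem_Collect_eq distrib_right mult.assoc mult_zero_left by blast
  then have "is_ideal {a. a * b \<in> ideal_pow J (Suc i + j)}"
    using is_ideal_pow by blast
  then have "ideal_mult J (ideal_pow J i) \<subseteq> {a. a * b \<in> ideal_pow J (Suc i + j)}"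
  proof (rule ideal_mult_minimal, safe)
    fix x y assume "x \<in> J" "y \<in> ideal_pow J i"
    then show "x * y * b \<in> ideal_pow J (Suc i + j)"
      using ideal_multI[OF _ Suc.IH[of y b], of x J] Suc.prems
      by (simp only: mult.assoc add_Suc ideal_pow.simps)
  qed
  then show ?case using Suc.prems by auto
qed

lemma ideal_mult_subset_right: "is_ideal K \<Longrightarrow> ideal_mult J K \<subseteq> K"
  by (rule ideal_mult_minimal) (auto intro: ideal.subspace_scale)

lemma ideal_pow_antimono: "i \<le> j \<Longrightarrow> ideal_pow J j \<subseteq> ideal_pow J i"
proof (induction j)
  case (Suc j)
  then show ?case using ideal_mult_subset_right[OF is_ideal_pow[of J j], of J] by (cases "i = Suc j") auto
qed auto

lemma ideal_pow_1: "is_ideal J \<Longrightarrow> ideal_pow J 1 = J"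
proof
  assume "is_ideal J"
  then show "ideal_pow J 1 \<subseteq> J"
    by (simp add: One_nat_def) (rule ideal_mult_minimal, simp_all, metis mult.commute ideal.subspace_scale)
  show "J \<subseteq> ideal_pow J 1"
  proof
    fix a assume "a \<in> J"
    then have "a * 1 \<in> ideal_mult J UNIV" by (rule ideal_multI) simp
    then show "a \<in> ideal_pow J 1" unfolding One_nat_def ideal_pow.simps by simp
  qed
qed

lemma pm_sum: "f = (\<Sum>e\<in>keys f. single e (lookup f e))"
  by (rule poly_mapping_eqI) (auto simp: lookup_sum lookup_single when_def in_keys_iff)

lemma nat_add_le: "nat (i + j) \<le> nat i + nat j"
  by simp

text \<open>Negative degrees fit in because \<open>nat d\<close> is 0 there; products of mixed sign
  stay inside since \<open>nat (i + j) \<le> nat i + nat j\<close> and the powers of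
  \<open>J\<close> decrease.\<close>

lemma ext_Rees_eq:
  assumes J: "is_ideal J"
  shows "ext_Rees J = {f. \<forall>d. lookup f d \<in> ideal_pow J (nat d)}" (is "_ = ?R")
proof
  have mult: "f * g \<in> ?R" if fg: "f \<in> ?R" "g \<in> ?R" for f g
  proof -
    have "f * g = (\<Sum>i\<in>keys f. \<Sum>j\<in>keys g.
        single (i + j) (lookup f i * lookup g j))"
      using arg_cong2[OF pm_sum[of f] pm_sum[of g], of "(*)"] by (simp add: sum_product mult_single)
    moreover have "lookup f i * lookup g j \<in> ideal_pow J (nat (i + j))" for i j
      using ideal_pow_add_mem[of "lookup f i" J "nat i" "lookup g j" "nat j"] fg
        ideal_pow_antimono[of "nat (i + j)" "nat i + nat j" J] nat_add_le[of i j] by blast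
    ultimately show ?thesis
      by (auto simp: lookup_sum lookup_single when_def is_ideal_pow ideal.subspace_0
          intro!: ideal.subspace_sum)
  qed
  have "is_subring ?R"
    unfolding is_subring_def
  proof (intro conjI ballI)
    show "1 \<in> ?R" by (auto simp: lookup_one when_def is_ideal_pow ideal.subspace_0)
  qed (use mult in \<open>auto simp: lookup_minus is_ideal_pow ideal.subspace_diff\<close>)
  moreover have "single 1 a \<in> ?R" if "a \<in> J" for a
    using that ideal_pow_1[OF J, unfolded One_nat_def]
    by (auto simp: lookup_single when_def is_ideal_pow ideal.subspace_0 simp del: ideal_pow.simps)
  ultimately show "ext_Rees J \<subseteq> ?R"
    unfolding ext_Rees_def
    by (intro hull_minimal) (auto simp: lookup_single when_def is_ideal_pow ideal.subspace_0)
  let ?H = "is_subring hull (range (single 0) \<union> single 1 ` J \<union> {single (-1) 1})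
    :: (int \<Rightarrow>\<^sub>0 'a) set"
  have H: "is_subring ?H" by (rule is_subring_hull)
  have base: "single 0 a \<in> ?H" "b \<in> J \<Longrightarrow> single 1 b \<in> ?H"
    "single (-1) 1 \<in> ?H" for a b
    by (auto intro: hull_inc)
  have pos: "a \<in> ideal_pow J r \<Longrightarrow> single (int r) a \<in> ?H" for r a
  proof (induction r arbitrary: a)
    case (Suc r)
    have "is_ideal {a. single (int (Suc r)) a \<in> ?H}"
      unfolding ideal.subspace_def
    proof (safe, goal_cases)
      case 1 show ?case using subring_0[OF H] by simp
    next
      case (2 x y) then show ?case using subring_add[OF H] by (simp add: single_add)
    next
      case (3 c x)
      then show ?case using subring_mult[OF H base(1)[of c]] by (force simp: mult_single)
    qed
    then have "ideal_mult J (ideal_pow J r) \<subseteq> {a. single (int (Suc r)) a \<in> ?H}"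
    proof (rule ideal_mult_minimal)
      fix a b assume "a \<in> J" "b \<in> ideal_pow J r"
      then show "a * b \<in> {a. single (int (Suc r)) a \<in> ?H}"
        using subring_mult[OF H base(2)[of a] Suc.IH[of b]] by (simp add: mult_single)
    qed
    then show ?case using Suc.prems by auto
  qed (use base in auto)
  have neg: "single (- int r) a \<in> ?H" for r a
  proof (induction r)
    case (Suc r)
    then show ?case using subring_mult[OF H _ base(3)] by (force simp: mult_single algebra_simps)
  qed (use base in auto)
  show "?R \<subseteq> ext_Rees J"
  proof
    fix f assume f: "f \<in> ?R"
    have "single d (lookup f d) \<in> ?H" for d
    proof (cases "d \<ge> 0")
      case True
      then show ?thesis using pos[of "lookup f d" "nat d"] f by auto
    next
      case False
      then show ?thesis using neg[of "nat (- d)" "lookup f d"] by auto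
    qed
    then show "f \<in> ext_Rees J"
      unfolding ext_Rees_def by (subst pm_sum) (rule subring_sum[OF H], auto)
  qed
qed

lemma lookup_single_mult:
  "lookup (single d a * f) e = a * lookup f (e - d :: int)"
proof (induction f rule: pm_induct)
  case (single d' c)
  show ?case by (auto simp: mult_single lookup_single when_def)
qed (simp add: distrib_left lookup_add)

section \<open>Powers of the ideal generated by pure powers\<close>

definition nscale :: "nat \<Rightarrow> ex3 \<Rightarrow> ex3" where
  "nscale n e = Poly_Mapping.map ((*) n) e"

lemma lookup_nscale [simp]: "lookup (nscale n e) i = n * lookup e i"
  by (auto simp: nscale_def Poly_Mapping.map.rep_eq when_def)

lemma nscale_add: "nscale n (e + f) = nscale n e + nscale n f"
  by (rule poly_mapping_eqI) (simp add: lookup_add algebra_simps)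

lemma nscale_0 [simp]: "nscale n 0 = 0"
  by (rule poly_mapping_eqI) simp

lemma tdeg_nscale [simp]: "tdeg (nscale n e) = n * tdeg e"
  by (simp add: tdeg_def sum_distrib_left)

lemma nsum_nscale: "nsum s (nscale n ` G) = nscale n ` nsum s G"
proof (induction s)
  case (Suc s)
  then show ?case by (auto simp: setadd_def nscale_add image_iff) (metis nscale_add)+
qed simp

definition fl :: "nat \<Rightarrow> ex3 \<Rightarrow> nat" where
  "fl n e = (\<Sum>i\<in>UNIV. lookup e i div n)"

definition Jx :: "nat \<Rightarrow> ex3 set" where
  "Jx n = range (\<lambda>i. single i n)"

lemma Jx_eq: "Jx n = nscale n ` range eps"
proof -
  have "single i n = nscale n (eps i)" for i :: 3
    by (rule poly_mapping_eqI) (simp add: lookup_single when_def)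
  then show ?thesis by (auto simp: Jx_def)
qed

text \<open>The variable with index \<open>i\<close> supplies \<open>lookup e i div n\<close>
  factors that are pure \<open>n\<close>-th powers; any \<open>s\<close> of all these can be split
  off, and no more than \<open>fl n e\<close> ever can.\<close>

lemma fl_iff:
  assumes "n > 0" shows "(\<exists>g\<in>nsum s (Jx n). \<exists>h. e = g + h) \<longleftrightarrow> s \<le> fl n e"
proof
  assume "\<exists>g\<in>nsum s (Jx n). \<exists>h. e = g + h"
  then obtain t h where th: "tdeg t = s" "e = nscale n t + h"
    by (auto simp: Jx_eq nsum_nscale sums_eps)
  have "lookup t i \<le> lookup e i div n" for i
    using assms by (simp add: th lookup_add)
  then show "s \<le> fl n e" unfolding th(1)[symmetric] tdeg_def fl_def by (intro sum_mono)
next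
  assume s: "s \<le> fl n e"
  define t where "t = Poly_Mapping.map (\<lambda>x. x div n) e"
  have t: "lookup t i = lookup e i div n" for i
    by (auto simp: t_def Poly_Mapping.map.rep_eq when_def)
  then have "s \<le> tdeg t" using s by (simp add: tdeg_def fl_def)
  then obtain t1 t2 where t12: "t = t1 + t2" "tdeg t1 = s" using ex3_decomp by blast
  have le: "n * lookup t1 i \<le> lookup e i" for i
  proof -
    have "lookup t1 i \<le> lookup e i div n"
      using t[of i] by (simp add: t12(1) lookup_add)
    then have "n * lookup t1 i \<le> n * (lookup e i div n)" by simp
    then show ?thesis using times_div_less_eq_dividend[of n] order_trans by blast
  qed
  have "e = nscale n t1 + (e - nscale n t1)"
    by (rule poly_mapping_eqI) (simp add: lookup_add lookup_minus le)
  then show "\<exists>g\<in>nsum s (Jx n). \<exists>h. e = g + h"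
    using t12(2) by (auto simp: Jx_eq nsum_nscale sums_eps)
qed

lemma J_pow: "n > 0 \<Longrightarrow> ideal_pow (mi (Jx n)) s = {f. \<forall>e\<in>keys f. s \<le> fl n e}"
  unfolding ideal_pow_mi by (simp add: mi_def fl_iff)

lemma pure_power_ideal_mi: "pure_power_ideal n = mi (Jx n)"
proof -
  have "Jx n = {single 0 n, single 1 n, single 2 n}"
    unfolding Jx_def UNIV_3 by simp
  then show ?thesis unfolding pure_power_ideal_def mon_def ideal_gen_mo[symmetric] by simp
qed

text \<open>Each of the three remainders modulo \<open>n\<close> wastes at most
  \<open>n - 1\<close>; this is the origin of \<open>3 * n - 3\<close>.\<close>

lemma fl_bound:
  assumes "n > 0" "tdeg e \<ge> n * s + (3 * n - 3)" shows "s \<le> fl n e"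
proof -
  have "lookup e i \<le> n * (lookup e i div n) + (n - 1)" for i
    using mult_div_mod_eq[of n "lookup e i"] mod_less_divisor[OF assms(1), of "lookup e i"]
    by linarith
  then have "tdeg e \<le> (\<Sum>i\<in>UNIV. n * (lookup e i div n) + (n - 1))"
    unfolding tdeg_def by (intro sum_mono)
  also have "\<dots> = n * fl n e + 3 * (n - 1)"
    by (simp add: sum.distrib fl_def sum_distrib_left)
  finally have "n * s \<le> n * fl n e" using assms(2) unfolding right_diff_distrib' by linarith
  then show ?thesis using assms(1) by simp
qed

lemma Mge_J: "n > 0 \<Longrightarrow> Mge (n * s + (3 * n - 3)) \<subseteq> ideal_pow (mi (Jx n)) s"
  by (auto simp: J_pow Mge_def intro: fl_bound)

text \<open>For congruent exponents the quotients differ by the difference of the exponents over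
  \<open>n\<close>, so the change of \<open>fl\<close> is visible in the total degrees alone. The
  summand \<open>b\<close> stands for a monomial of the other factor of a product.\<close>

lemma fl_shift:
  assumes "n > 0" "tdeg s = tdeg a + n * m" "\<And>i. lookup s i mod n = lookup a i mod n"
  shows "fl n (b + s) = fl n (b + a) + m"
proof -
  have *: "int n * (int (lookup (b + s) i div n) - int (lookup (b + a) i div n))
      = int (lookup s i) - int (lookup a i)" for i
  proof -
    have "lookup (b + s) i mod n = lookup (b + a) i mod n"
      using assms(3)[of i] by (simp add: lookup_add) (metis mod_add_right_eq)
    moreover have "int n * int (x div n) = int x - int (x mod n)" for x
      by (metis add_diff_cancel_right' mult_div_mod_eq of_nat_add of_nat_mult)
    ultimately show ?thesis by (simp add: right_diff_distrib lookup_add)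
  qed
  have "int n * (int (fl n (b + s)) - int (fl n (b + a))) = int (tdeg s) - int (tdeg a)"
    using *[of 0] *[of 1] *[of 2] unfolding fl_def tdeg_def sum_3 by (simp add: algebra_simps)
  also have "\<dots> = int n * int m" using assms(2) by simp
  finally show ?thesis using assms(1) by simp
qed

lemma single_eq_0_iff [simp]: "single e c = 0 \<longleftrightarrow> c = 0"
  by (metis lookup_single_eq lookup_zero single_zero)

section \<open>The first coefficient ideal\<close>

text \<open>The two arithmetic consequences of \<open>a = b = c = 1\<close>. In \<open>cycle\<close>
  two edges meet in the vertex \<open>i1\<close> and carry generators at positions \<open>c1\<close>
  and \<open>c3\<close> prime to \<open>p\<close>; they will make a triangular pair of congruences
  modulo \<open>c1\<close> and \<open>c3\<close> solvable.\<close>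

locale edge_exponents =
  fixes n :: nat and E :: "ex3 set"
  assumes n_pos: "n > 0" and fin_E: "finite E" and deg_E: "e \<in> E \<Longrightarrow> tdeg e = n"
    and Jx_E: "Jx n \<subseteq> E"
    and residues: "n dvd tdeg a \<Longrightarrow>
      \<exists>s. \<exists>g\<in>nsum s E. \<forall>i. lookup g i mod n = lookup a i mod n"
    and cycle: "prime p \<Longrightarrow> \<exists>i1 i2 i3 c1 c3. i1 \<noteq> i2 \<and> i1 \<noteq> i3 \<and> i2 \<noteq> i3 \<and> 0 < c1 \<and> c1 \<le> n \<and> 0 < c3 \<and> c3 \<le> n \<and>
      \<not> p dvd c1 \<and> \<not> p dvd c3 \<and>
      single i1 (n - c1) + single i2 c1 \<in> E \<and>
      single i3 (n - c3) + single i1 c3 \<in> E"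
begin

lemma tdeg_nsum: "g \<in> nsum s E \<Longrightarrow> tdeg g = n * s"
  by (induction s arbitrary: g) (auto simp: setadd_def deg_E)

lemma I_Mge: "mi E \<subseteq> Mge n"
  by (rule mi_subset_ideal[OF ideal_Mge]) (auto simp: deg_E Mge_def)

lemma I_pow_Mge: "ideal_pow (mi E) s \<subseteq> Mge (n * s)"
  unfolding ideal_pow_mi by (rule mi_subset_ideal[OF ideal_Mge]) (auto simp: Mge_def tdeg_nsum)

lemma J_sub_I: "mi (Jx n) \<subseteq> mi E"
  unfolding mi_def using Jx_E by blast

lemma ordm_power: "f \<noteq> 0 \<Longrightarrow> ordm (f ^ m) = m * ordm f"
proof (induction m)
  case 0
  have "ordm (1 :: 'a poly3) = 0" by (rule ordm_unique) (auto simp: hc_eq hom_def)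
  then show ?case by simp
qed (simp add: ordm_mult)

lemma first_coeff_subset:
  "first_coeff_ideal (mi (Jx n)) (mi E :: 'k::field poly3 set) \<subseteq> Mge n"
proof
  let ?J = "mi (Jx n) :: 'k poly3 set" and ?I = "mi E :: 'k poly3 set"
  let ?A = "ext_Rees ?J" and ?B = "ext_Rees ?I"
  fix r :: "'k poly3" assume "r \<in> first_coeff_ideal ?J ?I"
  then have r: "single 1 r \<in> colon ?A (colon ?A ?B)" by (simp add: first_coeff_ideal_def Let_def)
  \<comment> \<open>By \<open>fl_bound\<close> a monomial of degree \<open>3 * n - 3\<close> moves
    \<open>\<mm>^(n s)\<close> into \<open>J^s\<close>, hence \<open>B\<close> into
    \<open>A\<close>.\<close>
  let ?c = "mo (single 0 (3 * n - 3)) :: 'k poly3"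
  have A: "?A = {f. \<forall>d. lookup f d \<in> ideal_pow ?J (nat d)}"
    and B: "?B = {f. \<forall>d. lookup f d \<in> ideal_pow ?I (nat d)}"
    by (rule ext_Rees_eq[OF ideal_mi])+
  have c: "?c \<in> Mge (3 * n - 3)" by (simp add: Mge_def)
  have subB: "is_subring ?B" unfolding ext_Rees_def by (rule is_subring_hull)
  \<comment> \<open>\<open>A : B\<close> is stable under \<open>B\<close>, so \<open>D\<close> maps
    it into itself and not merely into \<open>A\<close>. This is what permits iteration.\<close>
  have closed: "single 1 r * f \<in> colon ?A ?B" if f: "f \<in> colon ?A ?B" for f
  proof -
    have "single 1 r * f * b \<in> ?A" if b: "b \<in> ?B" for b
    proof -
      have "f * b \<in> colon ?A ?B"
        unfolding colon_def mem_Collect_eq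
      proof
        fix g assume "g \<in> ?B"
        then have "f * (b * g) \<in> ?A" using f subring_mult[OF subB b, of g] unfolding colon_def by blast
        then show "f * b * g \<in> ?A" by (simp only: mult.assoc)
      qed
      then have "single 1 r * (f * b) \<in> ?A" using r unfolding colon_def by blast
      then show ?thesis by (simp only: mult.assoc)
    qed
    then show ?thesis unfolding colon_def by blast
  qed
  have c_mem: "single 0 ?c \<in> colon ?A ?B"
    unfolding colon_def A B
  proof (clarify, subst lookup_single_mult)
    fix g d assume "\<forall>d. lookup g d \<in> ideal_pow ?I (nat d)"
    then have "lookup g d \<in> Mge (n * nat d)" using I_pow_Mge by blast
    then have "?c * lookup g d \<in> Mge (n * nat d + (3 * n - 3))"
      using Mge_mult[OF c] by (metis add.commute)
    then show "?c * lookup g (d - 0) \<in> ideal_pow ?J (nat d)"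
      using Mge_J[OF n_pos] by auto
  qed
  have pow: "single (int s) (r ^ s * ?c) \<in> colon ?A ?B" for s
  proof (induction s)
    case (Suc s)
    have "single 1 r * single (int s) (r ^ s * ?c)
        = single (int (Suc s)) (r ^ Suc s * ?c)"
      by (simp only: mult_single power_Suc mult.assoc of_nat_Suc)
    then show ?case using closed[OF Suc] by (simp only:)
  qed (use c_mem in simp)
  have mem: "r ^ s * ?c \<in> Mge (n * s)" for s
  proof -
    have "single (int s) (r ^ s * ?c) \<in> ?A"
      using pow[of s] subring_1[OF subB] by (force simp: colon_def)
    then have "r ^ s * ?c \<in> ideal_pow ?J s"
      unfolding A by (metis (mono_tags, lifting) lookup_single_eq mem_Collect_eq nat_int)
    then show ?thesis using ideal_pow_mono[OF J_sub_I] I_pow_Mge by blast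
  qed
  show "r \<in> Mge n"
  proof (cases "r = 0")
    case True
    then show ?thesis by (simp add: Mge_def)
  next
    case False
    have oc: "ordm ?c = 3 * n - 3" by (rule ordm_unique) (auto simp: hc_eq hom_single c)
    \<comment> \<open>The power \<open>3 * n - 2\<close> exceeds the order of \<open>?c\<close> by
      one, which is just enough to exclude \<open>ordm r \<le> n - 1\<close>.\<close>
    have "n * (3 * n - 2) \<le> (3 * n - 2) * ordm r + (3 * n - 3)"
    proof -
      have nz: "r ^ (3 * n - 2) \<noteq> 0" using False by simp
      have cz: "?c \<noteq> 0" by simp
      show ?thesis
        using mem[of "3 * n - 2"] Mge_iff_ordm[of "r ^ (3 * n - 2) * ?c"] nz cz
        by (simp add: ordm_mult ordm_power[OF False] oc)
    qed
    then have "n \<le> ordm r"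
    proof (rule contrapos_pp)
      assume "\<not> n \<le> ordm r"
      then have "(3 * n - 2) * (ordm r + 1) \<le> (3 * n - 2) * n" by (intro mult_left_mono) auto
      then have "(3 * n - 2) * ordm r + (3 * n - 2) \<le> n * (3 * n - 2)"
        unfolding distrib_left by (simp only: mult.commute mult_1)
      then show "\<not> n * (3 * n - 2) \<le> (3 * n - 2) * ordm r + (3 * n - 3)"
        using n_pos by linarith
    qed
    then show ?thesis using Mge_iff_ordm[OF False] by simp
  qed
qed

lemma mo_nsum: "g \<in> nsum s E \<Longrightarrow> mo g \<in> ideal_pow (mi E) s"
  unfolding ideal_pow_mi using single_in_mi[of g _ 0] by simp

lemma first_coeff_superset:
  "Mge n \<subseteq> first_coeff_ideal (mi (Jx n)) (mi E :: 'k::field poly3 set)"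
proof
  let ?J = "mi (Jx n) :: 'k poly3 set" and ?I = "mi E :: 'k poly3 set"
  let ?A = "ext_Rees ?J" and ?B = "ext_Rees ?I"
  fix r :: "'k poly3" assume r: "r \<in> Mge n"
  have A: "?A = {f. \<forall>d. lookup f d \<in> ideal_pow ?J (nat d)}"
    and B: "?B = {f. \<forall>d. lookup f d \<in> ideal_pow ?I (nat d)}"
    by (rule ext_Rees_eq[OF ideal_mi])+
  have "single 1 r * f \<in> ?A" if f: "f \<in> colon ?A ?B" for f
    unfolding A
  proof (clarify, subst lookup_single_mult)
    fix d :: int
    show "r * lookup f (d - 1) \<in> ideal_pow ?J (nat d)"
      unfolding J_pow[OF n_pos]
    proof clarify
      fix e assume "e \<in> keys (r * lookup f (d - 1))"
      then obtain a b where ab: "e = a + b" "a \<in> keys r" "b \<in> keys (lookup f (d - 1))"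
        using keys_mult[of r "lookup f (d - 1)"] by blast
      then obtain a1 a2 where a: "a = a1 + a2" "tdeg a1 = n" using ex3_decomp[of n a] r by (auto simp: Mge_def)
      \<comment> \<open>\<open>f\<close> times \<open>x^g t^s\<close> lies in \<open>A\<close>,
        which bounds \<open>fl n (g + b)\<close>; congruence modulo \<open>n\<close> then transfers
        the bound from \<open>g\<close> to \<open>a1\<close>.\<close>
      obtain s g where g: "g \<in> nsum s E" "\<forall>i. lookup g i mod n = lookup a1 i mod n"
        using residues[of a1] a by auto
      have key: "nat (d - 1 + int s) \<le> fl n (g + b)"
      proof -
        have "single (int s) (mo g) \<in> ?B"
          using mo_nsum[OF g(1)]
          by (auto simp: B lookup_single when_def is_ideal_pow ideal.subspace_0)
        then have "f * single (int s) (mo g) \<in> ?A" using f by (auto simp: colon_def)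
        then have "lookup (single (int s) (mo g) * f) (d - 1 + int s) \<in> ideal_pow ?J (nat (d - 1 + int s))"
          unfolding A by (metis (mono_tags, lifting) mem_Collect_eq mult.commute)
        then have "mo g * lookup f (d - 1) \<in> ideal_pow ?J (nat (d - 1 + int s))"
          by (simp add: lookup_single_mult)
        moreover have "g + b \<in> keys (mo g * lookup f (d - 1))"
          using ab(3) by (simp add: keys_mo_mult)
        ultimately show ?thesis unfolding J_pow[OF n_pos] by auto
      qed
      \<comment> \<open>For \<open>s = 0\<close> the degree of \<open>a1\<close> is the larger one,
        and \<open>fl_shift\<close> is applied with exchanged roles; otherwise the shift is
        \<open>s - 1\<close>.\<close>
      have "int (fl n (b + g)) = int (fl n (b + a1)) + int s - 1"
      proof (cases s)
        case 0
        then have "tdeg a1 = tdeg g + n * 1" using tdeg_nsum[OF g(1)] a by simp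
        then have "fl n (b + a1) = fl n (b + g) + 1" using g(2) by (intro fl_shift n_pos) auto
        then show ?thesis using 0 by simp
      next
        case (Suc m)
        then have "tdeg g = tdeg a1 + n * m" using tdeg_nsum[OF g(1)] a by simp
        then have "fl n (b + g) = fl n (b + a1) + m" using g(2) by (intro fl_shift n_pos) auto
        then show ?thesis using Suc by simp
      qed
      then have "d \<le> int (fl n (b + a1))" using key by (simp add: add.commute)
      also have "fl n (b + a1) \<le> fl n e"
        unfolding fl_def ab a by (intro sum_mono div_le_mono) (simp add: lookup_add)
      finally show "nat d \<le> fl n e" by simp
    qed
  qed
  then show "r \<in> first_coeff_ideal ?J ?I"
    by (simp add: first_coeff_ideal_def Let_def colon_def)
qed

lemma first_coeff: "first_coeff_ideal (mi (Jx n)) (mi E :: 'k::field poly3 set) = Mge n"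
  using first_coeff_subset first_coeff_superset by blast

end

section \<open>The exponents of the given ideal\<close>

lemma int_subgroup:
  fixes A :: "int set"
  assumes "n \<in> A" "n > 0" "\<And>a b. a \<in> A \<Longrightarrow> b \<in> A \<Longrightarrow> a - b \<in> A"
  shows "\<exists>d. A = {x. d dvd x}"
proof -
  have 0: "0 \<in> A" using assms(3)[OF assms(1,1)] by simp
  have neg: "- a \<in> A" if "a \<in> A" for a using assms(3)[OF 0 that] by simp
  have add: "a + b \<in> A" if "a \<in> A" "b \<in> A" for a b using assms(3)[OF that(1) neg[OF that(2)]] by simp
  have mulp: "int k * a \<in> A" if "a \<in> A" for k a
    by (induction k) (auto simp: 0 algebra_simps intro: add that)
  have mul: "k * a \<in> A" if "a \<in> A" for k a
  proof (cases "k \<ge> 0")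
    case True then show ?thesis using mulp[OF that, of "nat k"] by simp
  next
    case False then show ?thesis using neg[OF mulp[OF that, of "nat (- k)"]] by simp
  qed
  define d where "d = (LEAST m. m > 0 \<and> int m \<in> A)"
  have d: "d > 0 \<and> int d \<in> A" unfolding d_def by (rule LeastI[of _ "nat n"]) (use assms in auto)
  have least: "\<And>m. m > 0 \<Longrightarrow> int m \<in> A \<Longrightarrow> d \<le> m" unfolding d_def by (rule Least_le) auto
  have "int d dvd x" if "x \<in> A" for x
  proof -
    have "x mod int d = x - (x div int d) * int d" by (simp add: minus_div_mult_eq_mod)
    then have "x mod int d \<in> A" using assms(3)[OF that mul[of "int d" "x div int d"]] d by simp
    moreover have "0 \<le> x mod int d" "x mod int d < int d" using d by auto
    ultimately have "x mod int d = 0" using least[of "nat (x mod int d)"]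
      by (metis int_nat_eq le_less not_less of_nat_less_iff zero_less_nat_eq)
    then show ?thesis by auto
  qed
  moreover have "x \<in> A" if "int d dvd x" for x
    using that mul[of "int d"] d by (auto simp: mult.commute)
  ultimately show ?thesis by blast
qed

definition ex :: "nat \<Rightarrow> nat \<Rightarrow> nat \<Rightarrow> ex3" where
  "ex i j l = single 0 i + single 1 j + single 2 l"

lemma lookup_ex [simp]: "lookup (ex i j l) 0 = i" "lookup (ex i j l) 1 = j"
  "lookup (ex i j l) 2 = l"
  by (auto simp: ex_def lookup_add lookup_single when_def)

lemma tdeg_ex [simp]: "tdeg (ex i j l) = i + j + l" by (simp add: tdeg_3)

definition edge_exps :: "nat \<Rightarrow> nat set \<Rightarrow> nat set \<Rightarrow> nat set \<Rightarrow> ex3 set" where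
  "edge_exps n ks ls ms = {ex n 0 0, ex 0 n 0, ex 0 0 n} \<union>
     (\<lambda>k. ex (n - k) k 0) ` ks \<union> (\<lambda>l. ex (n - l) 0 l) ` ls \<union> (\<lambda>m. ex 0 (n - m) m) ` ms"

lemma edge_ideal_mi: "edge_ideal n ks ls ms = mi (edge_exps n ks ls ms)"
  unfolding edge_ideal_def edge_exps_def mon_def ideal_gen_mo[symmetric] ex_def
  by (simp add: image_Un image_image)

lemma nsum_add: "g \<in> nsum s E \<Longrightarrow> h \<in> nsum t E \<Longrightarrow> g + h \<in> nsum (s + t) E"
proof (induction s arbitrary: g)
  case (Suc s)
  then obtain g1 g2 where "g = g1 + g2" "g1 \<in> E" "g2 \<in> nsum s E" by (auto simp: setadd_def)
  then show ?case using Suc.IH[of g2] Suc.prems by (auto simp: setadd_def add.assoc)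
qed simp

text \<open>Modulo \<open>n\<close> the sums of generators form a group, as \<open>- g\<close> is
  congruent to \<open>(n - 1) g\<close>. Its parts along the three edge directions are generated by
  \<open>d1\<close>, \<open>d2\<close>, \<open>d3\<close>. The gcd conditions make these pairwise
  coprime, and the linear dependence of the directions makes \<open>d1\<close> and \<open>d3\<close>
  units, so that every residue is reached.\<close>

lemma edge_exponents_edge_exps:
  assumes n: "n > 0" and sub: "ks \<subseteq> {0..n}" "ls \<subseteq> {0..n}" "ms \<subseteq> {0..n}"
    and g1: "Gcd (insert n (ks \<union> ls)) = 1" and g2: "Gcd (insert n (ks \<union> ms)) = 1"
    and g3: "Gcd (insert n (ls \<union> ms)) = 1"
  shows "edge_exponents n (edge_exps n ks ls ms)"
proof
  let ?E = "edge_exps n ks ls ms"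
  show "n > 0" by fact
  show "finite ?E" using sub by (auto simp: edge_exps_def intro!: finite_imageI intro: finite_subset)
  show deg: "tdeg e = n" if "e \<in> ?E" for e
    using that sub by (auto simp: edge_exps_def)
  have pure: "single i n \<in> ?E" for i
  proof -
    have "\<forall>i. single i n \<in> {ex n 0 0, ex 0 n 0, ex 0 0 n}"
      unfolding all_3 ex_def by simp
    then show ?thesis unfolding edge_exps_def by blast
  qed
  then show "Jx n \<subseteq> ?E" by (auto simp: Jx_def)
  have tdeg: "tdeg g = n * s" if "g \<in> nsum s ?E" for g s
    using that by (induction s arbitrary: g) (auto simp: setadd_def deg)
  \<comment> \<open>Only the exponents of \<open>y\<close> and \<open>z\<close> are tracked; that of
    \<open>x\<close> modulo \<open>n\<close> follows from the total degree.\<close>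
  define Rch where "Rch a b \<longleftrightarrow> (\<exists>s. \<exists>g\<in>nsum s ?E. int n dvd int (lookup g 1) - a \<and>
     int n dvd int (lookup g 2) - b)" for a b
  have R0: "Rch 0 0" unfolding Rch_def by (rule exI[of _ 0]) simp
  have Radd: "Rch (a + c) (b + d)" if R: "Rch a b" "Rch c d" for a b c d
  proof -
    obtain s g where g: "g \<in> nsum s ?E" "int n dvd int (lookup g 1) - a" "int n dvd int (lookup g 2) - b"
      using R(1) unfolding Rch_def by blast
    obtain t h where h: "h \<in> nsum t ?E" "int n dvd int (lookup h 1) - c" "int n dvd int (lookup h 2) - d"
      using R(2) unfolding Rch_def by blast
    have "int (lookup (g + h) 1) - (a + c) = (int (lookup g 1) - a) + (int (lookup h 1) - c)"
      "int (lookup (g + h) 2) - (b + d) = (int (lookup g 2) - b) + (int (lookup h 2) - d)"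
      by (simp_all add: lookup_add)
    then show ?thesis unfolding Rch_def using nsum_add[OF g(1) h(1)] g h by (metis dvd_add)
  qed
  have Rcong: "Rch a' b'" if "Rch a b" "int n dvd a - a'" "int n dvd b - b'" for a b a' b'
    using that unfolding Rch_def by (smt (verit) dvd_add)
  have Rmul: "Rch (int k * a) (int k * b)" if "Rch a b" for a b k
  proof (induction k)
    case (Suc k)
    then show ?case using Radd[OF that Suc.IH] by (simp add: distrib_right)
  qed (use R0 in simp)
  have Rneg: "Rch (- a) (- b)" if "Rch a b" for a b
    by (rule Rcong[OF Rmul[OF that, of "n - 1"]]) (use n in \<open>auto simp: algebra_simps of_nat_diff\<close>)
  have Rdiff: "Rch (a - c) (b - d)" if "Rch a b" "Rch c d" for a b c d
    using Radd[OF that(1) Rneg[OF that(2)]] by simp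
  have Rel: "Rch (int (lookup e 1)) (int (lookup e 2))" if "e \<in> ?E" for e
    unfolding Rch_def by (rule exI[of _ 1], rule bexI[of _ e]) (use that in \<open>auto simp: One_nat_def setadd_def\<close>)
  have Rk: "Rch (int k) 0" if "k \<in> insert n ks" for k
  proof (cases "k \<in> ks")
    case True then show ?thesis using Rel[of "ex (n - k) k 0"] by (auto simp: edge_exps_def)
  next
    case False then show ?thesis using that by (intro Rcong[OF R0]) auto
  qed
  have Rl: "Rch 0 (int l)" if "l \<in> insert n ls" for l
  proof (cases "l \<in> ls")
    case True then show ?thesis using Rel[of "ex (n - l) 0 l"] by (auto simp: edge_exps_def)
  next
    case False then show ?thesis using that by (intro Rcong[OF R0]) auto
  qed
  have Rm: "Rch (- int m) (int m)" if "m \<in> insert n ms" for m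
  proof (cases "m \<in> ms")
    case True
    then have "m \<le> n" using sub by auto
    then show ?thesis using Rcong[OF Rel[of "ex 0 (n - m) m"], of "- int m" "int m"] True
      by (auto simp: edge_exps_def)
  next
    case False then show ?thesis using that by (intro Rcong[OF R0]) auto
  qed
  obtain d1 where d1: "{a. Rch a 0} = {x. d1 dvd x}"
    using int_subgroup[of "int n" "{a. Rch a 0}"] Rk[of n] n Rdiff[of _ 0 _ 0] by auto
  obtain d2 where d2: "{a. Rch 0 a} = {x. d2 dvd x}"
    using int_subgroup[of "int n" "{a. Rch 0 a}"] Rl[of n] n Rdiff[of 0 _ 0 _] by auto
  obtain d3 where d3: "{a. Rch (- a) a} = {x. d3 dvd x}"
  proof -
    have "Rch (- (a - b)) (a - b)" if "Rch (- a) a" "Rch (- b) b" for a b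
      using Rdiff[OF that] by (simp add: algebra_simps)
    then show ?thesis using that int_subgroup[of "int n" "{a. Rch (- a) a}"] Rm[of n] n by auto
  qed
  have cop: "coprime d d'" if "\<And>k. k \<in> insert n (X \<union> Y) \<Longrightarrow> d dvd int k \<or> d' dvd int k"
    "Gcd (insert n (X \<union> Y)) = 1" "\<And>k. k \<in> insert n X \<Longrightarrow> d dvd int k" "\<And>k. k \<in> insert n Y \<Longrightarrow> d' dvd int k"
    for d d' :: int and X Y
  proof (rule coprimeI)
    fix c assume c: "c dvd d" "c dvd d'"
    have "nat \<bar>c\<bar> dvd k" if "k \<in> insert n (X \<union> Y)" for k
    proof -
      have "c dvd int k" using that \<open>\<And>k. k \<in> insert n X \<Longrightarrow> d dvd int k\<close> \<open>\<And>k. k \<in> insert n Y \<Longrightarrow> d' dvd int k\<close> c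
        by (metis Un_iff dvd_trans insert_iff)
      then show ?thesis by (simp add: nat_abs_dvd_iff)
    qed
    then have "nat \<bar>c\<bar> dvd Gcd (insert n (X \<union> Y))" by (rule Gcd_greatest)
    then have "nat \<bar>c\<bar> dvd 1" using that(2) by (simp only:)
    then show "is_unit c" by simp
  qed
  have k1: "d1 dvd int k" if "k \<in> insert n ks" for k using d1 Rk[OF that] by auto
  have k2: "d2 dvd int k" if "k \<in> insert n ls" for k using d2 Rl[OF that] by auto
  have k3: "d3 dvd int k" if "k \<in> insert n ms" for k using d3 Rm[OF that] by auto
  have c12: "coprime d1 d2" by (rule cop[OF _ g1 k1 k2]) (use k1 k2 in auto)
  have c13: "coprime d1 d3" by (rule cop[OF _ g2 k1 k3]) (use k1 k3 in auto)
  have c23: "coprime d2 d3" by (rule cop[OF _ g3 k2 k3]) (use k2 k3 in auto)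
  have in1: "Rch x 0" if "d1 dvd x" for x using d1 that by auto
  have in2: "Rch 0 x" if "d2 dvd x" for x using d2 that by auto
  have in3: "Rch (- x) x" if "d3 dvd x" for x using d3 that by auto
  \<comment> \<open>Steps of length \<open>d1 * d2\<close> in the \<open>y\<close>- and
    \<open>z\<close>-directions differ by a step along the third edge, so \<open>d3\<close> divides
    \<open>d1 * d2\<close> although it is coprime to both factors.\<close>
  have "Rch (- (d1 * d2)) (d1 * d2)" using Rdiff[OF in2[of "d1 * d2"] in1[of "d1 * d2"]] by simp
  then have "d3 dvd d1 * d2" using d3 by auto
  then have u3: "is_unit d3" using c13 c23
    by (metis coprime_commute coprime_dvd_mult_left_iff coprime_common_divisor dvd_refl)
  have "Rch (d2 * d3) 0" using Rdiff[OF in2[of "d2 * d3"] in3[of "d2 * d3"]] by simp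
  then have "d1 dvd d2 * d3" using d1 by auto
  then have u1: "is_unit d1" using c12 c13
    by (metis coprime_dvd_mult_left_iff coprime_common_divisor dvd_refl)
  have all: "Rch a b" for a b
    using Radd[OF in1[of "a + b"] in3[of b]] u1 u3 by (simp add: unit_imp_dvd)
  show "\<exists>s. \<exists>g\<in>nsum s ?E. \<forall>i. lookup g i mod n = lookup a i mod n"
    if a: "n dvd tdeg a" for a
  proof -
    obtain s g where g: "g \<in> nsum s ?E" "int n dvd int (lookup g 1) - int (lookup a 1)"
      "int n dvd int (lookup g 2) - int (lookup a 2)"
      using all unfolding Rch_def by blast
    have "int n dvd int (tdeg g) - int (tdeg a)" using tdeg[OF g(1)] a by (simp add: int_dvd_int_iff)
    then have "int n dvd (int (tdeg g) - int (tdeg a)) - (int (lookup g 1) - int (lookup a 1))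
        - (int (lookup g 2) - int (lookup a 2))"
      using g(2,3) by (metis dvd_diff)
    then have "int n dvd int (lookup g 0) - int (lookup a 0)" by (simp add: tdeg_3)
    then have "\<forall>i. int n dvd int (lookup g i) - int (lookup a i)"
      unfolding all_3 using g by blast
    then have "lookup g i mod n = lookup a i mod n" for i
      by (metis mod_eq_dvd_iff of_nat_eq_iff zmod_int)
    then show ?thesis using g(1) by blast
  qed
  show "\<exists>i1 i2 i3 c1 c3. i1 \<noteq> i2 \<and> i1 \<noteq> i3 \<and> i2 \<noteq> i3 \<and> 0 < c1 \<and> c1 \<le> n \<and> 0 < c3 \<and> c3 \<le> n \<and>
      \<not> p dvd c1 \<and> \<not> p dvd c3 \<and>
      single i1 (n - c1) + single i2 c1 \<in> ?E \<and>
      single i3 (n - c3) + single i1 c3 \<in> ?E"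
    (is "\<exists>i1 i2 i3 c1 c3. ?C i1 i2 i3 c1 c3")
    if p: "prime p" for p
  proof (cases "p dvd n")
    case False
    \<comment> \<open>If \<open>p\<close> does not divide \<open>n\<close>, the vertices of the
      triangle themselves serve.\<close>
    have "?C 0 1 2 n n" using False n pure by simp
    then show ?thesis by blast
  next
    case True
    have ex_nd: "\<exists>k\<in>X. \<not> p dvd k" if "Gcd (insert n X) = 1" for X
    proof (rule ccontr)
      assume "\<not> (\<exists>k\<in>X. \<not> p dvd k)"
      then have "p dvd Gcd (insert n X)" using True by (intro Gcd_greatest) auto
      then have "p dvd 1" using that by (simp only:)
      then show False using p by simp
    qed
    have nd: "0 < k \<and> k < n \<and> \<not> p dvd n - k" if "\<not> p dvd k" "k \<le> n" for k
      using that True by (metis dvd_diffD1 dvd_0_right gr0I le_neq_implies_less)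
    have e1: "k \<in> ks \<Longrightarrow> single 0 (n - k) + single 1 k \<in> ?E"
      "k \<in> ls \<Longrightarrow> single 0 (n - k) + single 2 k \<in> ?E"
      "k \<in> ms \<Longrightarrow> single 1 (n - k) + single 2 k \<in> ?E" for k
      unfolding edge_exps_def by (auto simp: ex_def)
    \<comment> \<open>Each gcd condition concerns two edges, so at most one edge has all its
      positions divisible by \<open>p\<close>. Two other edges share a vertex, which becomes
      \<open>i1\<close>.\<close>
    consider k l where "k \<in> ks" "l \<in> ls" "\<not> p dvd k" "\<not> p dvd l"
      | k m where "k \<in> ks" "m \<in> ms" "\<not> p dvd k" "\<not> p dvd m"
      | l m where "l \<in> ls" "m \<in> ms" "\<not> p dvd l" "\<not> p dvd m"
      using ex_nd[OF g1] ex_nd[OF g2] ex_nd[OF g3] by blast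
    then show ?thesis
    proof cases
      case (1 k l)
      have kl: "k \<le> n" "l \<le> n" using 1 sub by auto
      then have "?C 0 1 2 k (n - l)" using nd[OF 1(3)] nd[OF 1(4)] 1 e1(1)[of k] e1(2)[of l]
        by (auto simp: add.commute)
      then show ?thesis by blast
    next
      case (2 k m)
      have kl: "k \<le> n" "m \<le> n" using 2 sub by auto
      then have "?C 1 0 2 (n - k) (n - m)" using nd[OF 2(3)] nd[OF 2(4)] 2 e1(1)[of k] e1(3)[of m]
        by (auto simp: add.commute)
      then show ?thesis by blast
    next
      case (3 l m)
      have kl: "l \<le> n" "m \<le> n" using 3 sub by auto
      then have "?C 2 0 1 (n - l) m" using nd[OF 3(3)] nd[OF 3(4)] 3 e1(2)[of l] e1(3)[of m]
        by (auto simp: add.commute)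
      then show ?thesis by blast
    qed
  qed
qed

text \<open>For \<open>a = b = c = 1\<close> the subring \<open>S\<close> is the whole polynomial
  ring, so \<open>K\<close> and \<open>L\<close> both become \<open>\<mm>^n\<close>.\<close>

lemma subalg_1: "subalg 1 1 1 = UNIV"
proof -
  let ?H = "subalg 1 1 1 :: 'a poly3 set"
  have H: "is_subring ?H" unfolding subalg_def by (rule is_subring_hull)
  have v: "mo (eps i) \<in> ?H" for i
  proof -
    have "\<forall>i. mo (eps i) \<in> ?H"
      unfolding all_3 subalg_def mon_def by (auto intro: hull_inc)
    then show ?thesis by blast
  qed
  have c: "cst a \<in> ?H" for a unfolding subalg_def by (auto intro: hull_inc)
  have "tdeg e = d \<Longrightarrow> mo e \<in> ?H" for e d
  proof (induction d arbitrary: e)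
    case 0 then show ?case using c[of 1] by (simp add: tdeg_eq_0_iff)
  next
    case (Suc d)
    then have "e \<in> nsum (Suc d) (range eps)" using sums_eps by blast
    then have "\<exists>g h. e = g + h \<and> g \<in> range eps \<and> tdeg h = d"
      using sums_eps[of d] by (auto simp add: setadd_def)
    then obtain i h where "e = eps i + h" "tdeg h = d" by blast
    then show ?case using subring_mult[OF H v[of i] Suc.IH[of h]] by (simp add: mult_single)
  qed
  then have "single e a \<in> ?H" for e a
    using subring_mult[OF H c[of a], of "mo e"] by (simp add: mult_single)
  then have "f \<in> ?H" for f by (subst pm_sum) (rule subring_sum[OF H])
  then show ?thesis by blast
qed

lemma K_ideal_UNIV: "K_ideal n UNIV = Mge n"
proof -
  have "{mon i j l :: 'a poly3 | i j l. mon i j l \<in> (UNIV :: 'a poly3 set) \<and> i + j + l = n} = mo ` {e. tdeg e = n}"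
  proof -
    have 1: "mon i j l = (mo (ex i j l) :: 'a poly3)" for i j l by (simp add: mon_def ex_def)
    have 2: "\<exists>i j l. e = ex i j l" for e
      by (rule exI[of _ "lookup e 0"], rule exI[of _ "lookup e 1"],
          rule exI[of _ "lookup e 2"], rule ex3_eqI) auto
    show ?thesis
    proof safe
      fix i j l assume "n = i + j + l"
      have "tdeg (ex i j l) = i + j + l" by simp
      then show "(mon i j l :: 'a poly3) \<in> mo ` {e. tdeg e = i + j + l}" unfolding 1 by blast
    next
      fix e assume "n = tdeg e"
      moreover obtain i j l where "e = ex i j l" using 2 by blast
      ultimately show "\<exists>i j l. (mo e :: 'a poly3) = mon i j l \<and> mon i j l \<in> (UNIV :: 'a poly3 set) \<and> i + j + l = tdeg e"
        by (rule_tac exI[of _ i], rule_tac exI[of _ j], rule_tac exI[of _ l]) (simp add: 1)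
    qed
  qed
  then show ?thesis unfolding K_ideal_def by (simp only: ideal_gen_mo Mge_mi)
qed

lemma L_ideal_UNIV: "L_ideal n UNIV = Mge n"
proof -
  have "{f \<in> UNIV. \<forall>e\<in>keys f. n \<le> tdeg e} = (Mge n :: 'a poly3 set)" by (simp add: Mge_def)
  moreover have "ideal_gen (Mge n) = (Mge n :: 'a poly3 set)" by (simp add: ideal.span_eq_iff ideal_Mge)
  ultimately show ?thesis unfolding L_ideal_def by metis
qed

section \<open>Part (b): every reduction contains \<open>\<mm>^(3n-2)\<close>\<close>

section \<open>Ideals generated by forms\<close>

declare single_one [simp del]

lemma hc_hom_eq: "f \<in> hom d' \<Longrightarrow> hc d f = (if d = d' then f else 0)"
  by (rule poly_mapping_eqI) (auto simp: lookup_hc hom_def in_keys_iff)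

lemma hc_mult_hom: "v \<in> hom b \<Longrightarrow> hc (a + b) (f * v) = hc a f * v"
proof (induction f rule: pm_induct)
  case (single e c)
  have "single e c * v \<in> hom (tdeg e + b)" using single by (intro hom_mult hom_single) auto
  moreover have "single e c \<in> hom (tdeg e)" by (simp add: hom_single)
  ultimately show ?case by (auto simp: hc_hom_eq)
qed (simp add: distrib_right hc_add)

lemma Abs_fc_simps: "Abs_fc 0 = 0" "Abs_fc 1 = 1" "Abs_fc (a + b) = Abs_fc a + Abs_fc b"
  "Abs_fc (a * b) = Abs_fc a * Abs_fc (b :: 'a::field)"
  by (simp_all add: zero_fc_def one_fc_def plus_fc_def times_fc_def Abs_fc_inverse)

lemma Abs_fc_eq_0_iff [simp]: "Abs_fc a = 0 \<longleftrightarrow> a = (0 :: 'a::field)"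
  by (metis Abs_fc_simps(1) Abs_fc_inverse UNIV_I)

lemma infinite_fc: "infinite (UNIV :: 'k set) \<Longrightarrow> infinite (UNIV :: 'k fc set)"
  using finite_imageI[of "UNIV :: 'k fc set" Rep_fc] by (metis Abs_fc_inverse UNIV_I finite_subset image_eqI subsetI)

text \<open>\<open>dh f = f(0, 1, z)\<close>, and \<open>hg d\<close> homogenizes with respect to \<open>y\<close>.\<close>

definition dh :: "'k::field poly3 \<Rightarrow> 'k fc poly" where
  "dh = ev (\<lambda>c. [:Abs_fc c:]) (\<lambda>i. if i = 0 then 0 else if i = 1 then 1 else [:0, 1:])"

interpretation fc_const: ring_map "\<lambda>c :: 'k::field. [:Abs_fc c:]"
  by standard (simp_all add: Abs_fc_simps)

interpretation dh: ring_map "dh :: 'k::field poly3 \<Rightarrow> 'k fc poly"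
  unfolding dh_def by (rule fc_const.ev_ring_map)

lemma dh_single: "dh (single e c) =
    (if lookup e 0 = 0 then monom (Abs_fc c) (lookup e 2) else 0)"
proof -
  have "dh (single e c) = [:Abs_fc c:] * (0 ^ lookup e 0 * [:0, 1:] ^ lookup e 2)"
    unfolding dh_def fc_const.ev_single prod_3 by simp
  then show ?thesis by (simp add: monom_altdef power_0_left)
qed

lemma dh_cst: "dh (cst c) = [:Abs_fc c:]"
  by (simp add: dh_single monom_0)

lemma dh_x: "dh (mo (eps 0)) = 0"
  by (simp add: dh_single)

lemma hc_single: "hc d (single e c) = (if tdeg e = d then single e c else 0)"
  by (rule poly_mapping_eqI) (auto simp: lookup_hc lookup_single when_def)

lemma ex_iff: "e = ex i j l \<longleftrightarrow> lookup e 0 = i \<and> lookup e 1 = j \<and> lookup e 2 = l"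
  by (auto intro: ex3_eqI)

lemma coeff_dh_hc:
  "coeff (dh (hc d f)) j = (if j \<le> d then Abs_fc (lookup f (ex 0 (d - j) j)) else 0)"
proof (induction f rule: pm_induct)
  case (single e c)
  show ?case
    by (auto simp: hc_single dh_single lookup_single when_def ex_iff tdeg_3 Abs_fc_simps)
qed (auto simp: hc_add dh.h_add lookup_add Abs_fc_simps)

lemma coeff_dh:
  "f \<in> hom d \<Longrightarrow> coeff (dh f) j = (if j \<le> d then Abs_fc (lookup f (ex 0 (d - j) j)) else 0)"
  using coeff_dh_hc[of d f j] by (simp add: hc_eq)

lemma degree_dh: "f \<in> hom d \<Longrightarrow> degree (dh f) \<le> d"
  by (rule degree_le) (simp add: coeff_dh)

definition hg :: "nat \<Rightarrow> 'k::field fc poly \<Rightarrow> 'k poly3" where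
  "hg d G = (\<Sum>j\<le>d. single (ex 0 (d - j) j) (Rep_fc (coeff G j)))"

lemma hg_hom: "hg d G \<in> hom d"
  unfolding hg_def by (intro hom_sum hom_single) simp

lemma dh_hg:
  assumes "degree G \<le> d" shows "dh (hg d G) = G"
proof (rule poly_eqI)
  fix j
  show "coeff (dh (hg d G)) j = coeff G j"
  proof (cases "j \<le> d")
    case True
    have "lookup (hg d G) (ex 0 (d - j) j) = (\<Sum>i\<le>d. if i = j then Rep_fc (coeff G i) else 0)"
      unfolding hg_def lookup_sum by (intro sum.cong) (auto simp: lookup_single when_def ex_iff)
    then show ?thesis using True by (simp add: coeff_dh[OF hg_hom] Rep_fc_inverse)
  next
    case False
    then show ?thesis using assms by (simp add: coeff_dh[OF hg_hom] coeff_eq_0)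
  qed
qed

lemma divide_var:
  assumes "\<And>e. e \<in> keys f \<Longrightarrow> lookup e i > 0"
  shows "\<exists>g. f = mo (eps i) * g"
proof -
  define g where "g = (\<Sum>e\<in>keys f. single (e - eps i) (lookup f e))"
  have "mo (eps i) * g = (\<Sum>e\<in>keys f. single e (lookup f e))"
    unfolding g_def sum_distrib_left
  proof (rule sum.cong)
    fix e assume e: "e \<in> keys f"
    have "eps i + (e - eps i) = e"
      by (rule poly_mapping_eqI) (use assms[OF e] in \<open>auto simp: lookup_add lookup_minus lookup_single when_def\<close>)
    then show "mo (eps i) * single (e - eps i) (lookup f e) = single e (lookup f e)"
      by (simp add: mult_single)
  qed simp
  then show ?thesis using poly3_sum[of f] by metis
qed

text \<open>Setting \<open>y = 1\<close> loses nothing on forms of fixed degree, so the kernel comes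
  from \<open>x = 0\<close> alone.\<close>

lemma dh_eq_0:
  assumes "f \<in> hom d" "dh f = 0" shows "\<exists>g\<in>hom (d - 1). f = mo (eps 0) * g"
proof -
  have "lookup e 0 > 0" if e: "e \<in> keys f" for e
  proof (rule ccontr)
    assume z: "\<not> ?thesis"
    define j where "j = lookup e 2"
    have "tdeg e = d" using e assms(1) by (auto simp: hom_def)
    then have "j \<le> d" "e = ex 0 (d - j) j" using z by (auto simp: tdeg_3 j_def ex_iff)
    then show False using e coeff_dh[OF assms(1), of j] assms(2) by (simp add: in_keys_iff)
  qed
  then obtain g where g: "f = mo (eps 0) * g" using divide_var by blast
  have "tdeg e = d - 1" if "e \<in> keys g" for e
  proof -
    have "eps 0 + e \<in> keys f" using that by (simp add: g keys_mo_mult)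
    then show ?thesis using assms(1) by (auto simp: hom_def)
  qed
  then show ?thesis using g by (auto simp: hom_def)
qed

text \<open>Prime avoidance for a linear space over an infinite field. If a prime \<open>q\<close>
  divides \<open>w + c v\<close> for two values of \<open>c\<close>, it divides \<open>v\<close> and
  \<open>w\<close>; hence every prime already avoided by \<open>w\<close> forbids at most one
  \<open>c\<close>.\<close>

lemma avoid_primes:
  fixes W :: "'k::field_gcd poly set"
  assumes inf: "infinite (UNIV :: 'k set)" and ne: "W \<noteq> {}"
    and add: "\<And>v w. v \<in> W \<Longrightarrow> w \<in> W \<Longrightarrow> v + w \<in> W" and sm: "\<And>c v. v \<in> W \<Longrightarrow> smult c v \<in> W"
    and P: "finite P" "\<And>p. p \<in> P \<Longrightarrow> prime_elem p" "\<And>p. p \<in> P \<Longrightarrow> \<exists>v\<in>W. \<not> p dvd v"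
  shows "\<exists>w\<in>W. \<forall>p\<in>P. \<not> p dvd w"
  using P
proof (induction P rule: finite_induct)
  case empty
  then show ?case using ne by auto
next
  case (insert p P)
  then obtain w where w: "w \<in> W" "\<forall>p\<in>P. \<not> p dvd w" by auto
  obtain v where v: "v \<in> W" "\<not> p dvd v" using insert.prems by auto
  show ?case
  proof (cases "p dvd w")
    case False
    then show ?thesis using w by auto
  next
    case True
    have "finite {c. q dvd w + smult c v}" if q: "q \<in> P" for q
    proof -
      have "c = d" if cd: "q dvd w + smult c v" "q dvd w + smult d v" for c d
      proof (rule ccontr)
        assume "c \<noteq> d"
        have "q dvd (w + smult c v) - (w + smult d v)" using cd by (rule dvd_diff)
        then have "q dvd smult (c - d) v" by (simp add: smult_diff_left)
        then have "q dvd v" using \<open>c \<noteq> d\<close> by (simp add: dvd_smult_iff)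
        then have "q dvd w" using cd(1) by (metis dvd_add_left_iff dvd_smult)
        then show False using w q by auto
      qed
      then have "{c. q dvd w + smult c v} \<subseteq> {SOME c. q dvd w + smult c v}"
        by (metis (mono_tags, lifting) mem_Collect_eq singletonI someI_ex subsetI)
      then show ?thesis using finite_subset by blast
    qed
    then have "finite (insert 0 (\<Union>q\<in>P. {c. q dvd w + smult c v}))" using insert.hyps by auto
    then obtain c where c: "c \<notin> insert 0 (\<Union>q\<in>P. {c. q dvd w + smult c v})"
      using inf ex_new_if_finite by blast
    have "\<not> p dvd w + smult c v"
      using True v(2) c by (simp add: dvd_add_right_iff dvd_smult_iff)
    then show ?thesis using c w v by (intro bexI[of _ "w + smult c v"]) (auto intro: add sm)
  qed
qed

text \<open>\<open>V\<close> will be the space of degree-\<open>n\<close> parts of a reduction. The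
  number \<open>N\<close> witnesses that \<open>V\<close> generates an ideal primary to
  \<open>\<mm>\<close>.\<close>

locale forms =
  fixes n N :: nat and V :: "'k::field poly3 set"
  assumes inf_k: "infinite (UNIV :: 'k set)" and n_pos: "n > 0" and V_hom: "V \<subseteq> hom n"
    and V_add: "v \<in> V \<Longrightarrow> w \<in> V \<Longrightarrow> v + w \<in> V" and V_sm: "v \<in> V \<Longrightarrow> cst c * v \<in> V"
    and V_gen: "Mge N \<subseteq> ideal_gen V"
begin

lemma V_ne: "V \<noteq> {}"
proof
  assume "V = {}"
  moreover have "mo (single 0 N) \<in> (Mge N :: 'k poly3 set)" by (simp add: Mge_def)
  ultimately have "mo (single 0 N) \<in> {0 :: 'k poly3}"
    using V_gen by auto
  then show False by simp
qed

text \<open>Otherwise all of \<open>V\<close> would vanish at the point (0, 0, 1). The form found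
  keeps degree \<open>n\<close> under \<open>dh\<close>, so that no common zero is lost at infinity
  of the line \<open>x = 0\<close>.\<close>

lemma monic_form: "\<exists>v\<in>V. lookup v (single 2 n) \<noteq> 0"
proof (rule ccontr)
  assume neg: "\<not> ?thesis"
  have "v \<in> mi {eps 0, eps 1}" if v: "v \<in> V" for v
    unfolding mi_def mem_Collect_eq
  proof
    fix e assume e: "e \<in> keys v"
    then have "e \<noteq> single 2 n" using neg v by (auto simp: in_keys_iff)
    moreover have "tdeg e = n" using e v V_hom by (auto simp: hom_def)
    ultimately have "lookup e 0 > 0 \<or> lookup e 1 > 0"
      by (auto simp: tdeg_3 lookup_single when_def intro!: ex3_eqI)
    then obtain i where i: "i \<in> {0, 1}" "lookup e i > 0" by auto
    have "e = eps i + (e - eps i)"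
      by (rule poly_mapping_eqI) (use i in \<open>auto simp: lookup_add lookup_minus lookup_single when_def\<close>)
    then show "\<exists>g\<in>{eps 0, eps 1}. \<exists>h. e = g + h" using i(1) by blast
  qed
  then have "ideal_gen V \<subseteq> mi {eps 0, eps 1}" by (intro ideal.span_minimal ideal_mi) auto
  moreover have "mo (single 2 N) \<in> (Mge N :: 'k poly3 set)" by (simp add: Mge_def)
  ultimately have "mo (single 2 N) \<in> (mi {eps 0, eps 1} :: 'k poly3 set)" using V_gen by blast
  then obtain i h where ih: "i \<in> {0, 1 :: 3}" "single 2 N = eps i + h" by (auto simp: mi_def)
  have "lookup (single 2 N) i = lookup (eps i + h) i" using ih(2) by simp
  then show False using ih(1) by (auto simp: lookup_add lookup_single when_def)
qed

text \<open>Since \<open>y^N\<close> maps to 1, the image of \<open>V\<close> generates the unit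
  ideal. So no prime factor of \<open>dh f1\<close> divides the whole image, and
  \<open>avoid_primes\<close> yields \<open>f2\<close>.\<close>

lemma coprime_forms:
  "\<exists>f1\<in>V. \<exists>f2\<in>V. degree (dh f1) = n \<and> coprime (dh f1) (dh f2)"
proof -
  obtain f1 where f1: "f1 \<in> V" "lookup f1 (single 2 n) \<noteq> 0" using monic_form by blast
  have hom1: "f1 \<in> hom n" using f1 V_hom by auto
  have "ex 0 0 n = single 2 n" by (simp add: ex_def)
  then have "coeff (dh f1) n \<noteq> 0" using f1(2) by (simp add: coeff_dh[OF hom1])
  then have deg: "degree (dh f1) = n" using degree_dh[OF hom1] le_degree le_antisym by blast
  then have nz: "dh f1 \<noteq> 0" using n_pos by auto
  have "is_ideal {f. dh f \<in> ideal_gen (dh ` V)}"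
    unfolding ideal.subspace_def
    by (auto simp: dh.h_add dh.h_mult ideal.span_zero ideal.span_add ideal.span_scale)
  then have "ideal_gen V \<subseteq> {f. dh f \<in> ideal_gen (dh ` V)}"
    by (intro ideal.span_minimal) (auto intro: ideal.span_base)
  moreover have "mo (single 1 N) \<in> (Mge N :: 'k poly3 set)" by (simp add: Mge_def)
  ultimately have "dh (mo (single 1 N)) \<in> ideal_gen (dh ` V)" using V_gen by blast
  then have one: "1 \<in> ideal_gen (dh ` V)" by (simp add: dh_single lookup_single Abs_fc_simps)
  let ?P = "prime_factors (dh f1)"
  have "\<exists>w\<in>dh ` V. \<forall>p\<in>?P. \<not> p dvd w"
  proof (rule avoid_primes)
    show "infinite (UNIV :: 'k fc set)" using inf_k by (rule infinite_fc)
    show "dh ` V \<noteq> {}" using V_ne by simp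
    show "v + w \<in> dh ` V" if vw: "v \<in> dh ` V" "w \<in> dh ` V" for v w
    proof -
      obtain v' w' where "v = dh v'" "w = dh w'" "v' \<in> V" "w' \<in> V" using vw by auto
      then show ?thesis using V_add[of v' w'] by (auto simp: dh.h_add[symmetric])
    qed
    show "smult c v \<in> dh ` V" if v: "v \<in> dh ` V" for c v
    proof -
      obtain v' where v': "v = dh v'" "v' \<in> V" using v by auto
      have "smult c v = dh (cst (Rep_fc c) * v')"
        by (simp add: dh.h_mult dh_cst v' Rep_fc_inverse)
      then show ?thesis using V_sm[OF v'(2)] by blast
    qed
    show "prime_elem p" if "p \<in> ?P" for p using that by (auto dest: in_prime_factors_imp_prime)
    show "\<exists>v\<in>dh ` V. \<not> p dvd v" if p: "p \<in> ?P" for p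
    proof (rule ccontr)
      assume neg: "\<not> ?thesis"
      have "ideal_gen (dh ` V) \<subseteq> {f. p dvd f}"
        by (rule ideal.span_minimal) (use neg in \<open>auto simp: ideal.subspace_def\<close>)
      then have "p dvd 1" using one by auto
      moreover have "prime p" using p by auto
      ultimately show False by auto
    qed
  qed simp
  then obtain f2 where f2: "f2 \<in> V" "\<forall>p\<in>?P. \<not> p dvd dh f2" by auto
  have "coprime (dh f1) (dh f2)"
  proof (rule ccontr)
    assume "\<not> coprime (dh f1) (dh f2)"
    then obtain c where c: "c dvd dh f1" "c dvd dh f2" "\<not> is_unit c" by (rule not_coprimeE)
    then have "c \<noteq> 0" using nz by auto
    then obtain p where p: "p dvd c" "prime p" using prime_divisor_exists c(3) by blast
    then have "p \<in> ?P" using nz c(1) by (auto simp: prime_factors_dvd)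
    then show False using f2(2) p c(2) dvd_trans by blast
  qed
  then show ?thesis using f1 f2 deg by blast
qed

lemma form_span:
  assumes "h \<in> ideal_gen V" "h \<in> hom (d + n)"
  shows "\<exists>t g. finite t \<and> t \<subseteq> V \<and> (\<forall>v. g v \<in> hom d) \<and> h = (\<Sum>v\<in>t. g v * v)"
proof -
  obtain t r where t: "finite t" "t \<subseteq> V" "h = (\<Sum>v\<in>t. r v * v)"
    using assms(1) unfolding ideal.span_explicit by blast
  have "h = hc (d + n) (\<Sum>v\<in>t. r v * v)" using assms(2) t(3) by (simp add: hc_eq)
  also have "\<dots> = (\<Sum>v\<in>t. hc d (r v) * v)"
    unfolding hc_sum by (rule sum.cong) (use t V_hom in \<open>auto intro: hc_mult_hom\<close>)
  finally show ?thesis using t by (intro exI[of _ t] exI[of _ "\<lambda>v. hc d (r v)"]) (auto simp: hc_hom)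
qed

end

locale regular_forms =
  fixes n :: nat and f1 f2 :: "'k::field poly3"
  assumes n_pos: "n > 0" and f1: "f1 \<in> hom n" and f2: "f2 \<in> hom n"
    and deg1: "degree (dh f1) = n" and cop: "coprime (dh f1) (dh f2)"
begin

text \<open>Bezout in \<open>k[z]\<close>. The cofactor of \<open>dh f2\<close> is reduced modulo
  \<open>dh f1\<close>, so its degree is below \<open>n \<le> d + 1\<close>, and the degree of the
  other cofactor is then forced. This is where the degree bound \<open>2n - 1\<close>
  arises.\<close>

lemma divide_by_x:
  assumes h: "h \<in> hom (d + n)" and d: "d + 1 \<ge> n"
  shows "\<exists>p\<in>hom d. \<exists>q\<in>hom d. \<exists>h'\<in>hom (d + n - 1). h = p * f1 + q * f2 + mo (eps 0) * h'"
proof -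
  let ?F1 = "dh f1" and ?F2 = "dh f2" and ?H = "dh h"
  have nz: "?F1 \<noteq> 0" using n_pos deg1 by auto
  obtain a b where ab: "a * ?F1 + b * ?F2 = 1"
    using cop bezout_coefficients_fst_snd[of ?F1 ?F2] by (metis coprime_iff_gcd_eq_1)
  define G2 where "G2 = (?H * b) mod ?F1"
  define G1 where "G1 = ?H * a + ((?H * b) div ?F1) * ?F2"
  have Hb: "?H * b = ((?H * b) div ?F1) * ?F1 + G2" unfolding G2_def by (rule div_mult_mod_eq[symmetric])
  have "?H = ?H * (a * ?F1 + b * ?F2)" by (simp add: ab)
  also have "\<dots> = ?H * a * ?F1 + (?H * b) * ?F2" by (simp add: algebra_simps)
  also have "\<dots> = ?H * a * ?F1 + (((?H * b) div ?F1) * ?F1 + G2) * ?F2"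
    by (rule arg_cong[where f = "\<lambda>t. ?H * a * ?F1 + t * ?F2", OF Hb])
  also have "\<dots> = G1 * ?F1 + G2 * ?F2" by (simp add: G1_def algebra_simps)
  finally have H: "?H = G1 * ?F1 + G2 * ?F2" .
  have dG2: "degree G2 \<le> d"
    using degree_mod_less'[of ?F1 "?H * b"] nz deg1 d unfolding G2_def[symmetric] by (cases "G2 = 0") auto
  have "degree (G2 * ?F2) \<le> d + n"
    using degree_mult_le[of G2 ?F2] dG2 degree_dh[OF f2] by linarith
  then have "degree (G1 * ?F1) \<le> d + n"
    using H degree_dh[OF h] degree_diff_le[of ?H "d + n" "G2 * ?F2"] by simp
  then have dG1: "degree G1 \<le> d"
    using degree_mult_eq[of G1 ?F1] nz deg1 by (cases "G1 = 0") auto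
  have "h - hg d G1 * f1 - hg d G2 * f2 \<in> hom (d + n)"
    by (intro hom_diff hom_mult hg_hom h f1 f2)
  moreover have "dh (h - hg d G1 * f1 - hg d G2 * f2) = 0"
    by (simp add: dh.h_diff dh.h_mult dh_hg dG1 dG2) (use H in simp)
  ultimately obtain h' where "h' \<in> hom (d + n - 1)" "h - hg d G1 * f1 - hg d G2 * f2 = mo (eps 0) * h'"
    using dh_eq_0 by blast
  then show ?thesis
    by (intro bexI[of _ "hg d G1"] bexI[of _ "hg d G2"] bexI[of _ h'] hg_hom) (auto simp: algebra_simps)
qed

text \<open>On \<open>x = 0\<close> coprimality makes the relation a multiple \<open>C\<close> of
  the Koszul relation. After subtraction of its homogenization both coefficients are divisible by
  \<open>x\<close>.\<close>

lemma cancel_x: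
  assumes eq: "mo (eps 0) * h = a * f1 + b * f2" and a: "a \<in> hom (d + n)" and b: "b \<in> hom (d + n)"
  shows "\<exists>a' b'. h = a' * f1 + b' * f2"
proof -
  let ?F1 = "dh f1" and ?F2 = "dh f2"
  have nz: "?F1 \<noteq> 0" using n_pos deg1 by auto
  have nz2: "?F2 \<noteq> 0"
  proof
    assume "?F2 = 0"
    then have "is_unit ?F1" using cop by simp
    then show False using n_pos deg1 nz by (simp add: is_unit_iff_degree)
  qed
  have z: "dh a * ?F1 + dh b * ?F2 = 0"
    using arg_cong[OF eq, of dh] by (simp add: dh.h_add dh.h_mult dh_x)
  then have "?F2 dvd dh a * ?F1" by (metis dvd_add_right_iff dvd_0_right dvd_triv_right add.commute)
  then have "?F2 dvd dh a" using cop by (metis coprime_commute coprime_dvd_mult_left_iff)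
  then obtain C where C: "dh a = ?F2 * C" by (auto elim: dvdE)
  then have "?F2 * (C * ?F1 + dh b) = 0" using z by (simp add: algebra_simps)
  then have B: "dh b = - C * ?F1" using nz2 by (simp add: eq_neg_iff_add_eq_0 add.commute)
  have "degree (C * ?F1) \<le> d + n" using degree_dh[OF b] B by simp
  then have dC: "degree C \<le> d" using degree_mult_eq[of C ?F1] nz deg1 by (cases "C = 0") auto
  let ?c = "hg d C"
  have "a - ?c * f2 \<in> hom (d + n)" by (intro hom_diff hom_mult hg_hom a f2)
  moreover have "dh (a - ?c * f2) = 0"
    unfolding dh.h_diff dh.h_mult dh_hg[OF dC] C by (simp add: mult.commute)
  ultimately obtain a' where a': "a - ?c * f2 = mo (eps 0) * a'" using dh_eq_0 by blast
  have "b + ?c * f1 \<in> hom (d + n)" by (intro hom_add hom_mult hg_hom b f1)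
  moreover have "dh (b + ?c * f1) = 0"
    unfolding dh.h_add dh.h_mult dh_hg[OF dC] B by simp
  ultimately obtain b' where b': "b + ?c * f1 = mo (eps 0) * b'" using dh_eq_0 by blast
  have "mo (eps 0) * h = (a - ?c * f2) * f1 + (b + ?c * f1) * f2"
    unfolding eq by (simp add: algebra_simps)
  also have "\<dots> = mo (eps 0) * (a' * f1 + b' * f2)" unfolding a' b' by (simp add: algebra_simps)
  finally show ?thesis by (metis mult_left_cancel single_eq_0_iff zero_neq_one)
qed

end

context forms
begin

text \<open>In \<open>x h = \<Sum> g v * v\<close> the coefficients have degree
  \<open>e + 1 - n \<ge> 2n - 1\<close>, so modulo \<open>f1\<close>, \<open>f2\<close> each is a
  multiple of \<open>x\<close>. Then \<open>x (h - H)\<close> lies in \<open>(f1, f2)\<close> for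
  some \<open>H\<close> in the ideal of \<open>V\<close>, and \<open>x\<close> can be
  cancelled.\<close>

lemma saturated:
  assumes h: "h \<in> hom e" and e: "e \<ge> 3 * n - 2" and xh: "mo (eps 0) * h \<in> ideal_gen V"
  shows "h \<in> ideal_gen V"
proof -
  obtain f1 f2 where f: "f1 \<in> V" "f2 \<in> V" "degree (dh f1) = n" "coprime (dh f1) (dh f2)"
    using coprime_forms by blast
  interpret regular_forms n f1 f2
    by standard (use f V_hom n_pos in auto)
  define d where "d = e + 1 - 2 * n"
  have e_eq: "e + 1 = d + n + n" and dn: "d + 1 \<ge> n" using e n_pos unfolding d_def by linarith+
  have "mo (eps 0) * h \<in> hom (1 + e)" by (intro hom_mult hom_single h) simp
  then have "mo (eps 0) * h \<in> hom ((d + n) + n)" using e_eq by (simp add: add.commute)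
  then obtain t g where t: "finite t" "t \<subseteq> V" "\<forall>v. g v \<in> hom (d + n)" "mo (eps 0) * h = (\<Sum>v\<in>t. g v * v)"
    using form_span[OF xh, of "d + n"] by auto
  have "\<forall>v. \<exists>p q h'. p \<in> hom d \<and> q \<in> hom d \<and> g v = p * f1 + q * f2 + mo (eps 0) * h'"
    using divide_by_x[OF t(3)[rule_format] dn] by blast
  then obtain p q h' where pq: "\<And>v. p v \<in> hom d" "\<And>v. q v \<in> hom d"
    "\<And>v. g v = p v * f1 + q v * f2 + mo (eps 0) * h' v" by metis
  let ?P = "\<Sum>v\<in>t. p v * v" and ?Q = "\<Sum>v\<in>t. q v * v" and ?H = "\<Sum>v\<in>t. h' v * v"
  have "mo (eps 0) * h = ?P * f1 + ?Q * f2 + mo (eps 0) * ?H"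
    unfolding t(4) by (simp add: pq(3) sum_distrib_left sum_distrib_right sum.distrib[symmetric] algebra_simps)
  then have eq: "mo (eps 0) * (h - ?H) = ?P * f1 + ?Q * f2" by (simp add: algebra_simps)
  have "?P \<in> hom (d + n)" "?Q \<in> hom (d + n)"
    by (rule hom_sum, rule hom_mult, use pq t V_hom in auto)+
  then obtain a b where "h - ?H = a * f1 + b * f2" using cancel_x[OF eq] by blast
  then have "h = a * f1 + b * f2 + ?H" by (simp add: algebra_simps)
  also have "\<dots> \<in> ideal_gen V"
    using f(1,2) t(2) by (intro ideal.span_add ideal.span_sum ideal.span_scale ideal.span_base) auto
  finally show ?thesis .
qed

lemma Mge_subset_gen: "Mge (3 * n - 2) \<subseteq> ideal_gen V"
proof -
  have sat: "h \<in> hom e \<Longrightarrow> e \<ge> 3 * n - 2 \<Longrightarrow> mo (eps 0) ^ m * h \<in> ideal_gen V \<Longrightarrow> h \<in> ideal_gen V" for h e m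
  proof (induction m arbitrary: h e)
    case (Suc m)
    have "mo (eps 0) * h \<in> hom (1 + e)" using Suc.prems(1) by (intro hom_mult hom_single) auto
    moreover have "mo (eps 0) ^ m * (mo (eps 0) * h) \<in> ideal_gen V"
      using Suc.prems(3) by (simp only: power_Suc mult.assoc mult.left_commute)
    ultimately have "mo (eps 0) * h \<in> ideal_gen V" using Suc.IH[of "mo (eps 0) * h" "1 + e"] Suc.prems(2) by simp
    then show ?case using saturated Suc.prems by blast
  qed simp
  show ?thesis
  proof
    fix f :: "'k poly3" assume f: "f \<in> Mge (3 * n - 2)"
    have "single e (lookup f e) \<in> ideal_gen V" if e: "e \<in> keys f" for e
    proof (rule sat)
      show "single e (lookup f e) \<in> hom (tdeg e)" by (simp add: hom_single)
      show "3 * n - 2 \<le> tdeg e" using f e by (auto simp: Mge_def)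
      have "mo (eps 0) ^ N * single e (lookup f e) \<in> Mge (N * 1 + 0)"
        by (intro Mge_mult Mge_power) (auto simp: Mge_def)
      then show "mo (eps 0) ^ N * single e (lookup f e) \<in> ideal_gen V" using V_gen by auto
    qed
    then show "f \<in> ideal_gen V" by (subst poly3_sum) (rule ideal.span_sum)
  qed
qed

end

section \<open>Reductions contain a power of the maximal ideal\<close>

context edge_exponents
begin

lemma reduction_superset:
  fixes J' :: "'k::field poly3 set"
  assumes inf: "infinite (UNIV :: 'k set)" and red: "is_reduction J' (mi E)"
  shows "Mge (3 * n - 2) \<subseteq> J'"
proof -
  let ?I = "mi E :: 'k poly3 set"
  obtain r where J': "is_ideal J'" "J' \<subseteq> ?I" and r: "ideal_pow ?I (r + 1) = ideal_mult J' (ideal_pow ?I r)"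
    using red by (auto simp: is_reduction_def)
  have Jn: "j \<in> Mge n" if "j \<in> J'" for j using that J'(2) I_Mge by blast
  have large: "Mge (n * (r + 1) + (3 * n - 3)) \<subseteq> ideal_mult J' (ideal_pow ?I r)"
    using Mge_J[OF n_pos, of "r + 1"] ideal_pow_mono[OF J_sub_I, of "r + 1"] r by blast
  define V where "V = hc n ` J'"
  \<comment> \<open>\<open>J' I^r\<close> lives in degrees at least \<open>n * r + n\<close>; its
    component in that degree sees only the degree-\<open>n\<close> parts of
    \<open>J'\<close>.\<close>
  have lead: "hc (n * r + n) f \<in> ideal_gen V" if f: "f \<in> ideal_mult J' (ideal_pow ?I r)" for f
  proof -
    obtain t c where t: "finite t" "t \<subseteq> {a * b |a b. a \<in> J' \<and> b \<in> ideal_pow ?I r}" "f = (\<Sum>x\<in>t. c x * x)"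
      using f unfolding ideal_mult_def ideal.span_explicit by blast
    have "hc (n * r + n) (c x * x) \<in> ideal_gen V" if x: "x \<in> t" for x
    proof -
      obtain a b where ab: "x = a * b" "a \<in> J'" "b \<in> ideal_pow ?I r" using x t by blast
      have "c x * b \<in> ideal_pow ?I r" using ab ideal.subspace_scale[OF is_ideal_pow] by blast
      then have "c x * b \<in> Mge (n * r)" using I_pow_Mge by blast
      then have "hc (n * r + n) ((c x * b) * a) = hc (n * r) (c x * b) * hc n a"
        using Jn[OF ab(2)] by (rule hc_mult)
      then have "hc (n * r + n) (c x * x) = hc (n * r) (c x * b) * hc n a"
        by (simp add: ab(1) ac_simps)
      then show ?thesis using ab(2) by (auto simp: V_def intro: ideal.span_scale ideal.span_base)
    qed
    then show ?thesis unfolding t(3) hc_sum by (rule ideal.span_sum)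
  qed
  interpret forms n "n * (r + 1) + (3 * n - 3)" V
  proof
    show "infinite (UNIV :: 'k set)" "n > 0" by (fact inf, fact n_pos)
    show "V \<subseteq> hom n" by (auto simp: V_def hc_hom)
    show "v + w \<in> V" if "v \<in> V" "w \<in> V" for v w
      using that J'(1) by (auto simp: V_def hc_add[symmetric] intro: ideal.subspace_add)
    show "cst c * v \<in> V" if v: "v \<in> V" for c v
    proof -
      obtain j where j: "j \<in> J'" "v = hc n j" using v by (auto simp: V_def)
      have "hc (0 + n) (cst c * j) = hc 0 (cst c) * hc n j"
        by (rule hc_mult) (use Jn j in auto)
      then have "cst c * v = hc n (cst c * j)" by (simp add: j hc_eq hom_single)
      then show ?thesis using j J'(1) by (auto simp: V_def intro: ideal.subspace_scale)
    qed
    \<comment> \<open>The generators of \<open>J^(r+1)\<close> are monomials of degree exactly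
      \<open>n * (r + 1)\<close> and lie in \<open>J' I^r\<close>, so \<open>lead\<close> applies to
      them unchanged.\<close>
    show "Mge (n * (r + 1) + (3 * n - 3)) \<subseteq> ideal_gen V"
      unfolding Mge_mi[of "n * (r + 1) + _"]
    proof (rule mi_subset_ideal[OF ideal.subspace_span])
      fix e assume "e \<in> {e. tdeg e = n * (r + 1) + (3 * n - 3)}"
      then have "r + 1 \<le> fl n e" by (intro fl_bound n_pos) auto
      then obtain g h where gh: "g \<in> nsum (r + 1) (Jx n)" "e = g + h" using fl_iff[OF n_pos] by blast
      have "mo g \<in> ideal_pow (mi (Jx n) :: 'k poly3 set) (r + 1)"
        unfolding ideal_pow_mi using single_in_mi[OF gh(1), of 0] by simp
      then have mem: "mo g \<in> ideal_mult J' (ideal_pow ?I r)"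
        using ideal_pow_mono[OF J_sub_I, of "r + 1"] r by blast
      have "tdeg g = n * r + n"
        using gh(1) by (auto simp: Jx_eq nsum_nscale sums_eps distrib_left simp del: nsum.simps)
      then have "mo g \<in> ideal_gen V" using lead[OF mem] by (simp add: hc_eq hom_single)
      then have "mo h * mo g \<in> ideal_gen V" by (rule ideal.span_scale)
      then show "mo e \<in> ideal_gen V" by (simp add: gh(2) mult_single add.commute)
    qed
  qed
  \<comment> \<open>Descending induction: a form of degree \<open>d\<close> is lifted from
    combinations of \<open>V\<close> to \<open>J'\<close>, with an error in the next power of
    \<open>\<mm>\<close>.\<close>
  have step: "Mge d \<subseteq> J'" if d: "3 * n - 2 \<le> d" "Mge (Suc d) \<subseteq> J'" for d
  proof
    fix f :: "'k poly3" assume f: "f \<in> Mge d"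
    have "hc d f \<in> Mge d" using hc_hom hom_Mge by blast
    then have 1: "hc d f \<in> ideal_gen V" using Mge_subset_gen Mge_antimono[OF d(1)] by blast
    have dn: "(d - n) + n = d" using d(1) n_pos by linarith
    have "hc d f \<in> hom ((d - n) + n)" unfolding dn by (rule hc_hom)
    from form_span[OF 1 this] obtain t g
      where t: "finite t" "t \<subseteq> V" "\<forall>v. g v \<in> hom (d - n)" "hc d f = (\<Sum>v\<in>t. g v * v)"
      by (elim exE conjE) (rule that)
    have "\<forall>v\<in>t. \<exists>j. j \<in> J' \<and> hc n j = v" using t(2) unfolding V_def by blast
    from bchoice[OF this] obtain j where j: "\<And>v. v \<in> t \<Longrightarrow> j v \<in> J' \<and> hc n (j v) = v" by blast
    let ?g = "\<Sum>v\<in>t. g v * j v"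
    have gJ: "?g \<in> J'" using j J'(1) by (intro ideal.subspace_sum ideal.subspace_scale) auto
    have gd: "g v * j v \<in> Mge d" if "v \<in> t" for v
      using Mge_mult[of "g v" "d - n" "j v" n] t(3) hom_Mge j[OF that] Jn dn by auto
    then have g_mem: "?g \<in> Mge d" using ideal_Mge by (intro ideal.subspace_sum) auto
    have "hc d (g v * j v) = g v * v" if "v \<in> t" for v
    proof -
      have "hc ((d - n) + n) (g v * j v) = hc (d - n) (g v) * hc n (j v)"
        by (rule hc_mult) (use t(3) hom_Mge j[OF that] Jn in auto)
      then show ?thesis using dn t(3) j[OF that] by (simp add: hc_eq)
    qed
    then have "hc d ?g = hc d f" unfolding hc_sum t(4) by simp
    moreover have "f - ?g \<in> Mge d" using f g_mem ideal_Mge ideal.subspace_diff by blast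
    moreover have "hc d (f - ?g) = hc d f - hc d ?g"
      by (rule poly_mapping_eqI) (auto simp: lookup_hc lookup_minus)
    ultimately have "f - ?g \<in> Mge (Suc d)" by (simp add: Mge_Suc_iff)
    then have "f - ?g \<in> J'" using d(2) by blast
    then have "(f - ?g) + ?g \<in> J'" using gJ J'(1) by (intro ideal.subspace_add)
    then show "f \<in> J'" by simp
  qed
  have "Mge (n * (r + 1) + (3 * n - 3)) \<subseteq> J'"
  proof -
    have "ideal_mult J' (ideal_pow ?I r) \<subseteq> J'"
    proof (rule ideal_mult_minimal[OF J'(1)])
      show "a * b \<in> J'" if "a \<in> J'" for a b
        using that J'(1) ideal.subspace_scale[of J' a b] by (simp add: mult.commute)
    qed
    then show ?thesis using large by blast
  qed
  moreover have "3 * n - 2 \<le> n * (r + 1) + (3 * n - 3)" using n_pos unfolding distrib_left by linarith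
  ultimately show ?thesis
    by (intro inc_induct[of "3 * n - 2" "n * (r + 1) + (3 * n - 3)" "\<lambda>d. Mge d \<subseteq> J'"]) (simp_all only: step)
qed

end

section \<open>Part (b): the upper bound for the core, by residues of perturbed pure powers\<close>

section \<open>Perturbation of the identity matrix\<close>

text \<open>\<open>Q\<close> is the adjugate and \<open>d\<close> the determinant of
  \<open>1 - \<tau> N\<close> over \<open>k[\<tau>]\<close>; at \<tau> = 0 the matrix is the
  identity, so \<open>d\<close> is not zero. The finite index set is arbitrary because the rows will
  be indexed by exponents.\<close>

lemma perturbed_inverse:
  fixes N :: "'b \<Rightarrow> 'b \<Rightarrow> 'k::field"
  assumes B: "finite B"
  shows "\<exists>(Q :: 'b \<Rightarrow> 'b \<Rightarrow> 'k poly) d. poly d 0 = 1 \<and>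
    (\<forall>x\<in>B. \<forall>z\<in>B. (\<Sum>y\<in>B. Q x y * ((if y = z then 1 else 0) - monom (N y z) 1)) = (if x = z then d else 0))"
proof -
  let ?m = "card B"
  obtain f where f: "bij_betw f {0..<?m} B" using B ex_bij_betw_nat_finite by blast
  define A :: "'b \<Rightarrow> 'b \<Rightarrow> 'k poly" where "A y z = (if y = z then 1 else 0) - monom (N y z) 1" for y z
  define M where "M = mat ?m ?m (\<lambda>(i, j). A (f i) (f j))"
  have M: "M \<in> carrier_mat ?m ?m" by (simp add: M_def)
  define g where "g = the_inv_into {0..<?m} f"
  have inj: "inj_on f {0..<?m}" and im: "f ` {0..<?m} = B" using f by (auto simp: bij_betw_def)
  have gf: "g (f i) = i" if "i < ?m" for i using the_inv_into_f_f[OF inj] that by (simp add: g_def)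
  have g: "g x < ?m" "f (g x) = x" if "x \<in> B" for x
    using the_inv_into_into[OF inj, of x "{0..<?m}"] f_the_inv_into_f[OF inj, of x] im that by (auto simp: g_def)
  define Q where "Q x y = adj_mat M $$ (g x, g y)" for x y
  have eval: "poly (det M) 0 = 1"
  proof -
    interpret comm_ring_hom "\<lambda>p :: 'k poly. poly p 0" by standard auto
    have "map_mat (\<lambda>p. poly p 0) M = 1\<^sub>m ?m"
      by (rule eq_matI) (use inj in \<open>auto simp: M_def A_def poly_monom inj_on_def\<close>)
    then show ?thesis using hom_det[of M] by simp
  qed
  have "(\<Sum>y\<in>B. Q x y * A y z) = (if x = z then det M else 0)" if xz: "x \<in> B" "z \<in> B" for x z
  proof -
    have "(\<Sum>y\<in>B. Q x y * A y z) = (\<Sum>i\<in>{0..<?m}. Q x (f i) * A (f i) z)"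
      using sum.reindex_bij_betw[OF f, of "\<lambda>y. Q x y * A y z"] by simp
    also have "\<dots> = (\<Sum>i\<in>{0..<?m}. adj_mat M $$ (g x, i) * M $$ (i, g z))"
      by (rule sum.cong) (use xz g in \<open>auto simp: Q_def gf M_def\<close>)
    also have "\<dots> = (adj_mat M * M) $$ (g x, g z)"
      using adj_mat(1)[OF M] M g xz by (auto simp: scalar_prod_def intro!: sum.cong)
    also have "\<dots> = (if x = z then det M else 0)"
      using adj_mat(3)[OF M] g xz by auto (metis g(2))
    finally show ?thesis .
  qed
  then show ?thesis using eval unfolding A_def by blast
qed

lemma ex_power_cong_1:
  fixes q m :: nat
  assumes m: "m > 0" and cop: "coprime q m"
  shows "\<exists>T>0. [q ^ T = 1] (mod m)"
proof -
  have "\<not> inj_on (\<lambda>i. q ^ i mod m) {..m}"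
  proof
    assume "inj_on (\<lambda>i. q ^ i mod m) {..m}"
    then have "card {..m} \<le> card {..<m}" by (rule card_inj_on_le) (use m in auto)
    then show False by simp
  qed
  then obtain i j where ij: "i < j" "q ^ i mod m = q ^ j mod m"
    unfolding inj_on_def by (metis linorder_neqE_nat)
  have "[q ^ i * q ^ (j - i) = q ^ i * 1] (mod m)"
    using ij by (simp add: cong_def flip: power_add)
  then have "[q ^ (j - i) = 1] (mod m)"
    using cop by (subst (asm) cong_mult_lcancel_nat) (auto simp: coprime_power_left_iff)
  then show ?thesis using ij(1) by (intro exI[of _ "j - i"]) simp
qed

lemma poly_vanish:
  fixes a :: "'x \<Rightarrow> 'k::field"
  assumes inf: "infinite (UNIV :: 'k set)" and A: "finite A" "inj_on c A"
    and z: "\<And>t. (\<Sum>x\<in>A. a x * t ^ c x) = 0" and x: "x \<in> A"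
  shows "a x = 0"
proof -
  define p where "p = (\<Sum>x\<in>A. monom (a x) (c x))"
  have "poly p t = 0" for t using z[of t] by (simp add: p_def poly_sum poly_monom)
  then have "p = 0" using inf poly_roots_finite[of p] by auto
  moreover have "coeff p (c x) = a x"
  proof -
    have "coeff p (c x) = (\<Sum>y\<in>A. if y = x then a y else 0)"
      unfolding p_def coeff_sum using A x by (intro sum.cong) (auto simp: inj_on_def)
    then show ?thesis using A x by simp
  qed
  ultimately show ?thesis by simp
qed

section \<open>A residue functional\<close>

lemma lookup_mo_mult_less: "lookup d i < lookup e i \<Longrightarrow> lookup (mo e * f) d = 0"
proof (rule ccontr)
  assume less: "lookup d i < lookup e i" and "lookup (mo e * f) d \<noteq> 0"
  then have "d \<in> (+) e ` keys f" by (simp add: in_keys_iff flip: keys_mo_mult)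
  then show False using less by (auto simp: lookup_add)
qed

lemma lookup_cst_mult [simp]: "lookup (cst c * f) e = c * lookup f e"
proof (induction f rule: pm_induct)
  case (single d' c)
  show ?case by (auto simp: mult_single lookup_single when_def)
qed (simp add: distrib_left lookup_add)

context
  fixes n :: nat and g :: "3 \<Rightarrow> 'k::field poly3"
begin

text \<open>The residue of \<open>u g^s\<close> over the product of the
  \<open>x_i^(n (s_i + 1))\<close> is the coefficient of \<open>u g^s\<close> with exponents
  \<open>n (s_i + 1) - 1\<close>.\<close>

definition top_exp :: "ex3 \<Rightarrow> ex3" where
  "top_exp s = nscale n s + ex (n - 1) (n - 1) (n - 1)"

definition gpow :: "ex3 \<Rightarrow> 'k poly3" where
  "gpow s = (\<Prod>i\<in>UNIV. g i ^ lookup s i)"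

text \<open>The coefficient of \<open>\<tau>^S\<close> in the Grothendieck residue of \<open>u dx dy dz\<close> with respect to
  \<open>x_i^n - \<tau> g_i\<close>, obtained from the geometric series for \<open>1 / (x_i^n - \<tau> g_i)\<close>.\<close>

definition phi :: "nat \<Rightarrow> 'k poly3 \<Rightarrow> 'k" where
  "phi S u = (\<Sum>s\<in>{s. tdeg s = S}. lookup (u * gpow s) (top_exp s))"

lemma phi_add: "phi S (u + v) = phi S u + phi S v"
  by (simp add: phi_def distrib_right lookup_add sum.distrib)

lemma phi_cst: "phi S (cst c * u) = c * phi S u"
  by (simp add: phi_def mult.assoc sum_distrib_left)

lemma lookup_top_exp: "lookup (top_exp s) i = n * lookup s i + (n - 1)"
proof -
  have "\<forall>i. lookup (ex (n - 1) (n - 1) (n - 1)) i = n - 1" unfolding all_3 by simp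
  then show ?thesis by (simp add: top_exp_def lookup_add)
qed

lemma gpow_add: "gpow (s + t) = gpow s * gpow t"
  by (simp add: gpow_def lookup_add power_add prod.distrib)

lemma gpow_eps: "gpow (eps i) = g i"
proof -
  have "gpow (eps i) = (\<Prod>j\<in>UNIV. if j = i then g j else 1)"
    unfolding gpow_def by (intro prod.cong) (auto simp: lookup_single when_def)
  then show ?thesis by simp
qed

lemma phi_pure_0: "n > 0 \<Longrightarrow> phi 0 (a * mo (single i n)) = 0"
  unfolding phi_def
proof (rule sum.neutral, safe)
  fix s assume s: "tdeg s = 0" and n: "n > 0"
  then show "lookup (a * mo (single i n) * gpow s) (top_exp s) = 0"
    using lookup_mo_mult_less[of "top_exp s" i "single i n" "a * gpow s"]
    by (simp add: tdeg_eq_0_iff lookup_top_exp ac_simps)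
qed

text \<open>For the generating series, multiplication by \<open>x_i^n\<close> is \<tau> times
  multiplication by \<open>g i\<close>; this is how the residue annihilates the ideal. Summands with
  \<open>lookup s i = 0\<close> drop out because \<open>x_i^n\<close> exceeds the extracted exponent
  \<open>n - 1\<close>.\<close>

lemma phi_pure_Suc:
  assumes n: "n > 0" shows "phi (Suc S) (a * mo (single i n)) = phi S (a * g i)"
proof -
  let ?e = "single i n"
  let ?F = "\<lambda>s. lookup (a * mo ?e * gpow s) (top_exp s)"
  have "phi (Suc S) (a * mo ?e) = (\<Sum>s\<in>(+) (eps i) ` {s. tdeg s = S}. ?F s)"
    unfolding phi_def
  proof (rule sum.mono_neutral_right)
    show "\<forall>s\<in>{s. tdeg s = Suc S} - (+) (eps i) ` {s. tdeg s = S}. ?F s = 0"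
    proof
      fix s assume s: "s \<in> {s. tdeg s = Suc S} - (+) (eps i) ` {s. tdeg s = S}"
      have "lookup s i = 0"
      proof (rule ccontr)
        assume nz: "lookup s i \<noteq> 0"
        have "s = eps i + (s - eps i)"
          by (rule poly_mapping_eqI) (use nz in \<open>auto simp: lookup_add lookup_minus lookup_single when_def\<close>)
        moreover from this have "tdeg s = 1 + tdeg (s - eps i)" by (metis tdeg_add tdeg_single)
        ultimately show False using s by auto
      qed
      then show "?F s = 0"
        using lookup_mo_mult_less[of "top_exp s" i ?e "a * gpow s"] n
        by (simp add: lookup_top_exp ac_simps)
    qed
  qed auto
  also have "\<dots> = (\<Sum>s\<in>{s. tdeg s = S}. ?F (eps i + s))"
    by (rule sum.reindex_cong[of "(+) (eps i)"]) auto
  also have "\<dots> = phi S (a * g i)"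
    unfolding phi_def
  proof (rule sum.cong)
    fix s
    have "top_exp (eps i + s) = ?e + top_exp s"
      by (rule poly_mapping_eqI) (auto simp: lookup_top_exp lookup_add lookup_single when_def distrib_left)
    moreover have "a * mo ?e * gpow (eps i + s) = mo ?e * (a * g i * gpow s)"
      by (simp add: gpow_add gpow_eps ac_simps)
    ultimately show "?F (eps i + s) = lookup (a * g i * gpow s) (top_exp s)"
      by (simp only: lookup_mo_mult)
  qed simp
  finally show ?thesis .
qed

definition pert :: "'k \<Rightarrow> 'k poly3 set" where
  "pert t = ideal_gen (range (\<lambda>i. mo (single i n) - cst t * g i))"

text \<open>Every monomial of degree \<open>3 * n - 3\<close> other than \<open>?w\<close> contains
  some \<open>x_i^n\<close>, so the series of these monomials satisfy a linear system with matrix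
  \<open>1 - \<tau> N\<close>. Cramer's rule writes them as polynomials times
  \<open>Phi (mo ?w)\<close> over \<open>d\<close>. The polynomial \<open>P u\<close> vanishes at
  every \<open>t\<close> with \<open>u \<in> pert t\<close>, hence identically.\<close>

lemma phi_eq_0:
  assumes n: "n > 0" and g: "\<And>i. g i \<in> hom n" and u: "u \<in> hom (3 * n - 3)"
    and inf: "infinite {t. u \<in> pert t}"
  shows "phi S u = 0"
proof -
  let ?w = "ex (n - 1) (n - 1) (n - 1)"
  let ?B = "{e. tdeg e = 3 * n - 3}"
  define Phi where "Phi v = Abs_fps (\<lambda>S. phi S v)" for v
  have Phi_add: "Phi (v + w) = Phi v + Phi w" for v w
    by (rule fps_ext) (simp add: Phi_def phi_add)
  have Phi_cst: "Phi (cst c * v) = fps_const c * Phi v" for c v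
    by (rule fps_ext) (simp add: Phi_def phi_cst)
  have Phi_0: "Phi 0 = 0" using Phi_cst[of 0 0] by simp
  have Phi_sum: "Phi (sum f A) = (\<Sum>x\<in>A. Phi (f x))" for f :: "ex3 \<Rightarrow> 'k poly3" and A
    by (induction A rule: infinite_finite_induct) (simp_all add: Phi_0 Phi_add)
  have Phi_hom: "Phi v = (\<Sum>e\<in>?B. fps_const (lookup v e) * Phi (mo e))" if v: "v \<in> hom (3 * n - 3)" for v
  proof -
    have "v = (\<Sum>e\<in>?B. cst (lookup v e) * mo e)"
    proof -
      have "v = (\<Sum>e\<in>keys v. cst (lookup v e) * mo e)"
        using poly3_sum[of v] by (simp flip: single_eq_mult)
      also have "\<dots> = (\<Sum>e\<in>?B. cst (lookup v e) * mo e)"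
        by (rule sum.mono_neutral_left) (use v in \<open>auto simp: hom_def in_keys_iff\<close>)
      finally show ?thesis .
    qed
    then have "Phi v = Phi (\<Sum>e\<in>?B. cst (lookup v e) * mo e)" by simp
    then show ?thesis by (simp add: Phi_sum Phi_cst)
  qed
  have Phi_pure: "Phi (a * mo (single i n)) = fps_X * Phi (a * g i)" for a i
  proof (rule fps_ext)
    fix m show "fps_nth (Phi (a * mo (single i n))) m = fps_nth (fps_X * Phi (a * g i)) m"
      by (cases m) (simp_all add: Phi_def phi_pure_0[OF n] phi_pure_Suc[OF n])
  qed
  have wB: "?w \<in> ?B" using n by auto
  have Phi_w: "Phi (mo ?w) \<noteq> 0"
  proof
    assume "Phi (mo ?w) = 0"
    then have "phi 0 (mo ?w) = 0" by (metis Phi_def fps_nth_Abs_fps fps_zero_nth)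
    moreover have "phi 0 (mo ?w) = 1"
      by (simp add: phi_def tdeg_eq_0_iff gpow_def top_exp_def)
    ultimately show False by simp
  qed
  have "\<exists>i r. e = r + single i n" if e: "e \<in> ?B" "e \<noteq> ?w" for e
  proof -
    have "\<exists>i. lookup e i \<ge> n"
    proof (rule ccontr)
      assume "\<not> ?thesis"
      then have "\<not> n \<le> lookup e i" for i by blast
      then have "lookup e i \<le> n - 1" for i using n by (metis Suc_pred' less_Suc_eq_le not_le)
      from this[of 0] this[of 1] this[of 2] have "e = ?w" using e(1) n by (intro ex3_eqI) (auto simp: tdeg_3)
      then show False using e by simp
    qed
    then obtain i where i: "lookup e i \<ge> n" ..
    have "e = (e - single i n) + single i n"
      by (rule poly_mapping_eqI) (use i in \<open>auto simp: lookup_add lookup_minus lookup_single when_def\<close>)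
    then show ?thesis by blast
  qed
  then obtain io ro where io: "\<And>e. e \<in> ?B \<Longrightarrow> e \<noteq> ?w \<Longrightarrow> e = ro e + single (io e) n" by metis
  \<comment> \<open>The row of \<open>?w\<close> is zero: this monomial is not rewritten and becomes
    the right-hand side of the system.\<close>
  define N where "N e f = (if e = ?w then 0 else lookup (mo (ro e) * g (io e)) f)" for e f
  obtain Q :: "ex3 \<Rightarrow> ex3 \<Rightarrow> 'k poly" and d where Qd: "poly d 0 = 1"
    "\<forall>x\<in>?B. \<forall>z\<in>?B. (\<Sum>y\<in>?B. Q x y * ((if y = z then 1 else 0) - monom (N y z) 1)) = (if x = z then d else 0)"
    using perturbed_inverse[of ?B N] by auto
  let ?A = "\<lambda>y z. (if y = z then 1 else 0) - monom (N y z) 1 :: 'k poly"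
  have d0: "fps_of_poly d \<noteq> 0" using Qd(1) by auto
  have row: "(\<Sum>z\<in>?B. fps_of_poly (?A y z) * Phi (mo z)) = (if y = ?w then Phi (mo ?w) else 0)" if y: "y \<in> ?B" for y
  proof -
    have "(\<Sum>z\<in>?B. fps_of_poly (?A y z) * Phi (mo z)) =
        (\<Sum>z\<in>?B. (if y = z then Phi (mo z) else 0) - fps_X * (fps_const (N y z) * Phi (mo z)))"
      by (rule sum.cong) (auto simp: fps_of_poly_diff fps_of_poly_monom' fps_of_poly_monom algebra_simps)
    also have "\<dots> = Phi (mo y) - fps_X * (\<Sum>z\<in>?B. fps_const (N y z) * Phi (mo z))"
      using y by (simp add: sum_subtractf sum_distrib_left)
    also have "\<dots> = (if y = ?w then Phi (mo ?w) else 0)"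
    proof (cases "y = ?w")
      case True
      then show ?thesis by (simp add: N_def)
    next
      case False
      have eq: "y = ro y + single (io y) n" using io y False by blast
      have "tdeg (ro y) + n = 3 * n - 3" using y eq by (metis mem_Collect_eq tdeg_add tdeg_single)
      then have "mo (ro y) * g (io y) \<in> hom (3 * n - 3)" using hom_mult[OF hom_single g, of "ro y" "tdeg (ro y)" 1 "io y"] by simp
      then have "Phi (mo (ro y) * g (io y)) = (\<Sum>z\<in>?B. fps_const (N y z) * Phi (mo z))"
        using Phi_hom False by (simp add: N_def)
      moreover have "(mo y :: 'k poly3) = mo (ro y) * mo (single (io y) n)" using eq by (simp add: mult_single)
      ultimately have "Phi (mo y) = fps_X * (\<Sum>z\<in>?B. fps_const (N y z) * Phi (mo z))"
        using Phi_pure[of "mo (ro y)" "io y"] by argo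
      then show ?thesis using False by simp
    qed
    finally show ?thesis .
  qed
  have cramer: "fps_of_poly (Q x ?w) * Phi (mo ?w) = fps_of_poly d * Phi (mo x)" if x: "x \<in> ?B" for x
  proof -
    have "fps_of_poly d * Phi (mo x) = (\<Sum>z\<in>?B. fps_of_poly (if x = z then d else 0) * Phi (mo z))"
    proof -
      have "(\<Sum>z\<in>?B. fps_of_poly (if x = z then d else 0) * Phi (mo z)) = (\<Sum>z\<in>?B. if x = z then fps_of_poly d * Phi (mo z) else 0)"
        by (rule sum.cong) auto
      then show ?thesis using x by simp
    qed
    also have "\<dots> = (\<Sum>z\<in>?B. \<Sum>y\<in>?B. fps_of_poly (Q x y) * fps_of_poly (?A y z) * Phi (mo z))"
    proof (rule sum.cong)
      fix z assume z: "z \<in> ?B"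
      have "fps_of_poly (if x = z then d else 0) = fps_of_poly (\<Sum>y\<in>?B. Q x y * ?A y z)" using Qd(2) x z by simp
      then show "fps_of_poly (if x = z then d else 0) * Phi (mo z) = (\<Sum>y\<in>?B. fps_of_poly (Q x y) * fps_of_poly (?A y z) * Phi (mo z))"
        by (simp only: fps_of_poly_sum fps_of_poly_mult sum_distrib_right)
    qed simp
    also have "\<dots> = (\<Sum>y\<in>?B. fps_of_poly (Q x y) * (\<Sum>z\<in>?B. fps_of_poly (?A y z) * Phi (mo z)))"
      by (subst sum.swap) (simp only: sum_distrib_left mult.assoc)
    also have "\<dots> = (\<Sum>y\<in>?B. fps_of_poly (Q x y) * (if y = ?w then Phi (mo ?w) else 0))"
      by (rule sum.cong) (simp_all only: row)
    also have "\<dots> = (\<Sum>y\<in>?B. if y = ?w then fps_of_poly (Q x ?w) * Phi (mo ?w) else 0)"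
      by (rule sum.cong) auto
    also have "\<dots> = fps_of_poly (Q x ?w) * Phi (mo ?w)" using wB by simp
    finally show ?thesis by simp
  qed
  \<comment> \<open>On forms of degree \<open>3 * n - 3\<close> this is
    \<open>d * Phi v / Phi (mo ?w)\<close>. Unlike the series, it can be evaluated at a
    scalar.\<close>
  define P where "P v = (\<Sum>e\<in>?B. smult (lookup v e) (Q e ?w))" for v
  have P_Phi: "fps_of_poly (P v) * Phi (mo ?w) = fps_of_poly d * Phi v" if v: "v \<in> hom (3 * n - 3)" for v
  proof -
    have "fps_of_poly (P v) * Phi (mo ?w) = (\<Sum>e\<in>?B. fps_const (lookup v e) * (fps_of_poly (Q e ?w) * Phi (mo ?w)))"
      by (simp add: P_def fps_of_poly_sum fps_of_poly_smult sum_distrib_right mult.assoc)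
    also have "\<dots> = (\<Sum>e\<in>?B. fps_const (lookup v e) * (fps_of_poly d * Phi (mo e)))"
      by (rule sum.cong) (simp_all add: cramer)
    also have "\<dots> = fps_of_poly d * Phi v"
      unfolding Phi_hom[OF v] by (simp add: sum_distrib_left ac_simps)
    finally show ?thesis .
  qed
  have P_add: "P (v + w) = P v + P w" for v w
    by (simp add: P_def lookup_add smult_add_left sum.distrib)
  have P_cst: "P (cst c * v) = smult c (P v)" for c v
  proof -
    have "smult c (sum f A) = (\<Sum>x\<in>A. smult c (f x))" for f :: "ex3 \<Rightarrow> 'k poly" and A
      by (induction A rule: infinite_finite_induct) (simp_all add: smult_add_right)
    then show ?thesis by (simp add: P_def)
  qed
  have P_diff: "P (v - w) = P v - P w" for v w
    using P_add[of "v - w" w] by simp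
  have P_pure: "P (a * mo (single i n)) = [:0, 1:] * P (a * g i)" for a i
  proof (induction a rule: pm_induct)
    case (single e c)
    have h1: "single e c * mo (single i n) \<in> hom (tdeg e + n)"
      and h2: "single e c * g i \<in> hom (tdeg e + n)"
      by (intro hom_mult hom_single g; simp)+
    show ?case
    proof (cases "tdeg e + n = 3 * n - 3")
      case True
      let ?X = "[:0, 1:] :: 'k poly"
      have "fps_of_poly (P (single e c * mo (single i n))) * Phi (mo ?w)
          = fps_of_poly (?X * P (single e c * g i)) * Phi (mo ?w)"
        using P_Phi[OF h1[unfolded True]] P_Phi[OF h2[unfolded True]] Phi_pure[of "single e c" i]
        by (simp only: fps_of_poly_mult fps_of_poly_fps_X mult.assoc) (simp add: mult.left_commute)
      then have "fps_of_poly (P (single e c * mo (single i n))) = fps_of_poly (?X * P (single e c * g i))"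
        using Phi_w unfolding mult_cancel_right by blast
      then show ?thesis by (simp only: fps_of_poly_eq_iff)
    next
      case False
      have "P v = 0" if "v \<in> hom (tdeg e + n)" for v
        unfolding P_def
      proof (rule sum.neutral, safe)
        fix x assume x: "tdeg x = 3 * n - 3"
        then have "x \<notin> keys v" using that False by (auto simp: hom_def)
        then show "smult (lookup v x) (Q x ?w) = 0" by (simp add: in_keys_iff)
      qed
      then show ?thesis using h1 h2 by simp
    qed
  qed (simp add: distrib_right P_add distrib_left)
  \<comment> \<open>Evaluation at \<open>t\<close> turns the factor \<tau> of \<open>P_pure\<close>
    into \<open>t\<close>, so \<open>P\<close> followed by evaluation kills all multiples of the
    generators of \<open>pert t\<close>.\<close>
  have vanish: "poly (P v) t = 0" if v: "v \<in> pert t" for v t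
  proof -
    have "is_ideal {v. \<forall>a. poly (P (a * v)) t = 0}"
      unfolding ideal.subspace_def
    proof (safe, goal_cases)
      case (1 a) show ?case by (simp add: P_def)
    next
      case (2 x y a) then show ?case by (simp add: distrib_left P_add)
    next
      case (3 c x a) then show ?case by (simp only: mult.assoc[symmetric])
    qed
    moreover have "poly (P (a * (mo (single i n) - cst t * g i))) t = 0" for a i
    proof -
      have "a * (mo (single i n) - cst t * g i) = a * mo (single i n) - cst t * (a * g i)"
        by (simp add: algebra_simps)
      then show ?thesis by (simp add: P_diff P_cst P_pure)
    qed
    ultimately have "pert t \<subseteq> {v. \<forall>a. poly (P (a * v)) t = 0}"
      unfolding pert_def by (intro ideal.span_minimal) auto
    then have "\<forall>a. poly (P (a * v)) t = 0" using v by blast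
    then have "poly (P (1 * v)) t = 0" by blast
    then show ?thesis by simp
  qed
  have "{t. u \<in> pert t} \<subseteq> {t. poly (P u) t = 0}" using vanish by blast
  then have "infinite {t. poly (P u) t = 0}" using inf finite_subset by blast
  then have "P u = 0" using poly_roots_finite by blast
  then have "Phi u = 0" using P_Phi[OF u] d0 by simp
  then show ?thesis by (metis Phi_def fps_nth_Abs_fps fps_zero_nth)
qed

end

section \<open>Perturbed pure powers generate reductions\<close>

lemma nscale_add_left: "nscale (a + b) e = nscale a e + nscale b e"
  by (rule poly_mapping_eqI) (simp add: lookup_add distrib_right)

lemma nscale_Suc: "nscale (Suc a) e = e + nscale a e"
  by (rule poly_mapping_eqI) (simp add: lookup_add)

lemma nscale_zero_left [simp]: "nscale 0 e = 0"
  by (rule poly_mapping_eqI) simp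

lemma nscale_one_left [simp]: "nscale 1 e = e"
  by (rule poly_mapping_eqI) simp

lemma mo_power: "mo e ^ m = mo (nscale m e)"
  by (induction m) (simp_all add: mult_single single_one nscale_Suc)

lemma cst_power: "cst c ^ m = cst (c ^ m)"
  by (induction m) (simp_all add: mult_single single_one)

lemma nsum_multiplicities:
  assumes E: "finite E"
  shows "g \<in> nsum s E \<Longrightarrow> \<exists>m. sum m E = s \<and> g = (\<Sum>e\<in>E. nscale (m e) e)"
proof (induction s arbitrary: g)
  case 0
  then show ?case by (intro exI[of _ "\<lambda>_. 0"]) auto
next
  case (Suc s)
  then obtain e h where eh: "g = e + h" "e \<in> E" "h \<in> nsum s E" by (auto simp: setadd_def)
  then obtain m where m: "sum m E = s" "h = (\<Sum>e\<in>E. nscale (m e) e)" using Suc.IH by blast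
  let ?m = "m(e := m e + 1)"
  have "sum ?m E = sum (\<lambda>x. m x + (if x = e then 1 else 0)) E" by (rule sum.cong) auto
  then have 1: "sum ?m E = Suc s" using m(1) eh(2) E by (simp add: sum.distrib)
  have "(\<Sum>x\<in>E. nscale (?m x) x) = (\<Sum>x\<in>E. nscale (m x) x + (if x = e then e else 0))"
    by (rule sum.cong) (auto simp: nscale_add_left)
  then have 2: "(\<Sum>x\<in>E. nscale (?m x) x) = g" using m(2) eh E by (simp add: sum.distrib add.commute)
  show ?case using 1 2 by metis
qed

lemma multiplicities_nsum:
  assumes E: "finite E" shows "(\<Sum>e\<in>E. nscale (m e) e) \<in> nsum (sum m E) E"
proof -
  have one: "nscale k e \<in> nsum k E" if "e \<in> E" for k e
    using that by (induction k) (auto simp: setadd_def nscale_Suc)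
  have "(\<Sum>e\<in>X. nscale (m e) e) \<in> nsum (sum m X) E" if "X \<subseteq> E" "finite X" for X
    using that(2,1)
  proof (induction X rule: finite_induct)
    case (insert e X)
    then show ?case using nsum_add[OF one[of e "m e"], of _ "sum m X"] by simp
  qed simp
  then show ?thesis using E by blast
qed

lemma nsum_mono: "G \<subseteq> H \<Longrightarrow> nsum s G \<subseteq> nsum s H"
proof (induction s)
  case (Suc s)
  then show ?case unfolding nsum.simps setadd_def by blast
qed simp

context edge_exponents
begin

text \<open>Pigeonhole: among more than \<open>card E * n\<close> summands some \<open>e\<close>
  occurs \<open>n\<close> times. As \<open>e\<close> has degree \<open>n\<close>, the exponent
  \<open>nscale n e\<close> is a sum of \<open>n\<close> exponents of pure powers, one of which is
  split off.\<close>

lemma monomial_reduction: "\<exists>r. nsum (Suc r) E \<subseteq> setadd (Jx n) (nsum r E)"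
proof -
  let ?r = "card E * n"
  have "g \<in> setadd (Jx n) (nsum ?r E)" if g: "g \<in> nsum (Suc ?r) E" for g
  proof -
    obtain m where m: "sum m E = Suc ?r" "g = (\<Sum>e\<in>E. nscale (m e) e)"
      using nsum_multiplicities[OF fin_E g] by blast
    have "\<exists>e\<in>E. m e \<ge> n"
    proof (rule ccontr)
      assume "\<not> ?thesis"
      then have "sum m E \<le> (\<Sum>e\<in>E. n)" by (intro sum_mono) (auto simp: not_le)
      then show False using m(1) by simp
    qed
    then obtain e where e: "e \<in> E" "m e \<ge> n" by blast
    let ?m = "m(e := m e - n)"
    have "g = nscale (m e) e + (\<Sum>x\<in>E - {e}. nscale (m x) x)"
      unfolding m(2) using fin_E e(1) by (rule sum.remove)
    also have "nscale (m e) e = nscale n e + nscale (m e - n) e"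
      using e(2) by (simp flip: nscale_add_left)
    also have "nscale n e + nscale (m e - n) e + (\<Sum>x\<in>E - {e}. nscale (m x) x)
        = nscale n e + (\<Sum>x\<in>E. nscale (?m x) x)"
      using sum.remove[OF fin_E e(1), of "\<lambda>x. nscale (?m x) x"] by (simp add: add.assoc)
    finally have g_eq: "g = nscale n e + (\<Sum>x\<in>E. nscale (?m x) x)" .
    have "sum m E = m e + sum m (E - {e})" using fin_E e(1) by (rule sum.remove)
    moreover have "sum ?m E = (m e - n) + sum m (E - {e})" using sum.remove[OF fin_E e(1), of ?m] by simp
    ultimately have tot: "n + sum ?m E = Suc ?r" using e(2) m(1) by linarith
    obtain n' where n': "n = Suc n'" using n_pos by (cases n) auto
    have "nscale n e \<in> nsum n (Jx n)" using deg_E[OF e(1)] by (simp add: Jx_eq nsum_nscale sums_eps)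
    then obtain j h where jh: "nscale n e = j + h" "j \<in> Jx n" "h \<in> nsum n' (Jx n)"
      by (auto simp: n' setadd_def)
    then have "h + (\<Sum>x\<in>E. nscale (?m x) x) \<in> nsum (n' + sum ?m E) E"
      using nsum_mono[OF Jx_E] multiplicities_nsum[OF fin_E] by (intro nsum_add) auto
    moreover have "n' + sum ?m E = ?r" using tot n' by simp
    ultimately show ?thesis using g_eq jh by (auto simp: setadd_def add.assoc)
  qed
  then show ?thesis by blast
qed

text \<open>A perturbation of \<open>monomial_reduction\<close>: each generator of
  \<open>I^(r+1)\<close> is \<open>x_i^n\<close> times a generator of \<open>I^r\<close>. Replacing
  \<open>x_i^n\<close> by \<open>x_i^n - t g_i\<close> changes the generators by the matrix
  \<open>1 - t N\<close>, which is invertible unless \<open>d\<close> vanishes at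
  \<open>t\<close>.\<close>

lemma pert_reduction:
  fixes g :: "3 \<Rightarrow> 'k::field poly3"
  assumes g: "\<And>i. keys (g i) \<subseteq> E"
  shows "finite {t. \<not> is_reduction (pert n g t) (mi E)}"
proof -
  let ?I = "mi E :: 'k poly3 set"
  obtain r where r: "nsum (Suc r) E \<subseteq> setadd (Jx n) (nsum r E)" using monomial_reduction by blast
  let ?U = "nsum (Suc r) E"
  have fin: "finite (nsum s E)" for s
  proof (induction s)
    case (Suc s)
    have "setadd E (nsum s E) = (\<lambda>(a, b). a + b) ` (E \<times> nsum s E)" by (auto simp: setadd_def)
    then show ?case using Suc fin_E by simp
  qed simp
  have "\<exists>i h. e = single i n + h \<and> h \<in> nsum r E" if "e \<in> ?U" for e
    using subsetD[OF r that] unfolding setadd_def Jx_def by blast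
  then obtain io ro where io: "\<And>e. e \<in> ?U \<Longrightarrow> e = single (io e) n + ro e"
    "\<And>e. e \<in> ?U \<Longrightarrow> ro e \<in> nsum r E" by metis
  define N where "N e f = lookup (mo (ro e) * g (io e)) f" for e f
  obtain Q :: "ex3 \<Rightarrow> ex3 \<Rightarrow> 'k poly" and d where Qd: "poly d 0 = 1"
    "\<forall>x\<in>?U. \<forall>z\<in>?U. (\<Sum>y\<in>?U. Q x y * ((if y = z then 1 else 0) - monom (N y z) 1)) = (if x = z then d else 0)"
    using perturbed_inverse[OF fin, of "Suc r" N] by auto
  have "is_reduction (pert n g t) ?I" if t: "poly d t \<noteq> 0" for t
  proof -
    let ?J = "pert n g t"
    have gI: "g i \<in> ?I" for i
      using g[of i] unfolding mi_def by (auto intro!: exI[of _ 0])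
    have JI: "?J \<subseteq> ?I"
      unfolding pert_def
    proof (rule ideal.span_minimal[OF _ ideal_mi], safe)
      fix i
      have "mo (single i n) \<in> ?I"
        using single_in_mi[of "single i n" E 0] Jx_E by (auto simp: Jx_def)
      then show "mo (single i n) - cst t * g i \<in> ?I"
        using gI ideal_mi by (intro ideal.subspace_diff ideal.subspace_scale)
    qed
    have fJ: "mo (single i n) - cst t * g i \<in> ?J" for i
      unfolding pert_def by (rule ideal.span_base) auto
    define F where "F y = mo (ro y) * (mo (single (io y) n) - cst t * g (io y))" for y
    have F_mem: "F y \<in> ideal_mult ?J (ideal_pow ?I r)" if "y \<in> ?U" for y
      unfolding F_def using ideal_multI[OF fJ mo_nsum[OF io(2)[OF that]]] by (subst mult.commute)
    have F_eq: "F y = (\<Sum>z\<in>?U. cst ((if y = z then 1 else 0) - t * N y z) * mo z)" if y: "y \<in> ?U" for y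
    proof (rule poly_mapping_eqI)
      fix e
      have "F y = mo (single (io y) n + ro y) - cst t * (mo (ro y) * g (io y))"
        unfolding F_def by (simp add: right_diff_distrib mult_single add.commute mult.left_commute)
      then have "F y = mo y - cst t * (mo (ro y) * g (io y))" using io(1)[OF y] by simp
      then have l: "lookup (F y) e = (if y = e then 1 else 0) - t * N y e"
        by (simp add: lookup_minus lookup_single when_def N_def)
      have r: "lookup (\<Sum>z\<in>?U. cst ((if y = z then 1 else 0) - t * N y z) * mo z) e
          = (\<Sum>z\<in>?U. if z = e then (if y = z then 1 else 0) - t * N y z else 0)"
        unfolding lookup_sum by (rule sum.cong) (auto simp: lookup_single when_def)
      show "lookup (F y) e = lookup (\<Sum>z\<in>?U. cst ((if y = z then 1 else 0) - t * N y z) * mo z) e"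
      proof (cases "e \<in> ?U")
        case True
        then show ?thesis using l r fin[of "Suc r"] by (simp del: nsum.simps)
      next
        case False
        have "N y e = 0"
        proof (rule ccontr)
          assume "N y e \<noteq> 0"
          then have "e \<in> (+) (ro y) ` keys (g (io y))"
            by (simp add: N_def in_keys_iff flip: keys_mo_mult)
          then have "e \<in> ?U" using g[of "io y"] io(2)[OF y] by (auto simp: setadd_def) (metis add.commute subsetD)
          then show False using False by simp
        qed
        then show ?thesis using l r False y fin[of "Suc r"] by (auto simp del: nsum.simps)
      qed
    qed
    have U_mem: "mo x \<in> ideal_mult ?J (ideal_pow ?I r)" if x: "x \<in> ?U" for x
    proof -
      have "(\<Sum>y\<in>?U. cst (poly (Q x y) t) * F y)
          = (\<Sum>y\<in>?U. \<Sum>z\<in>?U. cst (poly (Q x y) t * ((if y = z then 1 else 0) - t * N y z)) * mo z)"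
        by (rule sum.cong) (simp_all add: F_eq sum_distrib_left mult_single flip: mult.assoc del: nsum.simps)
      also have "\<dots> = (\<Sum>z\<in>?U. \<Sum>y\<in>?U. cst (poly (Q x y) t * ((if y = z then 1 else 0) - t * N y z)) * mo z)"
        by (rule sum.swap)
      also have "\<dots> = (\<Sum>z\<in>?U. cst (if x = z then poly d t else 0) * mo z)"
      proof (rule sum.cong)
        fix z assume z: "z \<in> ?U"
        have "poly (\<Sum>y\<in>?U. Q x y * ((if y = z then 1 else 0) - monom (N y z) 1)) t = poly (if x = z then d else 0) t"
          using Qd(2) x z by simp
        then have Q_sum: "(\<Sum>y\<in>?U. poly (Q x y) t * ((if y = z then 1 else 0) - t * N y z)) = (if x = z then poly d t else 0)"
          by (simp add: poly_sum poly_monom mult.commute if_distrib[of "\<lambda>p. poly p t"] cong: if_cong del: nsum.simps)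
        have cst_sum: "cst (sum f A) = (\<Sum>y\<in>A. cst (f y))" for f :: "ex3 \<Rightarrow> 'k" and A
          by (induction A rule: infinite_finite_induct) (simp_all add: single_add)
        show "(\<Sum>y\<in>?U. cst (poly (Q x y) t * ((if y = z then 1 else 0) - t * N y z)) * mo z)
            = cst (if x = z then poly d t else 0) * mo z"
          unfolding sum_distrib_right[symmetric] cst_sum[symmetric] Q_sum ..
      qed simp
      also have "\<dots> = (\<Sum>z\<in>?U. if z = x then cst (poly d t) * mo x else 0)"
        by (rule sum.cong) auto
      also have "\<dots> = cst (poly d t) * mo x" using x fin[of "Suc r"] by (simp del: nsum.simps)
      finally have "cst (poly d t) * mo x = (\<Sum>y\<in>?U. cst (poly (Q x y) t) * F y)" by simp
      also have "\<dots> \<in> ideal_mult ?J (ideal_pow ?I r)"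
        by (intro ideal.subspace_sum is_ideal_mult ideal.subspace_scale F_mem)
      finally have "cst (inverse (poly d t)) * (cst (poly d t) * mo x) \<in> ideal_mult ?J (ideal_pow ?I r)"
        by (rule ideal.subspace_scale[OF is_ideal_mult])
      then show ?thesis using t by (simp add: mult_single)
    qed
    have "ideal_pow ?I (r + 1) = ideal_mult ?J (ideal_pow ?I r)"
    proof
      show "ideal_mult ?J (ideal_pow ?I r) \<subseteq> ideal_pow ?I (r + 1)"
        using ideal_mult_mono[OF JI order_refl, of "ideal_pow ?I r"] unfolding Suc_eq_plus1[symmetric] by simp
      show "ideal_pow ?I (r + 1) \<subseteq> ideal_mult ?J (ideal_pow ?I r)"
        unfolding ideal_pow_mi Suc_eq_plus1[symmetric]
        using U_mem by (intro mi_subset_ideal is_ideal_mult) (simp add: ideal_pow_mi del: nsum.simps)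
    qed
    then show ?thesis unfolding is_reduction_def using JI by (auto simp: pert_def ideal.subspace_span)
  qed
  then have "{t. \<not> is_reduction (pert n g t) ?I} \<subseteq> {t. poly d t = 0}" by blast
  moreover have "d \<noteq> 0" using Qd(1) by auto
  ultimately show ?thesis using poly_roots_finite finite_subset by blast
qed

section \<open>The core is contained in the power of the maximal ideal\<close>

lemma E_hom: "keys f \<subseteq> E \<Longrightarrow> f \<in> hom n"
  using deg_E by (auto simp: hom_def)

lemma phi_core:
  fixes g :: "3 \<Rightarrow> 'k::field poly3"
  assumes inf: "infinite (UNIV :: 'k set)" and u: "u \<in> core (mi E)" "u \<in> hom (3 * n - 3)"
    and g: "\<And>i. keys (g i) \<subseteq> E"
  shows "phi n g S u = 0"
proof (rule phi_eq_0[OF n_pos E_hom[OF g] u(2)])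
  have "- {t. \<not> is_reduction (pert n g t) (mi E)} \<subseteq> {t. u \<in> pert n g t}"
    using u(1) by (auto simp: core_def)
  moreover have "infinite (- {t. \<not> is_reduction (pert n g t) (mi E)})"
    unfolding Compl_eq_Diff_UNIV by (rule Diff_infinite_finite[OF pert_reduction[OF g] inf])
  ultimately show "infinite {t. u \<in> pert n g t}" using finite_subset by blast
qed

lemma keys_cst_mult: "keys (cst c * f) \<subseteq> keys f"
  by (auto simp: in_keys_iff)

text \<open>Rescaling the \<open>g i\<close> by \<open>t^((S + 1)^i)\<close> separates the summands of \<open>phi\<close>.\<close>

lemma residue_core:
  fixes g :: "3 \<Rightarrow> 'k::field poly3"
  assumes inf: "infinite (UNIV :: 'k set)" and u: "u \<in> core (mi E)" "u \<in> hom (3 * n - 3)"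
    and g: "\<And>i. keys (g i) \<subseteq> E"
  shows "lookup (u * gpow g s) (top_exp n s) = 0"
proof -
  define S where "S = tdeg s"
  \<comment> \<open>Digits to base \<open>S + 1\<close>: the components of an exponent of degree
    \<open>S\<close> are at most \<open>S\<close>, so \<open>code\<close> is injective on these
    exponents.\<close>
  define w :: "3 \<Rightarrow> nat" where "w i = (if i = 0 then 1 else if i = 1 then S + 1 else (S + 1) ^ 2)" for i
  define code where "code s = (\<Sum>i\<in>UNIV. w i * lookup s i)" for s :: ex3
  have code: "code s = lookup s 0 + (S + 1) * (lookup s 1 + (S + 1) * lookup s 2)" for s
    by (simp add: code_def sum_3 w_def power2_eq_square algebra_simps)
  have inj: "inj_on code {s. tdeg s = S}"
  proof (rule inj_onI, safe)
    fix s s' assume S: "S = tdeg s" "tdeg s' = tdeg s" and eq: "code s = code s'"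
    have lt: "lookup s i < S + 1" "lookup s' i < S + 1" for i
      using member_le_sum[of i UNIV "lookup s"] member_le_sum[of i UNIV "lookup s'"] S
      by (simp_all add: tdeg_def less_Suc_eq_le)
    have "code s mod (S + 1) = code s' mod (S + 1)" using eq by simp
    then have 0: "lookup s 0 = lookup s' 0"
      unfolding code using lt[of 0] by simp
    then have e1: "lookup s 1 + (S + 1) * lookup s 2 = lookup s' 1 + (S + 1) * lookup s' 2"
      using eq unfolding code by simp
    then have "(lookup s 1 + (S + 1) * lookup s 2) mod (S + 1) = (lookup s' 1 + (S + 1) * lookup s' 2) mod (S + 1)"
      by simp
    then have 1: "lookup s 1 = lookup s' 1" using lt[of 1] by simp
    then have "lookup s 2 = lookup s' 2" using e1 by simp
    then show "s = s'" using 0 1 by (intro ex3_eqI)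
  qed
  have "lookup (u * gpow g s') (top_exp n s') = 0" if "s' \<in> {s. tdeg s = S}" for s'
  proof (rule poly_vanish[OF inf finite_tdeg inj _ that])
    fix t :: 'k
    define g' where "g' i = cst (t ^ w i) * g i" for i
    have g': "keys (g' i) \<subseteq> E" for i using g keys_cst_mult unfolding g'_def by blast
    have "gpow g' s = cst (t ^ code s) * gpow g s" for s
    proof -
      have "gpow g' s = (\<Prod>i\<in>UNIV. cst ((t ^ w i) ^ lookup s i)) * gpow g s"
        by (simp add: gpow_def g'_def power_mult_distrib prod.distrib cst_power)
      also have "(\<Prod>i\<in>UNIV. cst ((t ^ w i) ^ lookup s i)) = cst (t ^ code s)"
        by (simp add: prod_3 mult_single code_def sum_3 power_add power_mult)
      finally show ?thesis .
    qed
    then have "phi n g' S u = (\<Sum>s\<in>{s. tdeg s = S}. lookup (cst (t ^ code s) * (u * gpow g s)) (top_exp n s))"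
      unfolding phi_def by (simp only: mult.left_commute)
    then have "phi n g' S u = (\<Sum>s\<in>{s. tdeg s = S}. lookup (u * gpow g s) (top_exp n s) * t ^ code s)"
      unfolding lookup_cst_mult by (simp only: mult.commute)
    then show "(\<Sum>s\<in>{s. tdeg s = S}. lookup (u * gpow g s) (top_exp n s) * t ^ code s) = 0"
      using phi_core[OF inf u g'] by simp
  qed
  then show ?thesis by (simp add: S_def)
qed

text \<open>Replacing \<open>h\<close> by \<open>h + c x^e\<close> and comparing coefficients of powers of \<open>c\<close>.\<close>

lemma peel:
  fixes u :: "'k::field poly3"
  assumes inf: "infinite (UNIV :: 'k set)"
    and Z: "\<And>h. keys h \<subseteq> E \<Longrightarrow> lookup (u * mo f * h ^ m) t = 0"
    and e: "e \<in> E" and v: "v \<le> m" "of_nat (m choose v) \<noteq> (0 :: 'k)" and h: "keys h \<subseteq> E"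
  shows "lookup (u * mo (f + nscale v e) * h ^ (m - v)) t = 0"
proof -
  let ?a = "\<lambda>k. of_nat (m choose k) * lookup (u * mo (f + nscale k e) * h ^ (m - k)) t"
  have "?a v = 0"
  proof (rule poly_vanish[OF inf, where A = "{..m}" and c = "\<lambda>k. k" and a = ?a])
    fix c :: 'k
    have "keys (cst c * mo e + h) \<subseteq> E"
      using keys_add[of "cst c * mo e" h] keys_cst_mult[of c "mo e"] e h by auto
    then have "0 = lookup (u * mo f * (cst c * mo e + h) ^ m) t" by (rule Z[symmetric])
    also have "\<dots> = lookup (\<Sum>k\<le>m. cst (of_nat (m choose k) * c ^ k) * (u * mo (f + nscale k e) * h ^ (m - k))) t"
    proof -
      have "u * mo f * (of_nat (m choose k) * (cst c * mo e) ^ k * h ^ (m - k))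
          = cst (of_nat (m choose k) * c ^ k) * (u * mo (f + nscale k e) * h ^ (m - k))" for k
      proof -
        have 1: "mo (f + nscale k e) = mo f * mo (nscale k e)" by (simp add: mult_single)
        have 2: "cst (of_nat (m choose k) * c ^ k) = of_nat (m choose k) * cst c ^ k"
          by (simp add: cst_power mult_single flip: single_of_nat)
        show ?thesis unfolding 1 2 power_mult_distrib mo_power by (simp only: ac_simps)
      qed
      then show ?thesis by (simp only: binomial_ring sum_distrib_left)
    qed
    also have "\<dots> = (\<Sum>k\<le>m. ?a k * c ^ k)"
      unfolding lookup_sum lookup_cst_mult by (simp only: ac_simps)
    finally show "(\<Sum>k\<le>m. ?a k * c ^ k) = 0" by simp
  qed (use v in auto)
  then show ?thesis using v(2) by simp
qed

text \<open>\<open>psum\<close> counts the factors and \<open>wsum\<close> adds the exponents if the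
  entry at position \<open>j\<close> of the list (from 0) is used \<open>q^(k + j)\<close> times.
  Modulo a number to which \<open>q\<close> is congruent 1, they agree with the length and the sum
  of the list.\<close>

primrec psum :: "nat \<Rightarrow> ex3 list \<Rightarrow> nat \<Rightarrow> nat" where
  "psum q [] k = 0"
| "psum q (e # es) k = q ^ k + psum q es (Suc k)"

primrec wsum :: "nat \<Rightarrow> ex3 list \<Rightarrow> nat \<Rightarrow> ex3" where
  "wsum q [] k = 0"
| "wsum q (e # es) k = nscale (q ^ k) e + wsum q es (Suc k)"

lemma dvd_psum: "q ^ k dvd psum q es k"
proof (induction es arbitrary: k)
  case (Cons e es)
  have "q ^ k dvd psum q es (Suc k)" using Cons[of "Suc k"] by (metis dvd_trans le_imp_power_dvd le_SucI order_refl)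
  then show ?case by simp
qed simp

lemma psum_cong: "[q = 1] (mod c) \<Longrightarrow> [psum q es k = length es] (mod c)"
proof (induction es arbitrary: k)
  case (Cons e es)
  have "[q ^ k = 1 ^ k] (mod c)" using Cons.prems by (rule cong_pow)
  then show ?case using cong_add[OF _ Cons.IH[OF Cons.prems, of "Suc k"], of "q ^ k" 1] by (simp add: One_nat_def)
qed simp

lemma wsum_cong:
  "[q = 1] (mod c) \<Longrightarrow> [lookup (wsum q es k) i = lookup (sum_list es) i] (mod c)"
proof (induction es arbitrary: k)
  case (Cons e es)
  have "[q ^ k = 1 ^ k] (mod c)" using Cons.prems by (rule cong_pow)
  then have "[q ^ k * lookup e i = 1 * lookup e i] (mod c)"
    by (intro cong_mult) auto
  then show ?case using cong_add[OF _ Cons.IH[OF Cons.prems, of "Suc k"]] by (simp add: lookup_add)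
qed simp

lemma tdeg_wsum: "set es \<subseteq> E \<Longrightarrow> tdeg (wsum q es k) = n * psum q es k"
  by (induction es arbitrary: k) (auto simp: deg_E distrib_left)

lemma nsum_list: "g \<in> nsum s E \<Longrightarrow> \<exists>es. set es \<subseteq> E \<and> length es = s \<and> sum_list es = g"
proof (induction s arbitrary: g)
  case (Suc s)
  then obtain e h where eh: "g = e + h" "e \<in> E" "h \<in> nsum s E" by (auto simp: setadd_def)
  then obtain es where "set es \<subseteq> E \<and> length es = s \<and> sum_list es = h" using Suc.IH by blast
  then show ?case using eh by (intro exI[of _ "e # es"]) auto
qed simp

text \<open>The exponents \<open>p^(T k)\<close> are chosen so that all binomial coefficients met are units in \<open>k\<close>.\<close>

lemma peel_list:
  fixes u :: "'k::field poly3"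
  assumes inf: "infinite (UNIV :: 'k set)" and p: "prime p" and T: "T > 0"
    and char: "\<And>x. of_nat x = (0 :: 'k) \<Longrightarrow> p dvd x" and es: "set es \<subseteq> E"
    and Z: "\<And>h. keys h \<subseteq> E \<Longrightarrow>
      lookup (u * mo f * h ^ (psum (p ^ T) es k + (p ^ T) ^ (k + length es) * D)) t = 0"
    and h: "keys h \<subseteq> E"
  shows "lookup (u * mo (f + wsum (p ^ T) es k) * h ^ ((p ^ T) ^ (k + length es) * D)) t = 0"
  using es Z h
proof (induction es arbitrary: k f h)
  case Nil
  then show ?case by simp
next
  case (Cons e es)
  let ?q = "p ^ T"
  let ?m' = "psum ?q es (Suc k) + ?q ^ (Suc k + length es) * D"
  let ?m = "?q ^ k + ?m'"
  \<comment> \<open>All later contributions are divisible by \<open>q^(k+1)\<close>, so the exponent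
    of \<open>h\<close> is \<open>q^k\<close> times a number prime to \<open>p\<close>. By
    \<open>const_p_fac\<close> its binomial coefficient over \<open>q^k\<close> is then prime to
    \<open>p\<close>.\<close>
  have "?q ^ Suc k dvd ?m'"
    by (intro dvd_add dvd_psum dvd_mult2 le_imp_power_dvd) simp
  then obtain X where X: "?m' = ?q ^ Suc k * X" by (elim dvdE)
  have m_eq: "?m = p ^ (T * k) * (1 + ?q * X)" unfolding X by (simp add: power_mult algebra_simps)
  have "p dvd ?q" using T by simp
  then have "\<not> p dvd 1 + ?q * X" using p by (metis dvd_add_left_iff dvd_mult2 not_prime_unit)
  then have "multiplicity p (1 + ?q * X) = 0" by (rule not_dvd_imp_multiplicity_0)
  then have "multiplicity p (?m choose ?q ^ k) = 0"
    using const_p_fac[OF _ p, of "1 + ?q * X" "T * k"] m_eq by (simp add: power_mult)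
  moreover have "?m choose ?q ^ k \<noteq> 0" by simp
  ultimately have "\<not> p dvd ?m choose ?q ^ k" using p by (simp add: multiplicity_eq_zero_iff)
  then have nz: "of_nat (?m choose ?q ^ k) \<noteq> (0 :: 'k)" using char by blast
  have Z': "lookup (u * mo (f + nscale (?q ^ k) e) * h ^ ?m') t = 0" if h: "keys h \<subseteq> E" for h
  proof -
    have "lookup (u * mo (f + nscale (?q ^ k) e) * h ^ (?m - ?q ^ k)) t = 0"
      by (rule peel[OF inf _ _ _ nz h]) (use Cons.prems in \<open>auto simp: add.assoc\<close>)
    then show ?thesis by simp
  qed
  show ?case using Cons.IH[of "f + nscale (?q ^ k) e" "Suc k" h] Z' Cons.prems(1,3) by (simp add: add.assoc)
qed

text \<open>All \<open>g i\<close> are specialized to monomials: \<open>?e1\<close> used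
  \<open>s1\<close> times at \<open>i1\<close>, \<open>?e3\<close> used \<open>s3\<close> times at
  \<open>i3\<close>, and at \<open>i2\<close> the entries of \<open>es\<close> with multiplicities
  \<open>q^j\<close> together with \<open>d\<close> copies of the pure power of \<open>i3\<close>.
  It remains to solve \<open>?F + a = top_exp n ?s\<close> in natural numbers. Coordinate
  \<open>i2\<close> gives \<open>s1\<close> after division by \<open>c1\<close>, coordinate
  \<open>i3\<close> gives \<open>s3\<close> after division by \<open>c3\<close>, and
  \<open>i1\<close> follows from the degrees.\<close>

lemma core_coeff:
  fixes u :: "'k::field poly3"
  assumes inf: "infinite (UNIV :: 'k set)" and u: "u \<in> core (mi E)" "u \<in> hom (3 * n - 3)" and a: "tdeg a = 3 * n - 3"
  shows "lookup u a = 0"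
proof -
  obtain p where p: "prime p" and char: "\<And>x. of_nat x = (0 :: 'k) \<Longrightarrow> p dvd x"
  proof (cases "CHAR('k) = 0")
    case True
    \<comment> \<open>In characteristic 0 any prime serves, since only 0 becomes zero in the
      field.\<close>
    then show thesis using that[of 2] by (simp add: of_nat_eq_0_iff_char_dvd)
  next
    case False
    then show thesis using that[of "CHAR('k)"] prime_CHAR_semidom[where 'a = 'k] by (simp add: of_nat_eq_0_iff_char_dvd)
  qed
  obtain i1 i2 i3 c1 c3 where i: "i1 \<noteq> i2" "i1 \<noteq> i3" "i2 \<noteq> i3" and c: "0 < c1" "c1 \<le> n" "0 < c3" "c3 \<le> n"
      "\<not> p dvd c1" "\<not> p dvd c3"
    and E1: "single i1 (n - c1) + single i2 c1 \<in> E" (is "?e1 \<in> E")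
    and E3: "single i3 (n - c3) + single i1 c3 \<in> E" (is "?e3 \<in> E")
    using cycle[OF p] by blast
  have univ: "(UNIV :: 3 set) = {i1, i2, i3}"
    using i by (intro card_seteq[symmetric]) auto
  have pure: "single j n \<in> E" for j using Jx_E by (auto simp: Jx_def)
  have "coprime p (c1 * c3)" "c1 * c3 > 0" using c p by (simp_all add: prime_imp_coprime)
  then obtain T where T: "T > 0" and qT: "[p ^ T = 1] (mod c1 * c3)" using ex_power_cong_1 by blast
  let ?q = "p ^ T"
  have q1: "[?q = 1] (mod c1)" and q3: "[?q = 1] (mod c3)"
    using cong_dvd_modulus_nat[OF qT] by simp_all
  let ?l = "\<lambda>e i. int (lookup e i)"
  \<comment> \<open>\<open>(n - 1) (a + (1, 1, 1))\<close> is congruent to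
    \<open>(n - 1, n - 1, n - 1) - a\<close>, which is what \<open>a\<close> lacks to a top exponent
    modulo \<open>n\<close>.\<close>
  obtain s g where g: "g \<in> nsum s E"
    "\<forall>i. lookup g i mod n = lookup (nscale (n - 1) (a + ex 1 1 1)) i mod n"
  proof -
    have "tdeg (nscale (n - 1) (a + ex 1 1 1)) = (n - 1) * (3 * n)" using a n_pos by simp
    moreover have "n dvd (n - 1) * (3 * n)" by simp
    ultimately have "n dvd tdeg (nscale (n - 1) (a + ex 1 1 1))" by (simp only:)
    then show thesis using residues that by blast
  qed
  obtain es0 where es0: "set es0 \<subseteq> E" "length es0 = s" "sum_list es0 = g" using nsum_list[OF g(1)] by blast
  have gi: "int n dvd ?l g i - (int n - 1 - ?l a i)" for i
  proof -
    have ex1: "lookup (ex 1 1 1) i = 1" for i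
    proof -
      have "\<forall>i. lookup (ex 1 1 1) i = 1" unfolding all_3 by simp
      then show ?thesis ..
    qed
    have "int (lookup g i) mod int n = int ((n - 1) * (lookup a i + 1)) mod int n"
      using arg_cong[OF g(2)[rule_format, of i], of int] unfolding lookup_nscale lookup_add ex1 zmod_int .
    then have "int n dvd ?l g i - int ((n - 1) * (lookup a i + 1))" by (simp add: mod_eq_dvd_iff)
    also have "int ((n - 1) * (lookup a i + 1)) = (int n - 1 - ?l a i) + int n * ?l a i"
      using n_pos unfolding of_nat_mult of_nat_add by (simp add: of_nat_diff algebra_simps)
    finally have "int n dvd (?l g i - ((int n - 1 - ?l a i) + int n * ?l a i)) + int n * ?l a i"
      by (intro dvd_add) auto
    then show ?thesis by (simp add: algebra_simps)
  qed
  \<comment> \<open>In units of \<open>n\<close>, \<open>x\<close> and \<open>y\<close> measure the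
    defects in coordinates \<open>i2\<close> and \<open>i3\<close>. The term \<open>n * s\<close>
    occurs because each factor used at \<open>i2\<close> raises that coordinate of
    \<open>top_exp\<close> by \<open>n\<close>.\<close>
  have "int n dvd (?l g i2 - (int n - 1 - ?l a i2)) - int n * int s" by (rule dvd_diff[OF gi[of i2]]) simp
  then obtain x where x: "?l g i2 - (int n - 1 - ?l a i2) - int n * int s = int n * x" by (elim dvdE)
  obtain y where y: "?l g i3 - (int n - 1 - ?l a i3) = int n * y" using gi[of i3] by (elim dvdE)
  \<comment> \<open>Copies of the pure power of \<open>i3\<close> shift the \<open>i3\<close>
    equation by \<open>n\<close>, which fixes \<open>b\<close> modulo \<open>c3\<close>. Copies of
    the pure power of \<open>i1\<close> affect the \<open>i2\<close> equation only through the
    number of factors, so \<open>r\<close> can afterwards be adjusted modulo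
    \<open>c1\<close>.\<close>
  define b where "b = nat ((- y) mod int c3)"
  define r where "r = nat ((x - int b) mod int c1)"
  have b: "int c3 dvd y + int b"
  proof -
    have "(- y) mod int c3 - (- y) = - (int c3 * ((- y) div int c3))" by (simp add: minus_div_mult_eq_mod[symmetric])
    then show ?thesis using c(3) by (simp add: b_def add.commute) 
  qed
  have r: "int c1 dvd int r + int b - x"
  proof -
    have "(x - int b) mod int c1 - (x - int b) = - (int c1 * ((x - int b) div int c1))" by (simp add: minus_div_mult_eq_mod[symmetric])
    moreover have "int r = (x - int b) mod int c1" using c(1) by (simp add: r_def)
    ultimately have "int r + int b - x = - (int c1 * ((x - int b) div int c1))" by simp
    then show ?thesis by simp
  qed
  define es where "es = replicate r (single i1 n) @ replicate b (single i3 n) @ es0"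
  have es: "set es \<subseteq> E" using es0(1) pure by (auto simp: es_def)
  have len: "length es = r + b + s" by (simp add: es_def es0)
  have rep: "lookup (sum_list (replicate k e)) i = k * lookup e i" for k and e :: ex3 and i
    by (induction k) (auto simp: lookup_add)
  have S2: "?l (sum_list es) i2 = ?l g i2" and S3: "?l (sum_list es) i3 = int n * int b + ?l g i3"
    using i by (simp_all add: es_def es0 lookup_add rep lookup_single when_def)
  define P where "P = psum ?q es 0"
  define w where "w = wsum ?q es 0"
  \<comment> \<open>Divisible by \<open>c1 * c3\<close>, so the congruences are not disturbed, and
    large enough for \<open>s1\<close> and \<open>s3\<close> to come out nonnegative.\<close>
  define D where "D = c1 * c3 * (lookup a i2 + lookup w i2 + 1)"
  define d where "d = ?q ^ length es * D"
  have q_pos: "?q ^ length es > 0" using p by (simp add: prime_gt_0_nat)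
  have "c1 * c3 > 0" using c by simp
  then have D_ge: "D \<ge> lookup a i2 + lookup w i2 + 1"
    unfolding D_def by (metis mult_le_mono1 nat_mult_1 Suc_leI One_nat_def)
  have d_ge: "d \<ge> lookup a i2 + lookup w i2 + 1"
  proof -
    have "1 * D \<le> ?q ^ length es * D" using q_pos by (intro mult_le_mono1) (simp only: One_nat_def Suc_le_eq)
    then have "D \<le> d" by (simp add: d_def)
    then show ?thesis using D_ge by linarith
  qed
  have d13: "int c1 dvd int d" "int c3 dvd int d" by (simp_all add: d_def D_def)
  have cong_dvd: "[A = B] (mod m) \<Longrightarrow> int m dvd int A - int B" for A B m
    by (simp add: cong_iff_dvd_diff flip: cong_int_iff)
  have P1: "int c1 dvd int P - int (length es)" unfolding P_def by (rule cong_dvd[OF psum_cong[OF q1]])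
  have w1: "int c1 dvd ?l w i2 - ?l (sum_list es) i2" unfolding w_def by (rule cong_dvd[OF wsum_cong[OF q1]])
  have w3: "int c3 dvd ?l w i3 - ?l (sum_list es) i3" unfolding w_def by (rule cong_dvd[OF wsum_cong[OF q3]])
  have "int c1 dvd int n * (int P - int (length es)) + int n * int d - (?l w i2 - ?l (sum_list es) i2)
      + int n * (int r + int b - x)"
    by (rule dvd_add[OF dvd_diff[OF dvd_add[OF dvd_mult[OF P1] dvd_mult[OF d13(1)]] w1] dvd_mult[OF r]])
  also have "\<dots> = int n * (int P + int d) + (int n - 1) - ?l a i2 - ?l w i2"
    using x by (simp add: S2 len algebra_simps)
  finally obtain s1' where s1': "int n * (int P + int d) + (int n - 1) - ?l a i2 - ?l w i2 = int c1 * s1'" by (elim dvdE)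
  have "int c3 dvd (?l w i3 - ?l (sum_list es) i3) + int n * int d + int n * (y + int b)"
    by (rule dvd_add[OF dvd_add[OF w3 dvd_mult[OF d13(2)]] dvd_mult[OF b]])
  also have "\<dots> = ?l a i3 + ?l w i3 + int n * int d - (int n - 1)"
    using y by (simp add: S3 algebra_simps)
  finally obtain s3' where s3': "?l a i3 + ?l w i3 + int n * int d - (int n - 1) = int c3 * s3'" by (elim dvdE)
  have nd: "int n * int d \<ge> int d" "int n * int d \<ge> int n" using n_pos d_ge by simp_all
  have "0 \<le> int n * int P" by simp
  then have "int c1 * s1' \<ge> 0" unfolding s1'[symmetric] distrib_left using d_ge nd(1) n_pos by linarith
  then have "s1' \<ge> 0" using c by (simp add: zero_le_mult_iff)
  then obtain s1 where s1: "s1' = int s1" by (rule zero_le_imp_eq_int[THEN exE])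
  have "int c3 * s3' \<ge> 0" unfolding s3'[symmetric] using nd(2) by simp
  then have "s3' \<ge> 0" using c by (simp add: zero_le_mult_iff)
  then obtain s3 where s3: "s3' = int s3" by (rule zero_le_imp_eq_int[THEN exE])
  let ?s = "single i1 s1 + single i2 (P + d) + single i3 s3"
  let ?f = "nscale s1 ?e1 + nscale s3 ?e3"
  have "lookup (u * mo ?f * h ^ (P + d)) (top_exp n ?s) = 0" if h: "keys h \<subseteq> E" for h
  proof -
    let ?g = "\<lambda>j. if j = i1 then mo ?e1 else if j = i2 then h else mo ?e3"
    have "lookup (u * gpow ?g ?s) (top_exp n ?s) = 0"
      by (rule residue_core[OF inf u]) (use E1 E3 h in auto)
    moreover have "gpow ?g ?s = mo ?f * h ^ (P + d)"
    proof -
      have "gpow ?g ?s = ?g i1 ^ lookup ?s i1 * (?g i2 ^ lookup ?s i2 * ?g i3 ^ lookup ?s i3)"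
        unfolding gpow_def univ using i by simp
      also have "\<dots> = mo ?e1 ^ s1 * (h ^ (P + d) * mo ?e3 ^ s3)"
        using i by (simp add: lookup_add lookup_single when_def)
      also have "\<dots> = mo ?f * h ^ (P + d)"
        unfolding mo_power by (simp add: mult_single ac_simps flip: mult.assoc)
      finally show ?thesis .
    qed
    ultimately show ?thesis by (simp add: mult.assoc)
  qed
  \<comment> \<open>After \<open>es\<close> has been peeled off, the remaining \<open>h\<close> is
    the pure power of \<open>i3\<close>, and \<open>u\<close> is multiplied by a single
    monomial.\<close>
  then have "lookup (u * mo (?f + wsum ?q es 0) * mo (single i3 n) ^ (?q ^ (0 + length es) * D)) (top_exp n ?s) = 0"
    using pure by (intro peel_list[OF inf p T char es]) (auto simp: P_def d_def)
  then have z: "lookup (mo (?f + w + nscale d (single i3 n)) * u) (top_exp n ?s) = 0"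
  proof -
    have "(mo (?f + w + nscale d (single i3 n)) :: 'k poly3) = mo (?f + w) * mo (nscale d (single i3 n))"
      by (simp add: mult_single)
    then have "mo (?f + w + nscale d (single i3 n)) * u = u * mo (?f + w) * mo (nscale d (single i3 n))"
      by (simp only: mult.commute mult.left_commute mult.assoc)
    then show "lookup (u * mo (?f + wsum ?q es 0) * mo (single i3 n) ^ (?q ^ (0 + length es) * D)) (top_exp n ?s) = 0 \<Longrightarrow> ?thesis"
      by (simp only: mo_power add_0_left flip: w_def d_def)
  qed
  let ?F = "?f + w + nscale d (single i3 n)"
  have td: "tdeg e = lookup e i1 + lookup e i2 + lookup e i3" for e
    unfolding tdeg_def univ using i by simp
  have eq2: "lookup (?F + a) i2 = lookup (top_exp n ?s) i2"
  proof -
    have "?l (?F + a) i2 = ?l (top_exp n ?s) i2"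
      using i s1' n_pos by (simp add: lookup_top_exp lookup_add lookup_single when_def s1 of_nat_diff algebra_simps)
    then show ?thesis by simp
  qed
  have eq3: "lookup (?F + a) i3 = lookup (top_exp n ?s) i3"
  proof -
    have "?l (?F + a) i3 = int (s3 * (n - c3)) + ?l w i3 + int n * int d + ?l a i3"
      using i by (simp add: lookup_add lookup_single when_def mult.commute)
    moreover have "int (s3 * (n - c3)) = int n * int s3 - int c3 * int s3"
      unfolding of_nat_mult of_nat_diff[OF c(4)] by (simp add: algebra_simps)
    moreover have "?l (top_exp n ?s) i3 = int n * int s3 + (int n - 1)"
      using i n_pos by (simp add: lookup_top_exp lookup_add lookup_single when_def of_nat_diff)
    ultimately have "?l (?F + a) i3 = ?l (top_exp n ?s) i3"
      using s3'[unfolded s3] by linarith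
    then show ?thesis by simp
  qed
  have "tdeg (?F + a) = tdeg (top_exp n ?s)"
    using c a n_pos es by (simp add: top_exp_def w_def tdeg_wsum P_def algebra_simps)
  then have eq1: "lookup (?F + a) i1 = lookup (top_exp n ?s) i1"
    unfolding td using eq2 eq3 by simp
  have "?F + a = top_exp n ?s"
  proof (rule poly_mapping_eqI)
    fix j :: 3
    have "j \<in> {i1, i2, i3}" using univ by auto
    then show "lookup (?F + a) j = lookup (top_exp n ?s) j" using eq1 eq2 eq3 by auto
  qed
  then show ?thesis using z by (metis lookup_mo_mult)
qed

lemma is_ideal_core: "is_ideal (core I)"
  unfolding core_def by (rule ideal.subspace_Inter) (auto simp: is_reduction_def)

text \<open>An element of too low order is multiplied by a power of \<open>x\<close> up to order
  \<open>3 * n - 3\<close>. It differs from its lowest form by an element of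
  \<open>\<mm>^(3n-2)\<close>, which already lies in the core; so the form lies in the core and
  vanishes by \<open>core_coeff\<close>.\<close>

lemma core_subset:
  assumes inf: "infinite (UNIV :: 'k::field set)" and sup: "Mge (3 * n - 2) \<subseteq> core (mi E :: 'k poly3 set)"
  shows "core (mi E :: 'k poly3 set) \<subseteq> Mge (3 * n - 2)"
proof
  fix u :: "'k poly3" assume u: "u \<in> core (mi E)"
  show "u \<in> Mge (3 * n - 2)"
  proof (rule ccontr)
    assume neg: "u \<notin> Mge (3 * n - 2)"
    then have u0: "u \<noteq> 0" by (auto simp: Mge_def)
    define d where "d = ordm u"
    have d: "d \<le> 3 * n - 3" using neg Mge_iff_ordm[OF u0] unfolding d_def by fastforce
    let ?c = "single 0 (3 * n - 3 - d) :: ex3"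
    have ud: "u \<in> Mge d" using Mge_iff_ordm[OF u0] by (simp add: d_def)
    have cm: "mo ?c \<in> (Mge (3 * n - 3 - d) :: 'k poly3 set)" by (simp add: Mge_def)
    let ?v = "mo ?c * u"
    have v: "?v \<in> core (mi E)" using u is_ideal_core ideal.subspace_scale by blast
    have "hc ((3 * n - 3 - d) + d) ?v = hc (3 * n - 3 - d) (mo ?c) * hc d u" by (rule hc_mult[OF cm ud])
    then have hv: "hc (3 * n - 3) ?v = mo ?c * hc d u"
      unfolding le_add_diff_inverse2[OF d] by (simp add: hc_eq hom_single del: diff_diff_left)
    have "?v \<in> Mge ((3 * n - 3 - d) + d)" by (rule Mge_mult[OF cm ud])
    then have "?v \<in> Mge (3 * n - 3)" unfolding le_add_diff_inverse2[OF d] .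
    then have "?v - hc (3 * n - 3) ?v \<in> Mge (Suc (3 * n - 3))" by (rule diff_hc)
    moreover have "Suc (3 * n - 3) = 3 * n - 2" using n_pos by simp
    ultimately have "?v - hc (3 * n - 3) ?v \<in> core (mi E)" 
using sup by auto
    from ideal.subspace_diff[OF is_ideal_core v this]
    have "?v - (?v - hc (3 * n - 3) ?v) \<in> core (mi E)" .
    then have w: "hc (3 * n - 3) ?v \<in> core (mi E)" by simp
    have "lookup (hc (3 * n - 3) ?v) e = 0" for e
      using core_coeff[OF inf w hc_hom, of e] by (cases "tdeg e = 3 * n - 3") (simp_all add: lookup_hc)
    then have "hc (3 * n - 3) ?v = 0" by (intro poly_mapping_eqI) simp
    then show False using hv hc_ordm[OF u0] by (simp add: d_def)
  qed
qed

end

section \<open>The adjoint contains \<open>\<mm>^(3n-2)\<close>: Jacobian ideals of valuation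
  rings\<close>

section \<open>Kaehler differentials over subrings of a field\<close>

lemma submodule_hull: "submodule_over B sc (submodule_over B sc hull S)"
  by (rule hull_in) (auto simp: submodule_over_def)

lemma submodule_add: "submodule_over B sc N \<Longrightarrow> x \<in> N \<Longrightarrow> y \<in> N \<Longrightarrow> x + y \<in> N"
  and submodule_scale: "submodule_over B sc N \<Longrightarrow> c \<in> B \<Longrightarrow> x \<in> N \<Longrightarrow> sc c x \<in> N"
  and submodule_0: "submodule_over B sc N \<Longrightarrow> 0 \<in> N"
  by (auto simp: submodule_over_def)

lemma submodule_sum: "submodule_over B sc N \<Longrightarrow> (\<And>x. x \<in> X \<Longrightarrow> f x \<in> N) \<Longrightarrow> sum f X \<in> N"
  by (induction X rule: infinite_finite_induct) (auto simp: submodule_0 submodule_add)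

lemma lookup_pm_scale [simp]: "lookup (pm_scale c f) b = c * lookup f b"
  by (auto simp: pm_scale_def Poly_Mapping.map.rep_eq when_def)

lemma pm_scale_simps:
  "pm_scale c (f + g) = pm_scale c f + pm_scale c g" "pm_scale (a + b) f = pm_scale a f + pm_scale b f"
  "pm_scale a (pm_scale b f) = pm_scale (a * b) f" "pm_scale 1 f = f" "pm_scale c (single b x) = single b (c * x)"
  "pm_scale (- 1) f = - f" "pm_scale 0 f = 0" "pm_scale c 0 = 0"
  by (rule poly_mapping_eqI; simp add: lookup_add lookup_single when_def algebra_simps)+

lemma pm_scale_sum: "pm_scale c (sum f A) = (\<Sum>x\<in>A. pm_scale c (f x))"
  by (induction A rule: infinite_finite_induct) (simp_all add: pm_scale_simps)

lemma submodule_uminus: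
  assumes "submodule_over B pm_scale N" "is_subring B" "x \<in> N" shows "- x \<in> N"
  using submodule_scale[OF assms(1) subring_uminus[OF assms(2) subring_1[OF assms(2)]] assms(3)]
  by (simp add: pm_scale_simps)

lemma submodule_diff:
  assumes "submodule_over B pm_scale N" "is_subring B" "x \<in> N" "y \<in> N" shows "x - y \<in> N"
  using submodule_add[OF assms(1,3) submodule_uminus[OF assms(1,2,4)]] by simp

lemma det_in_subring:
  assumes B: "is_subring B" and A: "A \<in> carrier_mat m m" "elements_mat A \<subseteq> B"
  shows "det A \<in> B"
proof -
  have el: "A $$ (i, j) \<in> B" if "i < m" "j < m" for i j using that A by auto
  have sgn: "signof p \<in> B" for p :: "nat \<Rightarrow> nat"
    by (simp add: sign_def subring_1[OF B] subring_uminus[OF B])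
  show ?thesis
    unfolding det_def'[OF A(1)]
    by (intro subring_sum[OF B] subring_mult[OF B] sgn subring_prod[OF B] el)
      (auto dest: permutes_in_image)
qed

locale kaehler =
  fixes R B :: "'q::field set"
  assumes B: "is_subring B" and R: "is_subring R" and RB: "R \<subseteq> B"
begin

abbreviation d :: "'q \<Rightarrow> 'q \<Rightarrow>\<^sub>0 'q" where "d b \<equiv> single b 1"
abbreviation "N \<equiv> kaehler_rel R B"
abbreviation "F \<equiv> kaehler_free B"

lemma N_sub: "submodule_over B pm_scale N"
  unfolding kaehler_rel_def Let_def by (rule submodule_hull)

lemma N_add: "b \<in> B \<Longrightarrow> c \<in> B \<Longrightarrow> d (b + c) - d b - d c \<in> N"
  and N_mult: "b \<in> B \<Longrightarrow> c \<in> B \<Longrightarrow> d (b * c) - pm_scale b (d c) - pm_scale c (d b) \<in> N"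
  and N_R: "r \<in> R \<Longrightarrow> d r \<in> N"
  unfolding kaehler_rel_def Let_def by (auto intro!: hull_inc)

lemma F_sub: "submodule_over B pm_scale F"
  unfolding submodule_over_def
proof (intro conjI ballI)
  show "0 \<in> F" using subring_0[OF B] by (simp add: kaehler_free_def)
  show "f + g \<in> F" if "f \<in> F" "g \<in> F" for f g
    using that keys_add[of f g] subring_add[OF B] by (auto simp: kaehler_free_def lookup_add)
  show "pm_scale c f \<in> F" if "c \<in> B" "f \<in> F" for c f
  proof -
    have "keys (pm_scale c f) \<subseteq> keys f" by (auto simp: in_keys_iff)
    then show ?thesis using that subring_mult[OF B] by (auto simp: kaehler_free_def)
  qed
qed

lemma d_F: "b \<in> B \<Longrightarrow> d b \<in> F"
  using subring_0[OF B] subring_1[OF B] by (auto simp: kaehler_free_def lookup_single when_def)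

lemma N_F: "N \<subseteq> F"
  unfolding kaehler_rel_def Let_def
proof (rule hull_minimal)
  show "submodule_over B pm_scale F" by (rule F_sub)
qed (use RB in \<open>auto intro!: submodule_diff[OF F_sub B] submodule_scale[OF F_sub] d_F subring_add[OF B] subring_mult[OF B]\<close>)

lemma F_span: "submodule_over B pm_scale M \<Longrightarrow> (\<And>b. b \<in> B \<Longrightarrow> d b \<in> M) \<Longrightarrow> F \<subseteq> M"
proof
  fix f assume M: "submodule_over B pm_scale M" "\<And>b. b \<in> B \<Longrightarrow> d b \<in> M" and f: "f \<in> F"
  have "f = (\<Sum>b\<in>keys f. pm_scale (lookup f b) (d b))"
    by (subst pm_sum) (simp add: pm_scale_simps)
  also have "\<dots> \<in> M"
    using f by (intro submodule_sum[OF M(1)] submodule_scale[OF M(1)] M(2)) (auto simp: kaehler_free_def)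
  finally show "f \<in> M" .
qed

text \<open>By the Leibniz rule the \<open>b\<close> whose differential is generated form a ring,
  and \<open>s * b = a\<close> with \<open>1 / s\<close> in \<open>B\<close> extends this to
  quotients.\<close>

lemma generators:
  assumes W: "W \<subseteq> is_subring hull (R \<union> G)" "1 \<in> W" "0 \<notin> W"
    and B_eq: "B = {a / s | a s. a \<in> is_subring hull (R \<union> G) \<and> s \<in> W}"
  shows "submodule_over B pm_scale hull (d ` G \<union> N) = F"
proof
  let ?A = "is_subring hull (R \<union> G)"
  let ?M = "submodule_over B pm_scale hull (d ` G \<union> N)"
  have M: "submodule_over B pm_scale ?M" by (rule submodule_hull)
  have AB: "?A \<subseteq> B" unfolding B_eq using W(2) by force
  have GA: "G \<subseteq> ?A" by (auto intro: hull_inc)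
  have NM: "N \<subseteq> ?M" by (auto intro: hull_inc)
  show "?M \<subseteq> F"
  proof (rule hull_minimal)
    show "submodule_over B pm_scale F" by (rule F_sub)
  qed (use N_F d_F GA AB in auto)
  have "is_subring {b \<in> B. d b \<in> ?M}"
    unfolding is_subring_def
  proof (safe, goal_cases)
    case 1 show ?case by (rule subring_1[OF B])
  next
    case 2 show ?case using NM N_R[OF subring_1[OF R]] by auto
  next
    case (3 a b) then show ?case by (intro subring_diff[OF B])
  next
    case (4 b c)
    have "d ((b - c) + c) - d (b - c) - d c \<in> ?M" using NM N_add[of "b - c" c] 4 subring_diff[OF B] by auto
    then have "d b - d c - (d ((b - c) + c) - d (b - c) - d c) \<in> ?M"
      by (rule submodule_diff[OF M B submodule_diff[OF M B 4(2) 4(4)]])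
    then show ?case by simp
  next
    case (5 a b) then show ?case by (intro subring_mult[OF B])
  next
    case (6 b c)
    have "d (b * c) - pm_scale b (d c) - pm_scale c (d b) \<in> ?M" using NM N_mult 6 by auto
    then have "(d (b * c) - pm_scale b (d c) - pm_scale c (d b)) + pm_scale b (d c) + pm_scale c (d b) \<in> ?M"
      using 6 by (intro submodule_add[OF M] submodule_scale[OF M])
    then show ?case by simp
  qed
  then have "?A \<subseteq> {b \<in> B. d b \<in> ?M}"
  proof (rule hull_minimal[rotated], safe)
    show "g \<in> B" "d g \<in> ?M" if "g \<in> G" for g using that GA AB by (auto intro: hull_inc)
    show "r \<in> B" "d r \<in> ?M" if "r \<in> R" for r using that RB NM N_R by auto
  qed
  then have dA: "d b \<in> ?M" if "b \<in> ?A" for b using that by auto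
  show "F \<subseteq> ?M"
  proof (rule F_span[OF M])
    fix b assume b: "b \<in> B"
    then obtain a s where as: "b = a / s" "a \<in> ?A" "s \<in> W" unfolding B_eq by blast
    have s: "s \<noteq> 0" "s \<in> B" "s \<in> ?A" using as W AB by auto
    have "1 / s \<in> B" unfolding B_eq using subring_1[OF is_subring_hull] as(3) by blast
    moreover have "d (s * b) - pm_scale s (d b) - pm_scale b (d s) \<in> ?M"
      using NM N_mult[OF s(2) b] by blast
    then have "d a - (d (s * b) - pm_scale s (d b) - pm_scale b (d s)) - pm_scale b (d s) \<in> ?M"
      by (rule submodule_diff[OF M B submodule_diff[OF M B dA[OF as(2)]] submodule_scale[OF M b dA[OF s(3)]]])
    moreover have "s * b = a" using s as by simp
    ultimately have "1 / s \<in> B" "pm_scale s (d b) \<in> ?M" by simp_all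
    then have "pm_scale (1 / s) (pm_scale s (d b)) \<in> ?M" by (rule submodule_scale[OF M])
    then show "d b \<in> ?M" using s by (simp add: pm_scale_simps)
  qed
qed

text \<open>A denominator \<open>s g\<close> of \<open>g\<close> yields the relation that
  \<open>s g\<close> times \<open>d g\<close> is zero, because \<open>s g * g\<close> and
  \<open>s g\<close> lie in \<open>R\<close> and have differential zero. These relations form a
  diagonal matrix.\<close>

lemma Jacobian_contains:
  assumes W: "W \<subseteq> is_subring hull (R \<union> set G)" "1 \<in> W" "0 \<notin> W"
    and B_eq: "B = {a / s | a s. a \<in> is_subring hull (R \<union> set G) \<and> s \<in> W}"
    and s: "\<And>g. g \<in> set G \<Longrightarrow> s g \<in> R" "\<And>g. g \<in> set G \<Longrightarrow> s g * g \<in> R"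
  shows "prod_list (map s G) \<in> Jacobian_ideal R B"
proof -
  let ?m = "length G" and ?gs = "map d G"
  define A where "A = mat ?m ?m (\<lambda>(i, j). if i = j then s (G ! i) else 0)"
  have A: "A \<in> carrier_mat ?m ?m" by (simp add: A_def)
  have GB: "set G \<subseteq> B" unfolding B_eq using W(2) by (force intro: hull_inc)
  have "diag_mat A = map s G"
    by (auto simp: diag_mat_def A_def intro: nth_equalityI)
  then have det: "det A = prod_list (map s G)"
    using det_upper_triangular[OF _ A] by (simp add: upper_triangular_def A_def)
  have el: "elements_mat A \<subseteq> B"
    using s RB subring_0[OF B] by (auto simp: A_def elements_mat_def)
  have rel: "(\<Sum>j<?m. pm_scale (A $$ (i, j)) (?gs ! j)) \<in> N" if i: "i < ?m" for i
  proof -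
    let ?g = "G ! i"
    have g: "?g \<in> set G" using i by simp
    have "(\<Sum>j<?m. pm_scale (A $$ (i, j)) (?gs ! j)) = (\<Sum>j<?m. if j = i then pm_scale (s ?g) (d ?g) else 0)"
      by (rule sum.cong) (use i in \<open>auto simp: A_def pm_scale_simps\<close>)
    also have "\<dots> = pm_scale (s ?g) (d ?g)" using i by simp
    also have "\<dots> = d (s ?g * ?g) - (d (s ?g * ?g) - pm_scale (s ?g) (d ?g) - pm_scale ?g (d (s ?g))) - pm_scale ?g (d (s ?g))"
      by simp
    also have "\<dots> \<in> N"
      using g s RB GB by (intro submodule_diff[OF N_sub B] submodule_scale[OF N_sub] N_R N_mult) auto
    finally show ?thesis .
  qed
  have "submodule_over B pm_scale hull (set ?gs \<union> N) = F"
    using generators[OF W B_eq] by simp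
  moreover have "set ?gs \<subseteq> F" using GB d_F by auto
  ultimately have "det A \<in> Jacobian_ideal R B"
    unfolding Jacobian_ideal_def Fitting0_def
    by (intro hull_inc CollectI exI[of _ A] exI[of _ ?gs] conjI refl) (use A el rel in simp_all)
  then show ?thesis by (simp add: det)
qed

lemma Jacobian_subset: "Jacobian_ideal R B \<subseteq> B"
  unfolding Jacobian_ideal_def Fitting0_def
proof (rule hull_minimal)
  show "submodule_over B (*) B"
    using subring_0[OF B] subring_add[OF B] subring_mult[OF B] by (auto simp: submodule_over_def)
qed (auto intro: det_in_subring[OF B])

text \<open>Derivations \<open>D l\<close> of the field that map \<open>R\<close> into \<open>B\<close> induce a \<open>B\<close>-linear map from the
  differentials to \<open>Q/B \<times> Q/B\<close>; if its image contains \<open>(1/x, 0)\<close> and \<open>(0, 1/x)\<close>, the block matrix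
  \<open>P\<close> below exhibits \<open>det A / x^2\<close> as a determinant with entries in \<open>B\<close>.\<close>

lemma Jacobian_bound:
  fixes D :: "nat \<Rightarrow> 'q \<Rightarrow> 'q"
  assumes D_add: "\<And>l a b. D l (a + b) = D l a + D l b" and D_mult: "\<And>l a b. D l (a * b) = a * D l b + b * D l a"
    and D_R: "\<And>l r. r \<in> R \<Longrightarrow> D l r \<in> B"
    and u: "\<And>k. k < 2 \<Longrightarrow> u k \<in> B" and x: "x \<noteq> 0"
    and Du: "\<And>k l. k < 2 \<Longrightarrow> l < 2 \<Longrightarrow> D l (u k) = (if k = l then 1 / x else 0)"
    and z: "z \<in> Jacobian_ideal R B"
  shows "z / (x * x) \<in> B"
proof -
  define Phi where "Phi l = lin (\<lambda>b c. c * D l b)" for l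
  have Phi_add: "Phi l (f + g) = Phi l f + Phi l g" for l f g
    unfolding Phi_def by (rule lin_add) (auto simp: distrib_right)
  have Phi_single: "Phi l (single b c) = c * D l b" for l b c
    unfolding Phi_def by (rule lin_single) simp
  have Phi_scale: "Phi l (pm_scale c f) = c * Phi l f" for l c f
    by (induction f rule: pm_induct) (auto simp: Phi_add Phi_single pm_scale_simps distrib_left)
  have Phi_diff: "Phi l (f - g) = Phi l f - Phi l g" for l f g
    using Phi_add[of l "f - g" g] by simp
  have Phi_0: "Phi l 0 = 0" for l using Phi_diff[of l 0 0] by simp
  have Phi_sum: "Phi l (sum f A) = (\<Sum>x\<in>A. Phi l (f x))" for l and f :: "nat \<Rightarrow> _" and A
    by (induction A rule: infinite_finite_induct) (simp_all add: Phi_0 Phi_add)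
  have Phi_N: "Phi l f \<in> B" if "f \<in> N" for l f
  proof -
    have "N \<subseteq> {f. Phi l f \<in> B}"
      unfolding kaehler_rel_def Let_def
    proof (rule hull_minimal)
      show "submodule_over B pm_scale {f. Phi l f \<in> B}"
        using subring_0[OF B] subring_add[OF B] subring_mult[OF B]
        by (auto simp: submodule_over_def Phi_0 Phi_add Phi_scale)
    qed (use subring_0[OF B] D_R in \<open>auto simp: Phi_diff Phi_scale Phi_single D_add D_mult\<close>)
    then show ?thesis using that by auto
  qed
  have "Jacobian_ideal R B \<subseteq> {z. z / (x * x) \<in> B}"
    unfolding Jacobian_ideal_def Fitting0_def
  proof (rule hull_minimal)
    show "submodule_over B (*) {z. z / (x * x) \<in> B}"
      unfolding submodule_over_def
    proof (safe, goal_cases)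
      case 1 show ?case using subring_0[OF B] by simp
    next
      case (2 a b) then show ?case using subring_add[OF B] by (simp add: add_divide_distrib)
    next
      case (3 c a) then show ?case using subring_mult[OF B, of c "a / (x * x)"] by simp
    qed
    show "{det A | A gs. set gs \<subseteq> F \<and> submodule_over B pm_scale hull (set gs \<union> N) = F \<and>
        A \<in> carrier_mat (length gs) (length gs) \<and> elements_mat A \<subseteq> B \<and>
        (\<forall>i < length gs. (\<Sum>j < length gs. pm_scale (A $$ (i, j)) (gs ! j)) \<in> N)} \<subseteq> {z. z / (x * x) \<in> B}"
    proof safe
      fix A :: "'q mat" and gs :: "('q \<Rightarrow>\<^sub>0 'q) list"
      let ?m = "length gs"
      assume gs: "set gs \<subseteq> F" "submodule_over B pm_scale hull (set gs \<union> N) = F"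
        and A: "A \<in> carrier_mat ?m ?m" "elements_mat A \<subseteq> B"
        and rel: "\<forall>i<?m. (\<Sum>j<?m. pm_scale (A $$ (i, j)) (gs ! j)) \<in> N"
      have comb: "\<exists>c. (\<forall>j<?m. c j \<in> B) \<and> f - (\<Sum>j<?m. pm_scale (c j) (gs ! j)) \<in> N" if f: "f \<in> F" for f
      proof -
        let ?S = "{f. \<exists>c. (\<forall>j<?m. c j \<in> B) \<and> f - (\<Sum>j<?m. pm_scale (c j) (gs ! j)) \<in> N}"
        have "submodule_over B pm_scale hull (set gs \<union> N) \<subseteq> ?S"
        proof (rule hull_minimal)
          show "set gs \<union> N \<subseteq> ?S"
          proof
            fix f assume "f \<in> set gs \<union> N"
            then show "f \<in> ?S"
            proof
              assume "f \<in> set gs"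
              then obtain i where i: "i < ?m" "f = gs ! i" by (auto simp: in_set_conv_nth)
              have "(\<Sum>j<?m. pm_scale (if j = i then 1 else 0) (gs ! j)) = (\<Sum>j<?m. if j = i then gs ! j else 0)"
                by (rule sum.cong) (auto simp: pm_scale_simps)
              then have "f - (\<Sum>j<?m. pm_scale (if j = i then 1 else 0) (gs ! j)) \<in> N"
                using i submodule_0[OF N_sub] by simp
              then show ?thesis using subring_0[OF B] subring_1[OF B]
                by (intro CollectI exI[of _ "\<lambda>j. if j = i then 1 else 0"]) auto
            next
              assume "f \<in> N"
              then show ?thesis using subring_0[OF B] by (intro CollectI exI[of _ "\<lambda>j. 0"]) (auto simp: pm_scale_simps)
            qed
          qed
          show "submodule_over B pm_scale ?S"
            unfolding submodule_over_def
          proof (intro conjI ballI)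
            show "0 \<in> ?S" using subring_0[OF B] submodule_0[OF N_sub]
              by (intro CollectI exI[of _ "\<lambda>j. 0"]) (auto simp: pm_scale_simps)
          next
            fix f g assume "f \<in> ?S" "g \<in> ?S"
            then obtain c e where c: "\<forall>j<?m. c j \<in> B" "f - (\<Sum>j<?m. pm_scale (c j) (gs ! j)) \<in> N"
              and e: "\<forall>j<?m. e j \<in> B" "g - (\<Sum>j<?m. pm_scale (e j) (gs ! j)) \<in> N" by blast
            have "f + g - (\<Sum>j<?m. pm_scale (c j + e j) (gs ! j)) =
                (f - (\<Sum>j<?m. pm_scale (c j) (gs ! j))) + (g - (\<Sum>j<?m. pm_scale (e j) (gs ! j)))"
              by (simp add: pm_scale_simps sum.distrib)
            also have "\<dots> \<in> N" using c e by (intro submodule_add[OF N_sub])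
            finally show "f + g \<in> ?S" using c e subring_add[OF B] by (intro CollectI exI[of _ "\<lambda>j. c j + e j"]) auto
          next
            fix b f assume b: "b \<in> B" and "f \<in> ?S"
            then obtain c where c: "\<forall>j<?m. c j \<in> B" "f - (\<Sum>j<?m. pm_scale (c j) (gs ! j)) \<in> N" by blast
            have "pm_scale b f - (\<Sum>j<?m. pm_scale (b * c j) (gs ! j)) = pm_scale b (f - (\<Sum>j<?m. pm_scale (c j) (gs ! j)))"
            proof -
              have "pm_scale b (f - g) = pm_scale b f - pm_scale b g" for f g :: "'q \<Rightarrow>\<^sub>0 'q"
                by (rule poly_mapping_eqI) (simp add: lookup_minus right_diff_distrib)
              then show ?thesis by (simp add: pm_scale_sum pm_scale_simps)
            qed
            also have "\<dots> \<in> N" using c b by (intro submodule_scale[OF N_sub])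
            finally show "pm_scale b f \<in> ?S" using c b subring_mult[OF B] by (intro CollectI exI[of _ "\<lambda>j. b * c j"]) auto
          qed
        qed
        then show ?thesis using f gs(2) by auto
      qed
      have "\<forall>k. \<exists>c. k < 2 \<longrightarrow> (\<forall>j<?m. c j \<in> B) \<and> d (u k) - (\<Sum>j<?m. pm_scale (c j) (gs ! j)) \<in> N"
        using comb[OF d_F[OF u]] by blast
      then obtain c where c: "\<And>k j. k < 2 \<Longrightarrow> j < ?m \<Longrightarrow> c k j \<in> B"
        "\<And>k. k < 2 \<Longrightarrow> d (u k) - (\<Sum>j<?m. pm_scale (c k j) (gs ! j)) \<in> N" by metis
      \<comment> \<open>\<open>H\<close> holds the images of the generators under the derivations
        and need not have entries in \<open>B\<close>. The entries of \<open>A * H\<close> and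
        \<open>G\<close> are images of elements of \<open>N\<close>, and therefore do lie in
        \<open>B\<close>.\<close>
      define H where "H = mat ?m 2 (\<lambda>(j, l). Phi l (gs ! j))"
      define C where "C = mat 2 ?m (\<lambda>(k, j). c k j)"
      define G where "G = mat 2 2 (\<lambda>(k, l). (if k = l then 1 / x else 0) - (\<Sum>j<?m. c k j * Phi l (gs ! j)))"
      define P where "P = four_block_mat A (- (A * H)) C G"
      have H: "H \<in> carrier_mat ?m 2" and C: "C \<in> carrier_mat 2 ?m" and G: "G \<in> carrier_mat 2 2"
        by (simp_all add: H_def C_def G_def)
      have AH: "A * H \<in> carrier_mat ?m 2" using A H by simp
      have P: "P \<in> carrier_mat (?m + 2) (?m + 2)" unfolding P_def by (rule four_block_carrier_mat[OF A(1) G])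
      have Ael: "A $$ (i, j) \<in> B" if "i < ?m" "j < ?m" for i j using A that by auto
      have AH_el: "(A * H) $$ (i, l) \<in> B" if "i < ?m" "l < 2" for i l
      proof -
        have "(A * H) $$ (i, l) = (\<Sum>j<?m. A $$ (i, j) * Phi l (gs ! j))"
          using A(1) H that by (auto simp: scalar_prod_def H_def atLeast0LessThan intro!: sum.cong)
        also have "\<dots> = Phi l (\<Sum>j<?m. pm_scale (A $$ (i, j)) (gs ! j))" by (simp add: Phi_sum Phi_scale)
        also have "\<dots> \<in> B" using Phi_N rel that by blast
        finally show ?thesis .
      qed
      have G_el: "G $$ (k, l) \<in> B" if kl: "k < 2" "l < 2" for k l
      proof -
        have "G $$ (k, l) = Phi l (d (u k) - (\<Sum>j<?m. pm_scale (c k j) (gs ! j)))"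
          using kl by (simp add: G_def Phi_diff Phi_single Phi_sum Phi_scale Du)
        then show ?thesis using Phi_N c(2)[OF kl(1)] by simp
      qed
      have "elements_mat P \<subseteq> B"
      proof
        fix y assume "y \<in> elements_mat P"
        then obtain i j where ij: "i < ?m + 2" "j < ?m + 2" "y = P $$ (i, j)" using P by auto
        show "y \<in> B"
          using ij A(1) H C G AH_el[of i "j - ?m"] G_el[of "i - ?m" "j - ?m"] Ael[of i j] c(1)[of "i - ?m" j]
            subring_uminus[OF B]
          by (cases "i < ?m"; cases "j < ?m") (auto simp: P_def C_def)
      qed
      then have detP: "det P \<in> B" by (rule det_in_subring[OF B P])
      \<comment> \<open>A unimodular column operation: it clears the upper right block of
        \<open>P\<close> and turns the lower right one into \<open>1 / x\<close> times the
        identity.\<close>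
      define T where "T = four_block_mat (1\<^sub>m ?m) H (0\<^sub>m 2 ?m) (1\<^sub>m 2)"
      have T: "T \<in> carrier_mat (?m + 2) (?m + 2)" unfolding T_def by (rule four_block_carrier_mat) auto
      have "det T = 1"
        unfolding T_def using H by (subst det_four_block_mat_lower_left_zero) auto
      have "P * T = four_block_mat (A * 1\<^sub>m ?m + - (A * H) * 0\<^sub>m 2 ?m) (A * H + - (A * H) * 1\<^sub>m 2)
          (C * 1\<^sub>m ?m + G * 0\<^sub>m 2 ?m) (C * H + G * 1\<^sub>m 2)"
        unfolding P_def T_def
        by (rule mult_four_block_mat[where ?nr1.0 = ?m and ?n1.0 = ?m and ?n2.0 = 2 and ?nr2.0 = 2 and ?nc1.0 = ?m and ?nc2.0 = 2])
          (use A AH C G H in auto)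
      also have "\<dots> = four_block_mat A (0\<^sub>m ?m 2) C ((1 / x) \<cdot>\<^sub>m 1\<^sub>m 2)"
      proof -
        have "A * 1\<^sub>m ?m + - (A * H) * 0\<^sub>m 2 ?m = A" using A AH by (intro eq_matI) (auto simp: scalar_prod_def)
        moreover have "A * H + - (A * H) * 1\<^sub>m 2 = 0\<^sub>m ?m 2" using A(1) AH H by (intro eq_matI) auto
        moreover have "C * 1\<^sub>m ?m + G * 0\<^sub>m 2 ?m = C" using C G by (intro eq_matI) (auto simp: scalar_prod_def)
        moreover have "C * H + G * 1\<^sub>m 2 = (1 / x) \<cdot>\<^sub>m 1\<^sub>m 2"
        proof (rule eq_matI)
          fix k l assume "k < dim_row ((1 / x) \<cdot>\<^sub>m 1\<^sub>m 2)" "l < dim_col ((1 / x) \<cdot>\<^sub>m 1\<^sub>m 2)"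
          then have kl: "k < 2" "l < 2" by auto
          have "(C * H) $$ (k, l) = (\<Sum>j<?m. c k j * Phi l (gs ! j))"
            using C H kl by (auto simp: scalar_prod_def C_def H_def atLeast0LessThan intro!: sum.cong)
          moreover have "G * 1\<^sub>m 2 = G" using G by simp
          ultimately show "(C * H + G * 1\<^sub>m 2) $$ (k, l) = ((1 / x) \<cdot>\<^sub>m 1\<^sub>m 2) $$ (k, l)"
            using kl C H G by (simp add: G_def)
        qed (use C H G in auto)
        ultimately show ?thesis by simp
      qed
      finally have "det (P * T) = det A * det ((1 / x) \<cdot>\<^sub>m 1\<^sub>m 2 :: 'q mat)"
        using A C by (simp add: det_four_block_mat_upper_right_zero)
      then have "det P = det A * (1 / x) ^ 2"
        using det_mult[OF P T] \<open>det T = 1\<close> by (simp add: det_smult)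
      then show "det A / (x * x) \<in> B" using detP by (simp add: power2_eq_square)
    qed
  qed
  then show ?thesis using z by auto
qed

end

section \<open>Discrete valuations\<close>

locale dval =
  fixes v :: "'q::field \<Rightarrow> int"
  assumes dv: "discrete_valuation v"
begin

lemma v_mult: "a \<noteq> 0 \<Longrightarrow> b \<noteq> 0 \<Longrightarrow> v (a * b) = v a + v b"
  and v_add: "a \<noteq> 0 \<Longrightarrow> b \<noteq> 0 \<Longrightarrow> a + b \<noteq> 0 \<Longrightarrow> min (v a) (v b) \<le> v (a + b)"
  using dv by (auto simp: discrete_valuation_def)

lemma v_1 [simp]: "v 1 = 0" using v_mult[of 1 1] by simp

lemma v_uminus [simp]: "v (- a) = v a"
proof (cases "a = 0")
  case False
  have "v (-1) = 0" using v_mult[of "-1" "-1"] by simp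
  then show ?thesis using v_mult[of "-1" a] False by simp
qed simp

lemma v_power: "a \<noteq> 0 \<Longrightarrow> v (a ^ m) = int m * v a"
  by (induction m) (auto simp: v_mult algebra_simps)

lemma v_divide: "a \<noteq> 0 \<Longrightarrow> b \<noteq> 0 \<Longrightarrow> v (a / b) = v a - v b"
  using v_mult[of "a / b" b] by simp

lemma v_prod: "(\<And>x. x \<in> A \<Longrightarrow> f x \<noteq> 0) \<Longrightarrow> v (prod f A) = (\<Sum>x\<in>A. v (f x))"
  by (induction A rule: infinite_finite_induct) (auto simp: v_mult)

definition vge :: "int \<Rightarrow> 'q set" where "vge k = {a. a = 0 \<or> k \<le> v a}"

lemma val_ring_vge: "val_ring v = vge 0" by (simp add: val_ring_def vge_def)

lemma vge_0 [simp]: "0 \<in> vge k" by (simp add: vge_def)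

lemma vge_add: "a \<in> vge k \<Longrightarrow> b \<in> vge k \<Longrightarrow> a + b \<in> vge k"
  using v_add[of a b] by (cases "a = 0"; cases "b = 0"; cases "a + b = 0") (auto simp: vge_def)

lemma vge_mult: "a \<in> vge k \<Longrightarrow> b \<in> vge l \<Longrightarrow> a * b \<in> vge (k + l)"
  by (cases "a = 0"; cases "b = 0") (auto simp: vge_def v_mult)

lemma vge_uminus: "a \<in> vge k \<Longrightarrow> - a \<in> vge k"
  by (auto simp: vge_def)

lemma vge_sum: "(\<And>x. x \<in> A \<Longrightarrow> f x \<in> vge k) \<Longrightarrow> sum f A \<in> vge k"
  by (induction A rule: infinite_finite_induct) (auto intro: vge_add)

lemma subring_val_ring: "is_subring (val_ring v)"
  unfolding is_subring_def val_ring_vge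
proof (intro conjI ballI)
  show "1 \<in> vge 0" by (simp add: vge_def)
  show "a - b \<in> vge 0" if "a \<in> vge 0" "b \<in> vge 0" for a b
    using vge_add[OF that(1) vge_uminus[OF that(2)]] by simp
  show "a * b \<in> vge 0" if "a \<in> vge 0" "b \<in> vge 0" for a b
    using vge_mult[OF that] by simp
qed

lemma val_ideal_le: "a \<in> L \<Longrightarrow> a \<noteq> 0 \<Longrightarrow> L \<subseteq> val_ring v \<Longrightarrow> val_ideal v L \<le> v a"
  unfolding val_ideal_def by (rule cInf_lower) (auto simp: val_ring_def intro!: bdd_belowI[of _ 0])

lemma val_ideal_ge: "a \<in> L \<Longrightarrow> a \<noteq> 0 \<Longrightarrow> L \<subseteq> vge k \<Longrightarrow> k \<le> val_ideal v L"
  unfolding val_ideal_def by (rule cInf_greatest) (auto simp: vge_def)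

end

section \<open>Derivations of polynomials and of fractions\<close>

definition pd :: "3 \<Rightarrow> 'k::field poly3 \<Rightarrow> 'k poly3" where
  "pd i = lin (\<lambda>e c. single (e - eps i) (of_nat (lookup e i) * c))"

lemma pd_add: "pd i (f + g) = pd i f + pd i g"
  unfolding pd_def by (rule lin_add) (auto simp: single_add distrib_left)

lemma pd_single: "pd i (single e c) = single (e - eps i) (of_nat (lookup e i) * c)"
  unfolding pd_def by (rule lin_single) simp

lemma pd_mult: "pd i (f * g) = f * pd i g + g * pd i f"
proof (induction f rule: pm_induct)
  case (single e a)
  show ?case
  proof (induction g rule: pm_induct)
    case (single f b)
    let ?ei = "lookup e i" and ?fi = "lookup f i"
    have shift: "e' + (f' - eps i) = e' + f' - eps i" if "lookup f' i > 0" for e' f'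
      by (rule poly_mapping_eqI) (use that in \<open>auto simp: lookup_add lookup_minus lookup_single when_def\<close>)
    have 1: "single e a * pd i (single f b) = single (e + f - eps i) (of_nat ?fi * (a * b))"
      using shift[of f e] by (cases "?fi = 0") (auto simp: pd_single mult_single ac_simps)
    have 2: "single f b * pd i (single e a) = single (e + f - eps i) (of_nat ?ei * (a * b))"
      using shift[of e f] by (cases "?ei = 0") (auto simp: pd_single mult_single ac_simps)
    show ?case unfolding 1 2
      by (simp add: mult_single pd_single lookup_add distrib_right add.commute flip: single_add)
  qed (simp add: distrib_left distrib_right pd_add)
qed (simp add: distrib_left distrib_right pd_add)

locale derivation =
  fixes D :: "'a::idom \<Rightarrow> 'a"
  assumes D_add: "D (a + b) = D a + D b" and D_mult: "D (a * b) = a * D b + b * D a"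
begin

definition dF :: "'a fract \<Rightarrow> 'a fract" where
  "dF q = (SOME y. \<exists>a b. b \<noteq> 0 \<and> q = Fract a b \<and> y = Fract (D a * b - a * D b) (b * b))"

lemma dF_Fract:
  assumes b: "b \<noteq> 0" shows "dF (Fract a b) = Fract (D a * b - a * D b) (b * b)"
proof -
  have uniq: "Fract (D a' * b' - a' * D b') (b' * b') = Fract (D a * b - a * D b) (b * b)"
    if b': "b' \<noteq> 0" "Fract a b = Fract a' b'" for a' b'
  proof -
    have e: "a * b' = a' * b" using b b' by (simp add: eq_fract)
    have "D (a * b') = D (a' * b)" using e by simp
    then have "a * D b' + b' * D a = a' * D b + b * D a'" by (simp add: D_mult)
    with e have "(D a' * b' - a' * D b') * (b * b) = (D a * b - a * D b) * (b' * b')" by Groebner_Basis.algebra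
    then show ?thesis using b b' by (simp add: eq_fract)
  qed
  show ?thesis
    unfolding dF_def by (rule some_equality) (use uniq b in blast)+
qed

lemma D_1: "D 1 = 0" using D_mult[of 1 1] unfolding mult_1 by (simp only: add_cancel_right_right)

lemma dF_to_fract: "dF (to_fract a) = to_fract (D a)"
  unfolding to_fract_def by (subst dF_Fract) (auto simp: D_1)

lemma dF_add: "dF (p + q) = dF p + dF q"
proof (cases p rule: Fract_cases, cases q rule: Fract_cases)
  fix a b c d assume "p = Fract a b" "b \<noteq> 0" "q = Fract c d" "d \<noteq> 0"
  then show ?thesis by (simp add: dF_Fract eq_fract D_add D_mult algebra_simps)
qed

lemma dF_mult: "dF (p * q) = p * dF q + q * dF p"
proof (cases p rule: Fract_cases, cases q rule: Fract_cases)
  fix a b c d assume "p = Fract a b" "b \<noteq> 0" "q = Fract c d" "d \<noteq> 0"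
  then show ?thesis by (simp add: dF_Fract eq_fract D_mult algebra_simps)
qed

end

interpretation pd: derivation "pd i :: 'k::field poly3 \<Rightarrow> 'k poly3" for i
  by standard (rule pd_add, rule pd_mult)

section \<open>Valuations that are nonnegative on the polynomial ring\<close>

lemma subring_range_to_fract: "is_subring (range to_fract)"
  unfolding is_subring_def by (auto simp flip: to_fract_diff to_fract_mult intro: rangeI[of to_fract 1, unfolded to_fract_1])

lemma to_fract_sum: "to_fract (sum f A) = (\<Sum>x\<in>A. to_fract (f x))"
  by (induction A rule: infinite_finite_induct) auto

lemma to_fract_prod: "to_fract (prod f A) = (\<Prod>x\<in>A. to_fract (f x))"
  by (induction A rule: infinite_finite_induct) auto

lemma to_fract_power: "to_fract (a ^ m) = to_fract a ^ m"
  by (induction m) auto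

locale poly_val = dval v for v :: "'k::field poly3 fract \<Rightarrow> int" +
  assumes nonneg: "range to_fract \<subseteq> val_ring v"
begin

abbreviation X :: "3 \<Rightarrow> 'k poly3 fract" where "X i \<equiv> to_fract (mo (eps i))"

lemma X_nz: "X i \<noteq> 0" by simp

lemma to_fract_vge_0: "to_fract f \<in> vge 0"
  using nonneg by (auto simp: val_ring_vge)

lemma mo_X: "to_fract (mo e) = (\<Prod>i\<in>UNIV. X i ^ lookup e i)"
proof -
  have "(mo e :: 'k poly3) = (\<Prod>i\<in>UNIV. mo (eps i) ^ lookup e i)"
  proof -
    have pow: "(mo (eps i) :: 'k poly3) ^ m = mo (single i m)" for i m
      by (induction m) (auto simp: mult_single single_one plus_1_eq_Suc simp flip: single_add)
    have "e = single 0 (lookup e 0) + single 1 (lookup e 1)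
        + single 2 (lookup e 2)"
      by (rule ex3_eqI) (auto simp: lookup_add lookup_single when_def)
    then show ?thesis unfolding prod_3 pow by (simp add: mult_single)
  qed
  then show ?thesis by (simp add: to_fract_prod to_fract_power)
qed

lemma v_mo: "v (to_fract (mo e)) = (\<Sum>i\<in>UNIV. int (lookup e i) * v (X i))"
proof -
  have "v (to_fract (mo e)) = (\<Sum>i\<in>UNIV. v (X i ^ lookup e i))"
    by (subst mo_X, rule v_prod) simp
  then show ?thesis by (simp only: v_power[OF X_nz])
qed

lemma Mge_vge:
  assumes mu: "\<And>i. mu \<le> v (X i)" and mu0: "0 \<le> mu" and f: "f \<in> Mge d"
  shows "to_fract f \<in> vge (int d * mu)"
proof -
  have "to_fract (single e (lookup f e)) \<in> vge (int d * mu)" if e: "e \<in> keys f" for e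
  proof -
    have "int d * mu \<le> int (tdeg e) * mu" using f e mu0 by (intro mult_right_mono) (auto simp: Mge_def)
    also have "\<dots> = (\<Sum>i\<in>UNIV. int (lookup e i) * mu)" by (simp add: tdeg_def sum_distrib_right)
    also have "\<dots> \<le> v (to_fract (mo e))" by (subst v_mo, rule sum_mono, rule mult_left_mono[OF mu]) simp
    finally have "to_fract (mo e) \<in> vge (int d * mu)" by (simp add: vge_def)
    then have "to_fract (cst (lookup f e)) * to_fract (mo e) \<in> vge (0 + int d * mu)"
      by (intro vge_mult to_fract_vge_0)
    then show ?thesis by (simp add: mult_single flip: to_fract_mult)
  qed
  then have "to_fract (\<Sum>e\<in>keys f. single e (lookup f e)) \<in> vge (int d * mu)"
    unfolding to_fract_sum by (rule vge_sum)
  then show ?thesis using poly3_sum[of f] by metis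
qed

text \<open>As \<open>X i0\<close> has least value, the other two variables divided by
  \<open>X i0\<close> lie in the valuation ring, and their partial derivatives with respect to each
  other's numerators are \<open>1 / X i0\<close> or 0. These are the data of
  \<open>Jacobian_bound\<close>.\<close>

lemma Jacobian_vge:
  assumes mu: "\<And>i. v (X i0) \<le> v (X i)"
  shows "Jacobian_ideal (range to_fract) (val_ring v) \<subseteq> vge (2 * v (X i0))"
proof
  fix z assume z: "z \<in> Jacobian_ideal (range to_fract) (val_ring v)"
  interpret kaehler "range to_fract" "val_ring v"
    by standard (rule subring_val_ring, rule subring_range_to_fract, rule nonneg)
  obtain i1 i2 where i: "i1 \<noteq> i0" "i2 \<noteq> i0" "i1 \<noteq> i2"
  proof -
    have "\<forall>i::3. \<exists>i1 i2. i1 \<noteq> i \<and> i2 \<noteq> i \<and> i1 \<noteq> i2"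
      unfolding all_3 by (intro conjI exI[of _ "1::3"] exI[of _ "2::3"] exI[of _ "0::3"]; simp)
    then show thesis using that by blast
  qed
  define idx :: "nat \<Rightarrow> 3" where "idx l = (if l = 0 then i1 else i2)" for l
  define D :: "nat \<Rightarrow> 'k poly3 fract \<Rightarrow> 'k poly3 fract" where "D l = pd.dF (idx l)" for l
  have D_X: "D l (X j) = (if j = idx l then 1 else 0)" for l j
    by (simp add: D_def pd.dF_to_fract pd_single lookup_single when_def single_one)
  have "z / (X i0 * X i0) \<in> val_ring v"
  proof (rule Jacobian_bound[OF _ _ _ _ _ _ z])
    show "D l (a + b) = D l a + D l b" for l a b by (simp add: D_def pd.dF_add)
    show Dm: "D l (a * b) = a * D l b + b * D l a" for l a b by (simp add: D_def pd.dF_mult)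
    show "D l r \<in> val_ring v" if "r \<in> range to_fract" for l r
      using that nonneg by (auto simp: D_def pd.dF_to_fract)
    show "X (idx k) / X i0 \<in> val_ring v" for k
      using mu[of "idx k"] by (simp add: val_ring_def v_divide)
    show "X i0 \<noteq> 0" by simp
    show "D l (X (idx k) / X i0) = (if k = l then 1 / X i0 else 0)" if "k < 2" "l < 2" for k l
    proof -
      have "idx l \<noteq> i0" using i by (auto simp: idx_def)
      have "D l (X (idx k)) = X (idx k) / X i0 * D l (X i0) + X i0 * D l (X (idx k) / X i0)"
        using Dm[of l "X (idx k) / X i0" "X i0"] by simp
      then have "D l (X (idx k) / X i0) = D l (X (idx k)) / X i0"
        using \<open>idx l \<noteq> i0\<close> by (simp add: D_X)
      moreover have "idx k = idx l \<longleftrightarrow> k = l" using that i by (auto simp: idx_def)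
      ultimately show ?thesis by (simp add: D_X)
    qed
  qed
  then show "z \<in> vge (2 * v (X i0))"
    by (cases "z = 0") (auto simp: val_ring_def vge_def v_divide v_mult)
qed

text \<open>Ensures that \<open>val_ideal\<close> of the Jacobian ideal is a minimum over a nonempty
  set. Each of the finitely many algebra generators has a polynomial denominator, so
  \<open>Jacobian_contains\<close> applies.\<close>

lemma Jacobian_nonzero:
  assumes "ess_finite_type (range to_fract) (val_ring v)"
  shows "\<exists>z\<in>Jacobian_ideal (range to_fract) (val_ring v). z \<noteq> 0"
proof -
  interpret kaehler "range to_fract" "val_ring v"
    by standard (rule subring_val_ring, rule subring_range_to_fract, rule nonneg)
  obtain G W where GW: "finite G" "W \<subseteq> is_subring hull (range to_fract \<union> G)" "1 \<in> W" "0 \<notin> W"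
    "val_ring v = {a / s | a s. a \<in> is_subring hull (range to_fract \<union> G) \<and> s \<in> W}"
    using assms unfolding ess_finite_type_def by blast
  obtain Gl where Gl: "set Gl = G" using finite_list[OF GW(1)] by blast
  have "\<forall>g :: 'k poly3 fract. \<exists>b. b \<noteq> 0 \<and> to_fract b * g \<in> range to_fract"
  proof
    fix g :: "'k poly3 fract"
    obtain a b where ab: "g = Fract a b" "b \<noteq> 0" by (cases g rule: Fract_cases)
    have "to_fract b * g = to_fract a" using ab by (simp add: to_fract_def eq_fract mult.commute)
    then show "\<exists>b. b \<noteq> 0 \<and> to_fract b * g \<in> range to_fract" using ab(2) by (metis rangeI)
  qed
  from choice[OF this] obtain s where s: "\<forall>g :: 'k poly3 fract. s g \<noteq> 0 \<and> to_fract (s g) * g \<in> range to_fract"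
    by (elim exE) (rule that)
  have "prod_list (map (\<lambda>g. to_fract (s g)) Gl) \<in> Jacobian_ideal (range to_fract) (val_ring v)"
    by (rule Jacobian_contains[OF _ GW(3,4)]) (use GW Gl s in auto)
  moreover have "prod_list (map (\<lambda>g. to_fract (s g)) xs) \<noteq> 0" for xs
    using s by (induction xs) auto
  ultimately show ?thesis by blast
qed

end

section \<open>The power of the maximal ideal is contained in the adjoint\<close>

context edge_exponents
begin

lemma I3_subset: "ideal_pow (mi E) 3 \<subseteq> Mge (3 * n)"
  using I_pow_Mge[of 3] by (simp add: mult.commute)

lemma pure_in_I3: "mo (single i (3 * n)) \<in> ideal_pow (mi E) 3"
proof -
  have "single i n \<in> E" using Jx_E by (auto simp: Jx_def)
  then have "single i n + (single i n + (single i n + 0)) \<in> nsum (Suc (Suc (Suc 0))) E"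
    unfolding nsum.simps setadd_def by blast
  moreover have "single i n + (single i n + (single i n + 0)) = single i (3 * n)"
    unfolding single_add[symmetric] add_0_right by (rule arg_cong[of _ _ "single i"]) simp
  ultimately show ?thesis using mo_nsum[of "single i (3 * n)" 3] by (simp add: numeral_3_eq_3)
qed

lemma Mge_subset_adjoint:
  "to_fract ` Mge (3 * n - 2) \<subseteq> adjoint (range to_fract) (to_fract ` ideal_pow (mi E :: 'k::field poly3 set) 3)"
  unfolding adjoint_def
proof (intro subsetI CollectI allI impI)
  fix r :: "'k poly3 fract" and v :: "'k poly3 fract \<Rightarrow> int"
  let ?L = "to_fract ` ideal_pow (mi E :: 'k poly3 set) 3"
  let ?J = "Jacobian_ideal (range to_fract) (val_ring v)"
  assume "r \<in> to_fract ` Mge (3 * n - 2)" and v: "divisorial_valuation (range to_fract) v \<and> ess_finite_type (range to_fract) (val_ring v)"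
  then obtain f where f: "r = to_fract f" "f \<in> Mge (3 * n - 2)" by blast
  interpret poly_val v
    by standard (use v in \<open>auto simp: divisorial_valuation_def\<close>)
  have "\<exists>i0. \<forall>i. v (X i0) \<le> v (X i)"
  proof -
    have "Min (range (\<lambda>i. v (X i))) \<in> range (\<lambda>i. v (X i))" by (rule Min_in) auto
    then obtain i0 where "v (X i0) = Min (range (\<lambda>i. v (X i)))" by force
    moreover have "Min (range (\<lambda>i. v (X i))) \<le> v (X i)" for i by (rule Min_le) auto
    ultimately show ?thesis by metis
  qed
  then obtain i0 where i0: "\<And>i. v (X i0) \<le> v (X i)" by blast
  have mu0: "0 \<le> v (X i0)" using to_fract_vge_0[of "mo (eps i0)"] by (simp add: vge_def)
  obtain z where "z \<in> ?J" "z \<noteq> 0" using Jacobian_nonzero v by blast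
  then have J: "2 * v (X i0) \<le> val_ideal v ?J" using Jacobian_vge[OF i0] by (rule val_ideal_ge)
  have "val_ideal v ?L \<le> v (to_fract (mo (single i0 (3 * n))))"
    using pure_in_I3 nonneg by (intro val_ideal_le) auto
  also have "\<dots> = (\<Sum>i\<in>UNIV. if i = i0 then int (3 * n) * v (X i) else 0)"
    by (subst v_mo, rule sum.cong) (auto simp: lookup_single when_def)
  also have "\<dots> = int (3 * n) * v (X i0)" by simp
  finally have L: "val_ideal v ?L \<le> int (3 * n) * v (X i0)" .
  have "r \<in> vge (int (3 * n - 2) * v (X i0))" unfolding f(1) by (rule Mge_vge[OF i0 mu0 f(2)])
  moreover have "int (3 * n - 2) * v (X i0) = int (3 * n) * v (X i0) - 2 * v (X i0)"
    using n_pos by (simp add: of_nat_diff algebra_simps)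
  ultimately show "r = 0 \<or> val_ideal v ?L - val_ideal v ?J \<le> v r" using L J by (auto simp: vge_def)
qed

end

section \<open>The adjoint lies in \<open>\<mm>^(3n-2)\<close>: the order valuation and the
  valuations at primes\<close>

section \<open>Valuations of the field of fractions from order functions\<close>

text \<open>The last condition normalizes: it makes the extension to fractions surjective onto the
  integers.\<close>

locale order_fun =
  fixes w :: "'a::idom \<Rightarrow> nat"
  assumes w_mult: "a \<noteq> 0 \<Longrightarrow> b \<noteq> 0 \<Longrightarrow> w (a * b) = w a + w b"
    and w_add: "a \<noteq> 0 \<Longrightarrow> b \<noteq> 0 \<Longrightarrow> a + b \<noteq> 0 \<Longrightarrow> min (w a) (w b) \<le> w (a + b)"
    and w_ex_1: "\<exists>a. a \<noteq> 0 \<and> w a = 1"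
begin

definition fv :: "'a fract \<Rightarrow> int" where
  "fv q = (SOME z. \<exists>a b. a \<noteq> 0 \<and> b \<noteq> 0 \<and> q = Fract a b \<and> z = int (w a) - int (w b))"

lemma fv_Fract:
  assumes "a \<noteq> 0" "b \<noteq> 0" shows "fv (Fract a b) = int (w a) - int (w b)"
proof -
  have "int (w a') - int (w b') = int (w a) - int (w b)"
    if ab': "a' \<noteq> 0" "b' \<noteq> 0" "Fract a b = Fract a' b'" for a' b'
  proof -
    have "a * b' = a' * b" using assms ab' by (simp add: eq_fract)
    then have "w a + w b' = w a' + w b" using assms ab' by (metis w_mult)
    then show ?thesis by simp
  qed
  then show ?thesis unfolding fv_def using assms by (intro some_equality) blast+
qed

lemma w_1: "w 1 = 0" using w_mult[of 1 1] by simp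

lemma fv_to_fract: "a \<noteq> 0 \<Longrightarrow> fv (to_fract a) = int (w a)"
  unfolding to_fract_def by (simp add: fv_Fract w_1)

lemma w_power: "a \<noteq> 0 \<Longrightarrow> w (a ^ m) = m * w a"
  by (induction m) (auto simp: w_1 w_mult)

lemma dv_fv: "discrete_valuation fv"
  unfolding discrete_valuation_def
proof (intro conjI allI impI)
  fix p q :: "'a fract"
  obtain a b where p: "p = Fract a b" "b \<noteq> 0" by (cases p rule: Fract_cases)
  obtain c d where q: "q = Fract c d" "d \<noteq> 0" by (cases q rule: Fract_cases)
  show "fv (p * q) = fv p + fv q" if nz: "p \<noteq> 0 \<and> q \<noteq> 0"
  proof -
    have "a \<noteq> 0" "c \<noteq> 0" using nz p q by (auto simp: fract_collapse)
    then show ?thesis using p q by (simp add: fv_Fract w_mult)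
  qed
  show "min (fv p) (fv q) \<le> fv (p + q)" if nz: "p \<noteq> 0 \<and> q \<noteq> 0 \<and> p + q \<noteq> 0"
  proof -
    have ac: "a \<noteq> 0" "c \<noteq> 0" using nz p q by (auto simp: fract_collapse)
    have pq: "p + q = Fract (a * d + c * b) (b * d)" using p q by simp
    then have s: "a * d + c * b \<noteq> 0" using nz by (auto simp: fract_collapse)
    have "min (w a + w d) (w c + w b) \<le> w (a * d + c * b)"
      using w_add[OF _ _ s] ac p q by (simp add: w_mult)
    then show ?thesis unfolding pq using s ac p q by (simp add: fv_Fract w_mult)
  qed
next
  obtain a where a: "a \<noteq> 0" "w a = 1" using w_ex_1 by blast
  have "\<exists>q. q \<noteq> 0 \<and> fv q = z" for z
  proof (cases "z \<ge> 0")
    case True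
    then have "fv (to_fract (a ^ nat z)) = z" using a by (subst fv_to_fract) (auto simp: w_power)
    moreover have "to_fract (a ^ nat z) \<noteq> 0" using a by simp
    ultimately show ?thesis by blast
  next
    case False
    then have "fv (Fract 1 (a ^ nat (- z))) = z" using a by (subst fv_Fract) (auto simp: w_power w_1)
    moreover have "Fract 1 (a ^ nat (- z)) \<noteq> 0" using a by (simp add: eq_fract Zero_fract_def)
    ultimately show ?thesis by blast
  qed
  then have "z \<in> fv ` (- {0})" for z by (metis ComplI image_eqI singletonD)
  then show "fv ` (- {0}) = UNIV" by blast
qed

sublocale dval fv by standard (rule dv_fv)

lemma nonneg_fv: "range to_fract \<subseteq> val_ring fv"
proof safe
  fix a show "to_fract a \<in> val_ring fv"
    by (cases "a = 0") (auto simp: val_ring_def fv_to_fract)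
qed

lemma to_fract_val_max: "to_fract a \<in> val_max fv \<longleftrightarrow> a = 0 \<or> 0 < w a"
  by (cases "a = 0") (auto simp: val_max_def fv_to_fract)

lemma val_ring_Fract: "a \<noteq> 0 \<Longrightarrow> b \<noteq> 0 \<Longrightarrow> Fract a b \<in> val_ring fv \<longleftrightarrow> w b \<le> w a"
  by (auto simp: val_ring_def fv_Fract eq_fract Zero_fract_def)

end

lemma Fract_eq_divide: "Fract a b = to_fract a / to_fract b"
  by (simp add: to_fract_def)

section \<open>Prime ideals and heights\<close>

definition prime_ideal :: "'a::comm_ring_1 set \<Rightarrow> bool" where
  "prime_ideal P \<longleftrightarrow> is_ideal P \<and> 1 \<notin> P \<and> (\<forall>a b. a * b \<in> P \<longrightarrow> a \<in> P \<or> b \<in> P)"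

lemma is_prime_in_iff:
  fixes C :: "'a::idom fract set"
  shows "is_prime_in (range to_fract) C \<longleftrightarrow> C \<subseteq> range to_fract \<and> prime_ideal {a. to_fract a \<in> C}"
proof
  assume C: "is_prime_in (range to_fract) C"
  have sub: "submodule_over (range to_fract) (*) C" and psub: "C \<subset> range to_fract"
    and pr: "\<And>a b. to_fract (a * b) \<in> C \<Longrightarrow> to_fract a \<in> C \<or> to_fract b \<in> C"
    using C by (auto simp: is_prime_in_def)
  have "is_ideal {a. to_fract a \<in> C}"
    unfolding ideal.subspace_def using sub by (auto simp: submodule_over_def)
  moreover have "1 \<notin> {a. to_fract a \<in> C}"
  proof
    assume "1 \<in> {a. to_fract a \<in> C}"
    then have "1 \<in> C" by simp
    have "r * 1 \<in> C" if "r \<in> range to_fract" for r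
      by (rule submodule_scale[OF sub that \<open>1 \<in> C\<close>])
    then have "range to_fract \<subseteq> C" by auto
    then show False using psub by blast
  qed
  ultimately show "C \<subseteq> range to_fract \<and> prime_ideal {a. to_fract a \<in> C}"
    unfolding prime_ideal_def using psub pr by auto
next
  assume C: "C \<subseteq> range to_fract \<and> prime_ideal {a. to_fract a \<in> C}"
  then have id: "is_ideal {a. to_fract a \<in> C}" and one: "to_fract 1 \<notin> C"
    and pr: "\<And>a b. to_fract (a * b) \<in> C \<Longrightarrow> to_fract a \<in> C \<or> to_fract b \<in> C"
    unfolding prime_ideal_def by auto
  have "submodule_over (range to_fract) (*) C"
    unfolding submodule_over_def
  proof (intro conjI ballI)
    show "0 \<in> C" using ideal.subspace_0[OF id] by simp
    show "x + y \<in> C" if xy: "x \<in> C" "y \<in> C" for x y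
    proof -
      obtain a b where "x = to_fract a" "y = to_fract b" using xy C by blast
      then show ?thesis using ideal.subspace_add[OF id, of a b] xy by simp
    qed
    show "c * x \<in> C" if cx: "c \<in> range to_fract" "x \<in> C" for c x
    proof -
      obtain a b where "c = to_fract a" "x = to_fract b" using cx C by blast
      then show ?thesis using ideal.subspace_scale[OF id, of b a] cx by simp
    qed
  qed
  then show "is_prime_in (range to_fract) C"
    unfolding is_prime_in_def
  proof (intro conjI ballI impI)
    have "to_fract (1 :: 'a) \<in> range to_fract" by (rule rangeI)
    then show "C \<subset> range to_fract" using C one by blast
    show "x \<in> C \<or> y \<in> C" if "x \<in> range to_fract" "y \<in> range to_fract" "x * y \<in> C" for x y
    proof -
      obtain a b where "x = to_fract a" "y = to_fract b" using \<open>x \<in> _\<close> \<open>y \<in> _\<close> by blast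
      then show ?thesis using pr[of a b] \<open>x * y \<in> C\<close> by simp
    qed
  qed
qed

text \<open>Divide by the lowest power of \<open>f 0\<close>, which is not in \<open>P 0\<close>,
  and reduce modulo the next prime: only terms with minimal first exponent survive, and induction
  treats the rest of the chain. With constant coefficients this says that the \<open>f i\<close> are
  algebraically independent, which bounds heights.\<close>

lemma chain_independent:
  fixes P :: "nat \<Rightarrow> 'a::comm_ring_1 set"
  assumes "\<And>i. i \<le> r \<Longrightarrow> prime_ideal (P i)" "\<And>i. i < r \<Longrightarrow> P i \<subseteq> P (Suc i) \<and> f i \<in> P (Suc i) \<and> f i \<notin> P i"
    and "finite A" "A \<noteq> {}" "\<And>a. a \<in> A \<Longrightarrow> length a = r"
    and "\<And>a i. a \<in> A \<Longrightarrow> i \<le> r \<Longrightarrow> c a \<notin> P i"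
  shows "(\<Sum>a\<in>A. c a * (\<Prod>i<r. f i ^ (a ! i))) \<notin> P 0"
  using assms
proof (induction r arbitrary: P f A c)
  case 0
  then have "A = {[]}" by auto
  then show ?case using 0 by simp
next
  case (Suc r)
  define m where "m = Min (hd ` A)"
  define g where "g a = (\<Prod>i<r. f (Suc i) ^ (a ! i))" for a
  have len: "a = hd a # tl a" "length (tl a) = r" if "a \<in> A" for a
    using Suc.prems(5)[OF that] by (cases a; simp)+
  have ge: "m \<le> hd a" if "a \<in> A" for a using Suc.prems(3) that by (auto simp: m_def)
  have "m \<in> hd ` A" unfolding m_def using Suc.prems(3,4) by (intro Min_in) auto
  have P0: "prime_ideal (P 0)" and P1: "prime_ideal (P (Suc 0))" using Suc.prems(1) by auto
  have f0: "f 0 \<in> P (Suc 0)" "f 0 \<notin> P 0" "P 0 \<subseteq> P (Suc 0)" using Suc.prems(2)[of 0] by auto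
  let ?A' = "{a \<in> A. hd a = m}" and ?A2 = "{a \<in> A. hd a \<noteq> m}"
  have prod_eq: "(\<Prod>i<Suc r. f i ^ (a ! i)) = f 0 ^ hd a * g (tl a)" if "a \<in> A" for a
    unfolding prod.lessThan_Suc_shift g_def by (subst (1 2) len(1)[OF that]) simp
  show ?case
  proof
    assume mem: "(\<Sum>a\<in>A. c a * (\<Prod>i<Suc r. f i ^ (a ! i))) \<in> P 0"
    have "(\<Sum>a\<in>A. c a * (\<Prod>i<Suc r. f i ^ (a ! i))) = f 0 ^ m * (\<Sum>a\<in>A. c a * f 0 ^ (hd a - m) * g (tl a))"
      unfolding sum_distrib_left
    proof (rule sum.cong)
      fix a assume a: "a \<in> A"
      have "f 0 ^ hd a = f 0 ^ m * f 0 ^ (hd a - m)" using ge[OF a] by (simp flip: power_add)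
      then show "c a * (\<Prod>i<Suc r. f i ^ (a ! i)) = f 0 ^ m * (c a * f 0 ^ (hd a - m) * g (tl a))"
        unfolding prod_eq[OF a] by (simp add: ac_simps)
    qed simp
    then have "f 0 ^ m * (\<Sum>a\<in>A. c a * f 0 ^ (hd a - m) * g (tl a)) \<in> P 0" using mem by simp
    moreover have "f 0 ^ m \<notin> P 0" for m
      by (induction m) (use P0 f0 in \<open>auto simp: prime_ideal_def\<close>)
    ultimately have "(\<Sum>a\<in>A. c a * f 0 ^ (hd a - m) * g (tl a)) \<in> P (Suc 0)"
      using P0 f0(3) unfolding prime_ideal_def by blast
    moreover have "(\<Sum>a\<in>A. c a * f 0 ^ (hd a - m) * g (tl a)) =
        (\<Sum>a\<in>?A'. c a * f 0 ^ (hd a - m) * g (tl a)) + (\<Sum>a\<in>?A2. c a * f 0 ^ (hd a - m) * g (tl a))"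
      using Suc.prems(3) by (subst sum.union_disjoint[symmetric]) (auto intro: sum.cong)
    moreover have "(\<Sum>a\<in>?A2. c a * f 0 ^ (hd a - m) * g (tl a)) \<in> P (Suc 0)"
    proof (rule ideal.subspace_sum)
      show id1: "is_ideal (P (Suc 0))" using P1 by (simp add: prime_ideal_def)
      fix a assume "a \<in> ?A2"
      then obtain k where "hd a - m = Suc k" using ge[of a] by (cases "hd a - m") auto
      then have "c a * f 0 ^ (hd a - m) * g (tl a) = (c a * f 0 ^ k * g (tl a)) * f 0" by (simp add: ac_simps)
      then show "c a * f 0 ^ (hd a - m) * g (tl a) \<in> P (Suc 0)"
        using ideal.subspace_scale[OF id1 f0(1)] by simp
    qed
    ultimately have "((\<Sum>a\<in>?A'. c a * f 0 ^ (hd a - m) * g (tl a)) + (\<Sum>a\<in>?A2. c a * f 0 ^ (hd a - m) * g (tl a)))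
        - (\<Sum>a\<in>?A2. c a * f 0 ^ (hd a - m) * g (tl a)) \<in> P (Suc 0)"
      using P1 unfolding prime_ideal_def by (intro ideal.subspace_diff) simp_all
    then have "(\<Sum>a\<in>?A'. c a * f 0 ^ (hd a - m) * g (tl a)) \<in> P (Suc 0)" by simp
    also have "(\<Sum>a\<in>?A'. c a * f 0 ^ (hd a - m) * g (tl a)) = (\<Sum>b\<in>tl ` ?A'. c (m # b) * (\<Prod>i<r. f (Suc i) ^ (b ! i)))"
    proof -
      have inj: "inj_on tl ?A'" by (rule inj_onI) (use len(1) in \<open>metis (mono_tags, lifting) mem_Collect_eq\<close>)
      have "c a * f 0 ^ (hd a - m) * g (tl a) = c (m # tl a) * g (tl a)" if "a \<in> ?A'" for a
        using that len(1)[of a] by auto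
      then show ?thesis unfolding sum.reindex[OF inj] by (intro sum.cong) (auto simp: g_def)
    qed
    finally have mem': "(\<Sum>b\<in>tl ` ?A'. c (m # b) * (\<Prod>i<r. f (Suc i) ^ (b ! i))) \<in> P (Suc 0)" .
    have "(\<Sum>b\<in>tl ` ?A'. c (m # b) * (\<Prod>i<r. f (Suc i) ^ (b ! i))) \<notin> P (Suc 0)"
    proof (rule Suc.IH[of "\<lambda>i. P (Suc i)" "\<lambda>i. f (Suc i)" "tl ` ?A'" "\<lambda>b. c (m # b)"])
      show "finite (tl ` ?A')" using Suc.prems(3) by simp
      show "tl ` ?A' \<noteq> {}" using \<open>m \<in> hd ` A\<close> by auto
      show "length b = r" if "b \<in> tl ` ?A'" for b using that len by auto
      show "c (m # b) \<notin> P (Suc i)" if b: "b \<in> tl ` ?A'" and i: "i \<le> r" for b i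
      proof -
        obtain a where a: "a \<in> A" "hd a = m" "b = tl a" using b by auto
        then have "m # b = a" using len(1)[OF a(1)] by simp
        then show ?thesis using Suc.prems(6)[OF a(1), of "Suc i"] i by simp
      qed
    qed (use Suc.prems(1,2) in auto)
    then show False using mem' by simp
  qed
qed

lemma underdetermined:
  fixes M :: "'b \<Rightarrow> 'a \<Rightarrow> 'k::field"
  assumes "finite B" "finite A" "card B < card A"
  shows "\<exists>x. (\<exists>a\<in>A. x a \<noteq> 0) \<and> (\<forall>b\<in>B. (\<Sum>a\<in>A. M b a * x a) = 0)"
  using assms
proof (induction B arbitrary: A M rule: finite_induct)
  case empty
  then have "A \<noteq> {}" by auto
  then show ?case by (intro exI[of _ "\<lambda>_. 1"]) auto
next
  case (insert b B)
  show ?case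
  proof (cases "\<forall>a\<in>A. M b a = 0")
    case True
    have "card B < card A" using insert by simp
    then obtain x where "\<exists>a\<in>A. x a \<noteq> 0" "\<forall>b\<in>B. (\<Sum>a\<in>A. M b a * x a) = 0"
      using insert.IH[OF insert.prems(1)] by blast
    then show ?thesis using True by (intro exI[of _ x]) auto
  next
    case False
    then obtain a0 where a0: "a0 \<in> A" "M b a0 \<noteq> 0" by blast
    let ?A = "A - {a0}" and ?M = "\<lambda>b' a. M b' a - M b' a0 * M b a / M b a0"
    have "card B < card ?A" using insert a0 by simp
    then obtain x where x: "\<exists>a\<in>?A. x a \<noteq> 0" "\<forall>b'\<in>B. (\<Sum>a\<in>?A. ?M b' a * x a) = 0"
      using insert.IH[of ?A ?M] insert.prems(1) by auto
    define s where "s = (\<Sum>a\<in>?A. M b a * x a)"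
    define y where "y = x(a0 := - s / M b a0)"
    have split: "(\<Sum>a\<in>A. M b' a * y a) = M b' a0 * (- s / M b a0) + (\<Sum>a\<in>?A. M b' a * x a)" for b'
      using insert.prems(1) a0(1) by (subst sum.remove[of A a0]) (auto simp: y_def intro!: sum.cong)
    have "(\<Sum>a\<in>A. M b a * y a) = 0" unfolding split using a0(2) by (simp add: s_def)
    moreover have "(\<Sum>a\<in>A. M b' a * y a) = 0" if b': "b' \<in> B" for b'
    proof -
      have "(\<Sum>a\<in>?A. ?M b' a * x a) = (\<Sum>a\<in>?A. M b' a * x a) - (\<Sum>a\<in>?A. M b' a0 / M b a0 * (M b a * x a))"
        unfolding sum_subtractf[symmetric] by (rule sum.cong) (auto simp: algebra_simps)
      also have "(\<Sum>a\<in>?A. M b' a0 / M b a0 * (M b a * x a)) = M b' a0 / M b a0 * s"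
        by (simp add: s_def sum_distrib_left)
      finally show ?thesis unfolding split using x(2) b' by simp
    qed
    moreover have "\<exists>a\<in>A. y a \<noteq> 0" using x(1) by (auto simp: y_def)
    ultimately show ?thesis by blast
  qed
qed

definition bd :: "nat \<Rightarrow> 'k::field poly3 \<Rightarrow> bool" where
  "bd m f \<longleftrightarrow> (\<forall>e\<in>keys f. \<forall>j. lookup e j \<le> m)"

lemma bd_mult: "bd m f \<Longrightarrow> bd l g \<Longrightarrow> bd (m + l) (f * g)"
  using keys_mult[of f g] unfolding bd_def by (fastforce simp: lookup_add intro: add_mono)

lemma bd_1: "bd 0 1" by (auto simp: bd_def)

lemma bd_power: "bd m f \<Longrightarrow> bd (k * m) (f ^ k)"
  by (induction k) (auto simp: bd_1 bd_mult)

lemma bd_prod: "(\<And>i. i \<in> I \<Longrightarrow> bd (m i) (f i)) \<Longrightarrow> bd (sum m I) (prod f I)"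
  by (induction I rule: infinite_finite_induct) (auto simp: bd_1 bd_mult)

lemma bd_mono: "bd m f \<Longrightarrow> m \<le> l \<Longrightarrow> bd l f"
  unfolding bd_def by (meson order_trans)

lemma bd_ex: "\<exists>m. bd m f"
proof -
  have "lookup e j \<le> (\<Sum>e\<in>keys f. tdeg e)" if "e \<in> keys f" for e j
  proof -
    have "lookup e j \<le> tdeg e" unfolding tdeg_def by (rule member_le_sum) auto
    also have "\<dots> \<le> (\<Sum>e\<in>keys f. tdeg e)" using that by (rule member_le_sum) auto
    finally show ?thesis .
  qed
  then show ?thesis by (auto simp: bd_def)
qed

text \<open>Counting: the \<open>L^4\<close> products with exponents below \<open>L\<close> have
  degree at most \<open>4 L D\<close> in each variable, so at most \<open>((4 D + 1) L)^3\<close>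
  coefficients must be cancelled; \<open>L > (4 D + 1)^3\<close> leaves a nontrivial
  solution.\<close>

lemma algebraically_dependent:
  fixes f :: "nat \<Rightarrow> 'k::field poly3"
  shows "\<exists>A c. finite A \<and> A \<noteq> {} \<and> (\<forall>a\<in>A. length a = 4 \<and> c a \<noteq> 0) \<and>
    (\<Sum>a\<in>A. cst (c a) * (\<Prod>i<4. f i ^ (a ! i))) = 0"
proof -
  have "\<forall>i. \<exists>m. bd m (f i)" using bd_ex by blast
  from choice[OF this] obtain m where m: "\<And>i. bd (m i) (f i)" by blast
  define D where "D = (\<Sum>i<4. m i)"
  have D: "bd D (f i)" if "i < 4" for i
    by (rule bd_mono[OF m]) (use that in \<open>auto simp: D_def intro: member_le_sum\<close>)
  define L where "L = (4 * D + 1) ^ 3 + 1"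
  let ?U = "{a. set a \<subseteq> {..<L} \<and> length a = 4}"
  let ?B = "{e::ex3. \<forall>j. lookup e j < 4 * (L * D) + 1}"
  have finU: "finite ?U" by (rule finite_lists_length_eq) simp
  have "card ?B \<le> (4 * (L * D) + 1) ^ 3" by (rule card_box)
  also have "\<dots> \<le> ((4 * D + 1) * L) ^ 3"
    by (rule power_mono) (auto simp: L_def algebra_simps)
  also have "\<dots> = (4 * D + 1) ^ 3 * L ^ 3" by (rule power_mult_distrib)
  also have "\<dots> < L * L ^ 3" by (intro mult_strict_right_mono) (auto simp: L_def)
  also have "\<dots> = card ?U" using card_lists_length_eq[of "{..<L}" 4] by (simp add: power_numeral_reduce)
  finally obtain x where x: "\<exists>a\<in>?U. x a \<noteq> 0"
    "\<forall>e\<in>?B. (\<Sum>a\<in>?U. lookup (\<Prod>i<4. f i ^ (a ! i)) e * x a) = 0"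
    using underdetermined[OF finite_box finU, of "4 * (L * D) + 1" "\<lambda>e a. lookup (\<Prod>i<4. f i ^ (a ! i)) e"] by blast
  have "(\<Sum>a\<in>?U. cst (x a) * (\<Prod>i<4. f i ^ (a ! i))) = 0"
  proof (rule poly_mapping_eqI)
    fix e
    have eq: "lookup (\<Sum>a\<in>?U. cst (x a) * (\<Prod>i<4. f i ^ (a ! i))) e
        = (\<Sum>a\<in>?U. lookup (\<Prod>i<4. f i ^ (a ! i)) e * x a)"
      unfolding lookup_sum by (rule sum.cong) (simp_all add: mult.commute)
    show "lookup (\<Sum>a\<in>?U. cst (x a) * (\<Prod>i<4. f i ^ (a ! i))) e = lookup 0 e"
    proof (cases "e \<in> ?B")
      case True
      then show ?thesis using x(2) eq by simp
    next
      case False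
      have "lookup (\<Prod>i<4. f i ^ (a ! i)) e = 0" if a: "a \<in> ?U" for a
      proof -
        have "bd (\<Sum>i<4. (a ! i) * D) (\<Prod>i<4. f i ^ (a ! i))"
          by (rule bd_prod, rule bd_power, rule D) simp
        moreover have "(\<Sum>i<4. (a ! i) * D) \<le> (\<Sum>i<(4::nat). L * D)"
        proof (rule sum_mono)
          fix i assume "i \<in> {..<4::nat}"
          then have "a ! i \<in> set a" using a by simp
          then have "a ! i < L" using a by blast
          then show "(a ! i) * D \<le> L * D" by simp
        qed
        ultimately have "bd (\<Sum>i<(4::nat). L * D) (\<Prod>i<4. f i ^ (a ! i))" by (rule bd_mono)
        then have "bd (4 * (L * D)) (\<Prod>i<4. f i ^ (a ! i))" by simp
        then have "e \<in> ?B" if "e \<in> keys (\<Prod>i<4. f i ^ (a ! i))"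
          using that unfolding bd_def by (intro CollectI allI) (simp only: Suc_eq_plus1[symmetric] less_Suc_eq_le)
        then have "e \<notin> keys (\<Prod>i<4. f i ^ (a ! i))" using False by blast
        then show ?thesis by (simp add: in_keys_iff)
      qed
      then show ?thesis unfolding eq by simp
    qed
  qed
  also have "(\<Sum>a\<in>?U. cst (x a) * (\<Prod>i<4. f i ^ (a ! i))) = (\<Sum>a\<in>{a \<in> ?U. x a \<noteq> 0}. cst (x a) * (\<Prod>i<4. f i ^ (a ! i)))"
    using finU by (intro sum.mono_neutral_right) auto
  finally have eq0: "(\<Sum>a\<in>{a \<in> ?U. x a \<noteq> 0}. cst (x a) * (\<Prod>i<4. f i ^ (a ! i))) = 0" .
  have "finite {a \<in> ?U. x a \<noteq> 0}" by (rule finite_subset[OF _ finU]) blast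
  then show ?thesis using eq0 x(1) by (intro exI[of _ "{a \<in> ?U. x a \<noteq> 0}"] exI[of _ x]) auto
qed

lemma cst_notin_prime:
  fixes c :: "'k::field"
  assumes "prime_ideal P" "c \<noteq> 0" shows "cst c \<notin> P"
proof
  assume "cst c \<in> P"
  then have "cst (inverse c) * cst c \<in> P" using assms(1) ideal.subspace_scale unfolding prime_ideal_def by blast
  then show False using assms by (simp add: mult_single prime_ideal_def single_one)
qed

lemma height_le_3: "height (range to_fract) (C :: 'k::field poly3 fract set) \<le> 3"
  unfolding height_def
proof (rule Sup_least, safe)
  fix r and c :: "nat \<Rightarrow> 'k poly3 fract set"
  assume pr: "\<forall>i\<le>r. is_prime_in (range to_fract) (c i)" and str: "\<forall>i<r. c i \<subset> c (Suc i)"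
  have "r \<le> 3"
  proof (rule ccontr)
    assume "\<not> r \<le> 3"
    then have r: "4 \<le> r" by simp
    define P where "P i = {a. to_fract a \<in> c i}" for i
    have P: "prime_ideal (P i)" if "i \<le> 4" for i using pr r that by (auto simp: is_prime_in_iff P_def)
    have "\<exists>f. P i \<subseteq> P (Suc i) \<and> f \<in> P (Suc i) \<and> f \<notin> P i" if i: "i < 4" for i
    proof -
      have "c i \<subset> c (Suc i)" "c (Suc i) \<subseteq> range to_fract" using str pr r i by (auto simp: is_prime_in_iff)
      then obtain f where "to_fract f \<in> c (Suc i)" "to_fract f \<notin> c i" by blast
      then show ?thesis using \<open>c i \<subset> c (Suc i)\<close> by (auto simp: P_def)
    qed
    then obtain f where f: "\<And>i. i < 4 \<Longrightarrow> P i \<subseteq> P (Suc i) \<and> f i \<in> P (Suc i) \<and> f i \<notin> P i" by metis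
    obtain A x where A: "finite A" "A \<noteq> {}" "\<forall>a\<in>A. length a = 4 \<and> x a \<noteq> (0 :: 'k)"
      "(\<Sum>a\<in>A. cst (x a) * (\<Prod>i<4. f i ^ (a ! i))) = 0"
      using algebraically_dependent[of f] by blast
    have "(\<Sum>a\<in>A. cst (x a) * (\<Prod>i<4. f i ^ (a ! i))) \<notin> P 0"
    proof (rule chain_independent)
      show "cst (x a) \<notin> P i" if "a \<in> A" "i \<le> 4" for a i
        using cst_notin_prime[OF P[OF that(2)]] A(3) that(1) by blast
    qed (use P f A in auto)
    moreover have "0 \<in> P 0" using P[of 0] ideal.subspace_0 by (auto simp: prime_ideal_def)
    ultimately show False using A(4) by simp
  qed
  then show "enat r \<le> 3" by (simp add: numeral_eq_enat)
qed

section \<open>The order valuation\<close>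

lemma mpoly_eval_add: "mpoly_eval us (f + g) = mpoly_eval us f + mpoly_eval us g"
proof -
  have eq: "mpoly_eval us f = lin (\<lambda>e c. c * (\<Prod>i<length us. us ! i ^ lookup e i)) f" for f
    by (simp add: mpoly_eval_def lin_def)
  show ?thesis unfolding eq by (rule lin_add) (auto simp: distrib_right)
qed

lemma mpoly_eval_single:
  "mpoly_eval us (single e c) = c * (\<Prod>i<length us. us ! i ^ lookup e i)"
  by (simp add: mpoly_eval_def)

lemma mpoly_eval_sum: "mpoly_eval us (sum f A) = (\<Sum>x\<in>A. mpoly_eval us (f x))"
  by (induction A rule: infinite_finite_induct) (auto simp: mpoly_eval_add, simp_all add: mpoly_eval_def)

interpretation ordm: order_fun "ordm :: 'k::field poly3 \<Rightarrow> nat"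
proof
  fix a b :: "'k poly3"
  show "a \<noteq> 0 \<Longrightarrow> b \<noteq> 0 \<Longrightarrow> ordm (a * b) = ordm a + ordm b" by (rule ordm_mult)
  assume nz: "a \<noteq> 0" "b \<noteq> 0" "a + b \<noteq> 0"
  let ?m = "min (ordm a) (ordm b)"
  have "a \<in> Mge ?m" "b \<in> Mge ?m" using nz by (simp_all add: Mge_iff_ordm)
  then have "a + b \<in> Mge ?m" using ideal_Mge by (rule_tac ideal.subspace_add)
  then show "?m \<le> ordm (a + b)" using nz by (simp add: Mge_iff_ordm)
next
  have "ordm (mo (eps 0) :: 'k poly3) = 1"
    by (rule ordm_unique) (auto simp: hc_eq hom_single Mge_def)
  then show "\<exists>a :: 'k poly3. a \<noteq> 0 \<and> ordm a = 1" by (intro exI[of _ "mo (eps 0)"]) simp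
qed

abbreviation ordv :: "'k::field poly3 fract \<Rightarrow> int" where "ordv \<equiv> ordm.fv"

interpretation ordv: poly_val "ordv :: 'k::field poly3 fract \<Rightarrow> int"
  by standard (rule ordm.nonneg_fv)

lemma ordm_mo: "ordm (mo e) = tdeg e"
  by (rule ordm_unique) (auto simp: hc_eq hom_single Mge_def)

lemma divide_in_val_max:
  assumes "g \<in> Mge (ordm s + 1)" "s \<noteq> 0" shows "to_fract g / to_fract s \<in> val_max ordv"
  using assms Mge_iff_ordm[of g "ordm s + 1"]
  by (cases "g = 0") (auto simp: val_max_def ordm.v_divide ordm.fv_to_fract)

lemma val_max_divide:
  assumes "to_fract g / to_fract s \<in> val_max ordv" "s \<noteq> 0" shows "g \<in> Mge (ordm s + 1)"
  using assms Mge_iff_ordm[of g "ordm s + 1"]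
  by (cases "g = 0") (auto simp: val_max_def ordm.v_divide ordm.fv_to_fract Mge_def)

definition lexp :: "nat \<Rightarrow> nat list \<Rightarrow> nat \<Rightarrow>\<^sub>0 nat" where
  "lexp r a = (\<Sum>i<r. single i (a ! i))"

lemma lookup_lexp: "lookup (lexp r a) i = (if i < r then a ! i else 0)"
proof -
  have "lookup (lexp r a) i = (\<Sum>j<r. if j = i then a ! j else 0)"
    unfolding lexp_def lookup_sum by (rule sum.cong) (auto simp: lookup_single when_def)
  then show ?thesis by simp
qed

lemma common_denominator:
  fixes us :: "'a::idom fract list"
  shows "\<exists>s a. s \<noteq> 0 \<and> (\<forall>i<length us. us ! i = to_fract (a i) / to_fract s)"
proof (induction us)
  case Nil
  show ?case by (intro exI[of _ 1]) simp
next
  case (Cons u us)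
  then obtain s a where s: "s \<noteq> 0" "\<forall>i<length us. us ! i = to_fract (a i) / to_fract s" by blast
  obtain x y where xy: "u = Fract x y" "y \<noteq> 0" by (cases u rule: Fract_cases)
  have "(u # us) ! i = to_fract (case i of 0 \<Rightarrow> x * s | Suc j \<Rightarrow> a j * y) / to_fract (s * y)"
    if "i < length (u # us)" for i
    using that s xy by (cases i) (auto simp: Fract_eq_divide)
  then show ?case using s xy by (intro exI[of _ "s * y"] exI[of _ "\<lambda>i. case i of 0 \<Rightarrow> x * s | Suc j \<Rightarrow> a j * y"]) simp
qed

text \<open>Three elements with a common denominator \<open>s\<close> of order \<open>D\<close> give
  \<open>L^3\<close> products, brought to order at least \<open>3 L D\<close> by powers of
  \<open>s\<close>. Their components in that degree involve at most \<open>((3 D + 1) L)^2\<close>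
  monomials, so some constant combination loses its lowest form and is a relation between the
  residues.\<close>

lemma ord_residue_trdeg_le:
  fixes us :: "'k::field poly3 fract list"
  assumes us: "set us \<subseteq> val_ring ordv" and indep: "residues_alg_indep (range to_fract) ordv us"
  shows "length us \<le> 2"
proof (rule ccontr)
  assume "\<not> ?thesis"
  then have len: "3 \<le> length us" by simp
  obtain s a where s: "s \<noteq> 0" "\<And>i. i < length us \<Longrightarrow> us ! i = to_fract (a i) / to_fract s"
    using common_denominator[of us] by blast
  define D where "D = ordm s"
  have aD: "a i \<in> Mge D" if i: "i < 3" for i
  proof (cases "a i = 0")
    case False
    have "us ! i \<in> val_ring ordv" using us len i by (simp add: subset_iff)
    then show ?thesis using s i len False
      by (auto simp: val_ring_def ordm.v_divide ordm.fv_to_fract Mge_iff_ordm D_def)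
  qed (simp add: Mge_def)
  have sD: "s \<in> Mge D" using s(1) by (simp add: Mge_iff_ordm D_def)
  define L where "L = (3 * D + 1) ^ 2 + 1"
  let ?U = "{b. set b \<subseteq> {..<L} \<and> length b = 3}"
  define tot where "tot b = (\<Sum>i<3. b ! i)" for b :: "nat list"
  define g where "g b = (\<Prod>i<3. a i ^ (b ! i)) * s ^ (3 * L - tot b)" for b
  have finU: "finite ?U" by (rule finite_lists_length_eq) simp
  have tot: "tot b \<le> 3 * L" if b: "b \<in> ?U" for b
  proof -
    have "tot b \<le> (\<Sum>i<(3::nat). L)"
      unfolding tot_def
    proof (rule sum_mono)
      fix i assume "i \<in> {..<3::nat}"
      then have "b ! i \<in> set b" using b by simp
      then show "b ! i \<le> L" using b by fastforce
    qed
    then show ?thesis by simp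
  qed
  have g_mem: "g b \<in> Mge (3 * L * D)" if b: "b \<in> ?U" for b
  proof -
    have "(\<Prod>i<3. a i ^ (b ! i)) \<in> Mge (\<Sum>i<3. (b ! i) * D)"
      by (rule Mge_prod) (auto intro: Mge_power aD)
    then have "g b \<in> Mge ((\<Sum>i<3. (b ! i) * D) + (3 * L - tot b) * D)"
      unfolding g_def by (rule Mge_mult[OF _ Mge_power[OF sD]])
    moreover have "(\<Sum>i<3. (b ! i) * D) + (3 * L - tot b) * D = (tot b + (3 * L - tot b)) * D"
      by (simp add: tot_def sum_distrib_right distrib_right)
    ultimately show ?thesis using tot[OF b] by simp
  qed
  let ?B = "{e. tdeg e = 3 * L * D}"
  have "card ?B \<le> (3 * L * D + 1) ^ 2" by (rule card_tdeg)
  also have "\<dots> \<le> ((3 * D + 1) * L) ^ 2" by (rule power_mono) (auto simp: L_def algebra_simps)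
  also have "\<dots> = (3 * D + 1) ^ 2 * L ^ 2" by (rule power_mult_distrib)
  also have "\<dots> < L * L ^ 2" by (intro mult_strict_right_mono) (auto simp: L_def)
  also have "\<dots> = card ?U" using card_lists_length_eq[of "{..<L}" 3] by (simp add: power_numeral_reduce)
  finally obtain x where x: "\<exists>b\<in>?U. x b \<noteq> 0" "\<forall>e\<in>?B. (\<Sum>b\<in>?U. lookup (g b) e * x b) = 0"
    using underdetermined[OF finite_tdeg finU, of "3 * L * D" "\<lambda>e b. lookup (g b) e"] by blast
  define G where "G = (\<Sum>b\<in>?U. cst (x b) * g b)"
  have "G \<in> Mge (3 * L * D)"
    unfolding G_def using g_mem ideal_Mge by (intro ideal.subspace_sum ideal.subspace_scale) auto
  moreover have "hc (3 * L * D) G = 0"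
  proof (rule poly_mapping_eqI)
    fix e
    have "lookup G e = (\<Sum>b\<in>?U. lookup (g b) e * x b)"
      unfolding G_def lookup_sum lookup_cst_mult by (simp only: mult.commute)
    then show "lookup (hc (3 * L * D) G) e = lookup 0 e"
      using x(2) by (simp add: lookup_hc)
  qed
  ultimately have "G \<in> Mge (3 * L * D + 1)" unfolding Suc_eq_plus1[symmetric] Mge_Suc_iff by blast
  moreover have "ordm (s ^ (3 * L)) = 3 * L * D" using s(1) by (simp add: ordm.w_power D_def)
  ultimately have G: "to_fract G / to_fract (s ^ (3 * L)) \<in> val_max ordv"
    using s(1) by (intro divide_in_val_max) simp_all
  define f where "f = (\<Sum>b\<in>?U. single (lexp 3 b) (to_fract (cst (x b))))"
  have lookup_f: "lookup f e = (\<Sum>b\<in>?U. if lexp 3 b = e then to_fract (cst (x b)) else 0)" for e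
    unfolding f_def lookup_sum by (rule sum.cong) (auto simp: lookup_single when_def)
  have inj: "inj_on (lexp 3) ?U"
  proof (rule inj_onI)
    fix b b' assume b: "b \<in> ?U" "b' \<in> ?U" "lexp 3 b = lexp 3 b'"
    show "b = b'"
    proof (rule nth_equalityI)
      show "length b = length b'" using b by simp
      fix i assume "i < length b"
      then have "i < 3" using b(1) by simp
      then show "b ! i = b' ! i" using arg_cong[OF b(3), of "\<lambda>e. lookup e i"] by (simp add: lookup_lexp)
    qed
  qed
  have "mpoly_eval us f \<in> val_max ordv"
  proof -
    have "mpoly_eval us (single (lexp 3 b) (to_fract (cst (x b)))) = to_fract (cst (x b) * g b) / to_fract (s ^ (3 * L))"
      if b: "b \<in> ?U" for b
    proof -
      have "(\<Prod>i<length us. us ! i ^ lookup (lexp 3 b) i) = (\<Prod>i<3. us ! i ^ (b ! i))"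
        by (rule prod.mono_neutral_cong_right) (use len in \<open>auto simp: lookup_lexp\<close>)
      also have "\<dots> = (\<Prod>i<3. to_fract (a i ^ (b ! i)) / to_fract s ^ (b ! i))"
        by (rule prod.cong) (use s(2) len in \<open>auto simp: power_divide to_fract_power\<close>)
      also have "\<dots> = to_fract (\<Prod>i<3. a i ^ (b ! i)) / to_fract s ^ tot b"
        by (simp add: prod_dividef to_fract_prod power_sum tot_def)
      also have "\<dots> = to_fract (g b) / to_fract (s ^ (3 * L))"
      proof -
        have "s ^ (3 * L) = s ^ tot b * s ^ (3 * L - tot b)" using tot[OF b] by (simp flip: power_add)
        then show ?thesis using s(1) by (simp add: g_def to_fract_power field_simps)
      qed
      finally show ?thesis by (simp add: mpoly_eval_single)
    qed
    then have "mpoly_eval us f = to_fract G / to_fract (s ^ (3 * L))"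
      unfolding f_def G_def mpoly_eval_sum by (simp only: to_fract_sum sum_divide_distrib cong: sum.cong)
    then show ?thesis using G by simp
  qed
  moreover have "lookup f e \<in> range to_fract" for e
    unfolding lookup_f by (intro subring_sum[OF subring_range_to_fract]) (auto intro: rangeI[of to_fract 0, simplified])
  moreover have "keys e \<subseteq> {..<length us}" if e: "e \<in> keys f" for e
  proof -
    have "\<exists>b\<in>?U. lexp 3 b = e"
    proof (rule ccontr)
      assume "\<not> ?thesis"
      then have "lookup f e = 0" unfolding lookup_f by (intro sum.neutral) auto
      then show False using e by (simp add: in_keys_iff)
    qed
    then show ?thesis using len by (auto simp: in_keys_iff lookup_lexp split: if_splits)
  qed
  ultimately have max: "lookup f e \<in> val_max ordv" for e
    using indep unfolding residues_alg_indep_def by blast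
  obtain b where b: "b \<in> ?U" "x b \<noteq> 0" using x(1) by blast
  have "lookup f (lexp 3 b) = (\<Sum>b'\<in>?U. if b' = b then to_fract (cst (x b)) else 0)"
    unfolding lookup_f by (rule sum.cong) (use inj b in \<open>auto simp: inj_on_def\<close>)
  also have "\<dots> = to_fract (cst (x b))" using b finU by simp
  finally have "to_fract (cst (x b)) \<in> val_max ordv" using max by metis
  moreover have "ordm (cst (x b)) = 0"
    by (rule ordm_unique) (use b in \<open>auto simp: hc_eq hom_single\<close>)
  ultimately show False using b(2) by (simp add: ordm.to_fract_val_max)
qed

lemma lookup_mo_mult_eq_deg:
  assumes "tdeg e = tdeg m" shows "lookup (mo e * f) m = (if e = m then lookup f 0 else 0)"
proof (cases "lookup (mo e * f) m = 0")
  case True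
  then show ?thesis using lookup_mo_mult[of e f 0] by auto
next
  case False
  then have "m \<in> (+) e ` keys f" by (simp add: in_keys_iff flip: keys_mo_mult)
  then obtain d where d: "m = e + d" by auto
  then have "d = 0" using assms by (simp add: tdeg_eq_0_iff)
  then show ?thesis using lookup_mo_mult[of e f 0] d by auto
qed

text \<open>Multiplication by \<open>x^N\<close> turns a relation into a sum of
  \<open>mo (mu e) * r e\<close> with distinct monomials of degree \<open>N\<close>. Order above
  \<open>N\<close> forces the constant terms of all \<open>r e\<close> to vanish.\<close>

lemma ord_residues_indep:
  "residues_alg_indep (range to_fract) ordv [ordv.X 1 / ordv.X 0, ordv.X 2 / ordv.X 0 :: 'k::field poly3 fract]"
  (is "residues_alg_indep _ _ ?us")
  unfolding residues_alg_indep_def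
proof (intro allI impI, elim conjE)
  fix f :: "(nat \<Rightarrow>\<^sub>0 nat) \<Rightarrow>\<^sub>0 'k poly3 fract" and e0
  assume R: "\<forall>e. lookup f e \<in> range to_fract" and keys: "\<forall>e\<in>keys f. keys e \<subseteq> {..<length ?us}"
    and max: "mpoly_eval ?us f \<in> val_max ordv"
  have "\<forall>e. \<exists>r. lookup f e = to_fract r" using R by blast
  from choice[OF this] obtain r where r: "\<And>e. lookup f e = to_fract (r e)" by blast
  define dg where "dg e = lookup e 0 + lookup e 1" for e :: "nat \<Rightarrow>\<^sub>0 nat"
  define N where "N = (\<Sum>e\<in>keys f. dg e)"
  have dgN: "dg e \<le> N" if "e \<in> keys f" for e unfolding N_def using that by (intro member_le_sum) auto
  define mu where "mu e = ex (N - dg e) (lookup e 0) (lookup e 1)" for e :: "nat \<Rightarrow>\<^sub>0 nat"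
  have tmu: "tdeg (mu e) = N" if "e \<in> keys f" for e using dgN[OF that] by (simp add: mu_def dg_def)
  define H where "H = (\<Sum>e\<in>keys f. mo (mu e) * r e)"
  let ?s = "mo (single 0 N) :: 'k poly3"
  have "lookup f e * (\<Prod>i<length ?us. ?us ! i ^ lookup e i) = to_fract (mo (mu e) * r e) / to_fract ?s"
    if e: "e \<in> keys f" for e
  proof -
    have "ordv.X 0 ^ N = ordv.X 0 ^ (N - dg e) * (ordv.X 0 ^ lookup e 0 * ordv.X 0 ^ lookup e 1 :: 'k poly3 fract)"
      using dgN[OF e] by (simp add: dg_def flip: power_add)
    moreover have "to_fract ?s = (ordv.X 0 ^ N :: 'k poly3 fract)"
      by (subst ordv.mo_X) (simp add: prod_3 lookup_single when_def)
    moreover have "to_fract (mo (mu e)) = (ordv.X 0 ^ (N - dg e) * ordv.X 1 ^ lookup e 0 * ordv.X 2 ^ lookup e 1 :: 'k poly3 fract)"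
      by (subst ordv.mo_X) (simp add: prod_3 mu_def)
    moreover have "(\<Prod>i<length ?us. ?us ! i ^ lookup e i)
        = (ordv.X 1 / ordv.X 0) ^ lookup e 0 * (ordv.X 2 / ordv.X 0 :: 'k poly3 fract) ^ lookup e 1"
      by (simp add: numeral_2_eq_2 prod.lessThan_Suc One_nat_def)
    ultimately show ?thesis using r[of e] by (simp add: power_divide field_simps)
  qed
  then have "mpoly_eval ?us f = to_fract H / to_fract ?s"
    unfolding mpoly_eval_def H_def to_fract_sum sum_divide_distrib by (intro sum.cong) auto
  then have "H \<in> Mge (ordm ?s + 1)" using max by (intro val_max_divide) auto
  then have H: "H \<in> Mge (N + 1)" by (simp add: ordm_mo)
  show "lookup f e0 \<in> val_max ordv"
  proof (cases "e0 \<in> keys f")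
    case False
    then show ?thesis by (simp add: in_keys_iff val_max_def)
  next
    case True
    have "lookup H (mu e0) = (\<Sum>e\<in>keys f. if e = e0 then lookup (r e0) 0 else 0)"
      unfolding H_def lookup_sum
    proof (rule sum.cong)
      fix e assume e: "e \<in> keys f"
      have "mu e = mu e0 \<longleftrightarrow> e = e0"
      proof
        assume "mu e = mu e0"
        then have l: "lookup e 0 = lookup e0 0" "lookup e 1 = lookup e0 1"
          unfolding mu_def by (metis lookup_ex)+
        show "e = e0"
        proof (rule poly_mapping_eqI)
          fix i :: nat
          show "lookup e i = lookup e0 i"
          proof (cases "i < 2")
            case True
            then show ?thesis using l by (auto simp: less_2_cases_iff One_nat_def)
          next
            case False
            have "keys e \<subseteq> {..<2}" "keys e0 \<subseteq> {..<2}" using keys e True by (auto simp: numeral_2_eq_2)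
            then have "i \<notin> keys e" "i \<notin> keys e0" using False by auto
            then show ?thesis by (simp add: in_keys_iff)
          qed
        qed
      qed simp
      then show "lookup (mo (mu e) * r e) (mu e0) = (if e = e0 then lookup (r e0) 0 else 0)"
        using lookup_mo_mult_eq_deg[of "mu e" "mu e0" "r e"] tmu[OF e] tmu[OF True] by auto
    qed simp
    also have "\<dots> = lookup (r e0) 0" using True by simp
    finally have "lookup (r e0) 0 = lookup H (mu e0)" by simp
    also have "\<dots> = 0"
    proof (rule ccontr)
      assume "lookup H (mu e0) \<noteq> 0"
      then have "N + 1 \<le> tdeg (mu e0)" using H by (auto simp: Mge_def in_keys_iff)
      then show False using tmu[OF True] by simp
    qed
    finally have z: "lookup (r e0) 0 = 0" .
    have "r e0 \<in> Mge 1"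
      unfolding Mge_def
    proof (intro CollectI ballI)
      fix e assume "e \<in> keys (r e0)"
      then have "e \<noteq> 0" using z by (auto simp: in_keys_iff)
      then show "1 \<le> tdeg e" using tdeg_eq_0_iff[of e] by (simp add: One_nat_def Suc_le_eq)
    qed
    then show ?thesis unfolding r ordm.to_fract_val_max using Mge_iff_ordm[of "r e0" 1] by (cases "r e0 = 0") (auto simp: One_nat_def)
  qed
qed

lemma ord_residue_trdeg: "residue_trdeg (range to_fract) (ordv :: 'k::field poly3 fract \<Rightarrow> int) = 2"
  unfolding residue_trdeg_def
proof (rule antisym)
  show "Sup {enat (length us) |us. set us \<subseteq> val_ring (ordv :: 'k poly3 fract \<Rightarrow> int) \<and> residues_alg_indep (range to_fract) ordv us} \<le> 2"
    by (rule Sup_least) (auto dest!: ord_residue_trdeg_le simp: numeral_eq_enat)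
  let ?us = "[ordv.X 1 / ordv.X 0, ordv.X 2 / ordv.X 0 :: 'k poly3 fract]"
  have "ordm.fv (ordv.X i / ordv.X 0 :: 'k poly3 fract) = 0" for i
    by (simp add: ordm.v_divide ordm.fv_to_fract ordm_mo)
  then have "set ?us \<subseteq> val_ring (ordv :: 'k poly3 fract \<Rightarrow> int)" by (auto simp: val_ring_def)
  then have "enat (length ?us) \<in> {enat (length us) |us. set us \<subseteq> val_ring (ordv :: 'k poly3 fract \<Rightarrow> int) \<and> residues_alg_indep (range to_fract) ordv us}"
    using ord_residues_indep by blast
  then have "enat (length ?us) \<le> Sup {enat (length us) |us. set us \<subseteq> val_ring (ordv :: 'k poly3 fract \<Rightarrow> int) \<and> residues_alg_indep (range to_fract) ordv us}"
    by (rule Sup_upper)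
  then show "2 \<le> Sup {enat (length us) |us. set us \<subseteq> val_ring (ordv :: 'k poly3 fract \<Rightarrow> int) \<and> residues_alg_indep (range to_fract) ordv us}"
    by (simp add: numeral_eq_enat numeral_2_eq_2)
qed

text \<open>Substitutes 0 for the first \<open>m\<close> variables. The kernels are the primes 0,
  \<open>(x)\<close>, \<open>(x, y)\<close>, \<open>(x, y, z)\<close>, the chain that witnesses
  height 3.\<close>

definition kill :: "nat \<Rightarrow> 'k::field poly3 \<Rightarrow> 'k poly3" where
  "kill m = ev cst (\<lambda>i. if (i = 0 \<and> 0 < m) \<or> (i = 1 \<and> 1 < m) \<or> (i = 2 \<and> 2 < m) then 0 else mo (eps i))"

interpretation cst: ring_map "cst :: 'k::field \<Rightarrow> 'k poly3"
  by standard (simp_all add: single_add mult_single single_one)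

interpretation kill: ring_map "kill m :: 'k::field poly3 \<Rightarrow> 'k poly3" for m
  unfolding kill_def by (rule cst.ev_ring_map)

lemma mo_pow_single: "mo (eps i) ^ m = mo (single i m)"
  by (induction m) (auto simp: mult_single single_one plus_1_eq_Suc simp flip: single_add)

lemma kill_single: "kill m (single e c) =
    (if (0 < m \<and> 0 < lookup e 0) \<or> (1 < m \<and> 0 < lookup e 1) \<or> (2 < m \<and> 0 < lookup e 2)
     then 0 else single e c)"
proof -
  have e: "e = single 0 (lookup e 0) + single 1 (lookup e 1)
        + single 2 (lookup e 2)"
    by (rule ex3_eqI) (auto simp: lookup_add lookup_single when_def)
  have mo: "(mo (eps 0) ^ lookup e 0) * (mo (eps 1) ^ lookup e 1 * mo (eps 2) ^ lookup e 2) = (mo e :: 'a poly3)"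
    unfolding mo_pow_single by (subst (4) e) (simp add: mult_single add.assoc)
  have "kill m (single e c) = cst c * (
      (if 0 < m then 0 else mo (eps 0)) ^ lookup e 0 *
      ((if 1 < m then 0 else mo (eps 1)) ^ lookup e 1 *
      (if 2 < m then 0 else mo (eps 2)) ^ lookup e 2))"
    unfolding kill_def cst.ev_single prod_3 by (simp add: mult.assoc)
  moreover have "cst c * mo e = single e c" by (simp add: mult_single)
  ultimately show ?thesis using mo by (auto simp: power_0_left)
qed

lemma kill_eq_0_iff: "kill m f = 0 \<longleftrightarrow> (\<forall>e\<in>keys f.
    (0 < m \<and> 0 < lookup e 0) \<or> (1 < m \<and> 0 < lookup e 1) \<or> (2 < m \<and> 0 < lookup e 2))"
proof -
  let ?b = "\<lambda>e. (0 < m \<and> 0 < lookup e 0) \<or> (1 < m \<and> 0 < lookup e 1) \<or> (2 < m \<and> 0 < lookup e (2 :: 3))"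
  have L: "lookup (kill m f) e = (if ?b e then 0 else lookup f e)" for e
    by (induction f rule: pm_induct) (auto simp: kill_single lookup_single when_def kill.h_add lookup_add)
  show ?thesis
  proof
    assume K: "kill m f = 0"
    show "\<forall>e\<in>keys f. ?b e"
    proof (rule ballI, rule ccontr)
      fix e assume e: "e \<in> keys f" "\<not> ?b e"
      then have "lookup (kill m f) e \<noteq> 0" unfolding L if_not_P[OF e(2)] by (simp add: in_keys_iff)
      then show False using K by simp
    qed
  next
    assume b: "\<forall>e\<in>keys f. ?b e"
    show "kill m f = 0"
    proof (rule poly_mapping_eqI)
      fix e
      show "lookup (kill m f) e = lookup 0 e"
      proof (cases "e \<in> keys f")
        case True
        then have "?b e" using b by (rule bspec[rotated])
        then show ?thesis unfolding L by simp
      next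
        case False
        then show ?thesis unfolding L by (simp add: in_keys_iff)
      qed
    qed
  qed
qed

lemma prime_ideal_kill: "prime_ideal {f :: 'k::field poly3. kill m f = 0}"
  unfolding prime_ideal_def ideal.subspace_def by (auto simp: kill.h_add kill.h_mult kill.h_1)

lemma prime_in_image: "prime_ideal P \<Longrightarrow> is_prime_in (range to_fract) (to_fract ` P)"
proof -
  assume P: "prime_ideal P"
  have "{a. to_fract a \<in> to_fract ` P} = P" by auto
  then show ?thesis using P by (auto simp: is_prime_in_iff)
qed

lemma ord_center: "range to_fract \<inter> val_max (ordv :: 'k::field poly3 fract \<Rightarrow> int) = to_fract ` {f. kill 3 f = 0}"
proof -
  have "(a = 0 \<or> 0 < ordm a) \<longleftrightarrow> kill 3 a = 0" for a :: "'k poly3"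
  proof (cases "a = 0")
    case False
    have "0 < ordm a \<longleftrightarrow> a \<in> Mge 1" using Mge_iff_ordm[OF False, of 1] by (auto simp: One_nat_def)
    also have "\<dots> \<longleftrightarrow> kill 3 a = 0" unfolding kill_eq_0_iff Mge_def by (auto simp: tdeg_3 One_nat_def Suc_le_eq)
    finally show ?thesis using False by simp
  qed simp
  then show ?thesis by (auto simp: ordm.to_fract_val_max)
qed

lemma ord_height: "height (range to_fract) (range to_fract \<inter> val_max (ordv :: 'k::field poly3 fract \<Rightarrow> int)) = 3"
proof (rule antisym[OF height_le_3])
  let ?c = "\<lambda>m. to_fract ` {f :: 'k poly3. kill m f = 0}"
  have "?c m \<subset> ?c (Suc m)" if m: "m < 3" for m
  proof -
    have "{f :: 'k poly3. kill m f = 0} \<subseteq> {f. kill (Suc m) f = 0}" by (auto simp: kill_eq_0_iff)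
    moreover have "\<exists>f :: 'k poly3. kill (Suc m) f = 0 \<and> kill m f \<noteq> 0"
    proof -
      have "m = 0 \<or> m = 1 \<or> m = 2" using m by auto
      then show ?thesis
        by (elim disjE; intro exI[of _ "mo (eps (of_nat m))"]) (simp_all add: kill_eq_0_iff lookup_single when_def)
    qed
    ultimately have "{f :: 'k poly3. kill m f = 0} \<subset> {f. kill (Suc m) f = 0}" by blast
    then show ?thesis by (rule image_strict_mono[rotated]) (auto intro: inj_onI)
  qed
  then have "enat 3 \<in> {enat r | r c. (\<forall>i\<le>r. is_prime_in (range to_fract) (c i)) \<and> (\<forall>i<r. c i \<subset> c (Suc i)) \<and> c r = ?c 3}"
    by (intro CollectI exI[of _ "3::nat"] exI[of _ ?c] conjI refl allI impI prime_in_image prime_ideal_kill) auto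
  then have "enat 3 \<le> height (range to_fract) (?c 3)" unfolding height_def by (rule Sup_upper)
  then show "3 \<le> height (range to_fract) (range to_fract \<inter> val_max (ordv :: 'k poly3 fract \<Rightarrow> int))"
    unfolding ord_center by (simp add: numeral_eq_enat)
qed

lemma ord_divisorial: "divisorial_valuation (range to_fract) (ordv :: 'k::field poly3 fract \<Rightarrow> int)"
  unfolding divisorial_valuation_def ord_height ord_residue_trdeg
  using ordm.dv_fv ordm.nonneg_fv by (simp add: numeral_eq_enat one_enat_def)

section \<open>The order valuation is essentially of finite type\<close>

text \<open>A chart of the blow-up of the origin; the valuation ring of the order valuation is its
  localization along the exceptional divisor \<open>x = 0\<close>.\<close>

definition chart :: "'k::field poly3 fract set" where
  "chart = is_subring hull (range to_fract \<union> set [ordv.X 1 / ordv.X 0, ordv.X 2 / ordv.X 0])"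

lemma subring_chart: "is_subring chart"
  unfolding chart_def by (rule is_subring_hull)

lemma chart_base: "to_fract f \<in> chart" "ordv.X 1 / ordv.X 0 \<in> chart" "ordv.X 2 / ordv.X 0 \<in> chart"
  unfolding chart_def by (auto intro!: hull_inc)

lemma Mge_chart: "f \<in> Mge d \<Longrightarrow> to_fract f / ordv.X 0 ^ d \<in> (chart :: 'k::field poly3 fract set)"
proof -
  assume f: "f \<in> Mge d"
  have "to_fract (single e (lookup f e)) / ordv.X 0 ^ d \<in> (chart :: 'k poly3 fract set)"
    if e: "e \<in> keys f" for e
  proof -
    let ?c = "lookup f e" and ?e = "lookup e"
    have d: "d \<le> ?e 0 + ?e 1 + ?e 2" using f e by (auto simp: Mge_def tdeg_3)
    have "to_fract (mo e :: 'k poly3) = ordv.X 0 ^ ?e 0 * (ordv.X 1 ^ ?e 1 * ordv.X 2 ^ ?e 2)"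
      by (subst ordv.mo_X) (simp only: prod_3 mult.assoc)
    moreover have "single e ?c = cst ?c * mo e" by (simp add: mult_single)
    ultimately have "to_fract (single e ?c) = to_fract (cst ?c) * (ordv.X 0 ^ ?e 0 * (ordv.X 1 ^ ?e 1 * ordv.X 2 ^ ?e 2))"
      by (simp only: to_fract_mult)
    moreover have "ordv.X 0 ^ (?e 0 + ?e 1 + ?e 2) = (ordv.X 0 ^ (?e 0 + ?e 1 + ?e 2 - d) * ordv.X 0 ^ d :: 'k poly3 fract)"
      unfolding power_add[symmetric] using d by simp
    ultimately have "to_fract (single e ?c) / ordv.X 0 ^ d =
        to_fract (cst ?c) * (ordv.X 0 ^ (?e 0 + ?e 1 + ?e 2 - d) * ((ordv.X 1 / ordv.X 0) ^ ?e 1 * (ordv.X 2 / ordv.X 0) ^ ?e 2))"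
      by (simp add: power_divide field_simps power_add)
    also have "\<dots> \<in> chart"
      by (intro subring_mult[OF subring_chart] subring_power[OF subring_chart] chart_base)
    finally show ?thesis .
  qed
  then show ?thesis
    by (subst pm_sum) (auto simp: to_fract_sum sum_divide_distrib intro!: subring_sum[OF subring_chart])
qed

definition chart_units :: "'k::field poly3 fract set" where
  "chart_units = {to_fract g / ordv.X 0 ^ ordm g | g. g \<noteq> 0}"

lemma ordv_X: "ordv (ordv.X i :: 'k::field poly3 fract) = 1"
  by (simp add: ordm.fv_to_fract ordm_mo)

lemma chart_subset_val_ring: "chart \<subseteq> val_ring (ordv :: 'k::field poly3 fract \<Rightarrow> int)"
  unfolding chart_def
proof (rule hull_minimal)
  have "ordv.X i / ordv.X 0 \<in> val_ring (ordv :: 'k poly3 fract \<Rightarrow> int)" for i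
    by (simp add: val_ring_def ordm.v_divide ordv_X)
  then show "range to_fract \<union> set [ordv.X 1 / ordv.X 0, ordv.X 2 / ordv.X 0] \<subseteq> val_ring (ordv :: 'k poly3 fract \<Rightarrow> int)"
    using ordm.nonneg_fv by auto
qed (rule ordm.subring_val_ring)

lemma ordv_unit: "g \<noteq> 0 \<Longrightarrow> ordv (to_fract g / ordv.X 0 ^ ordm g :: 'k::field poly3 fract) = 0"
  using ordv_X[where 'k = 'k] by (simp add: ordm.v_divide ordm.v_power ordm.fv_to_fract)

lemma val_ring_ordv:
  "val_ring (ordv :: 'k::field poly3 fract \<Rightarrow> int) = {a / s | a s. a \<in> chart \<and> s \<in> chart_units}"
proof (intro equalityI subsetI)
  fix q :: "'k poly3 fract" assume q: "q \<in> val_ring ordv"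
  show "q \<in> {a / s | a s. a \<in> chart \<and> s \<in> chart_units}"
  proof (cases "q = 0")
    case True
    have "(0::'k poly3 fract) = 0 / (to_fract 1 / ordv.X 0 ^ ordm (1 :: 'k poly3))" by simp
    moreover have "to_fract 1 / ordv.X 0 ^ ordm (1 :: 'k poly3) \<in> (chart_units :: 'k poly3 fract set)"
      unfolding chart_units_def by (intro CollectI exI[of _ "1 :: 'k poly3"] conjI refl) simp
    ultimately show ?thesis unfolding True using subring_0[OF subring_chart] by blast
  next
    case False
    obtain a b where ab: "q = Fract a b" "b \<noteq> 0" by (cases q rule: Fract_cases)
    then have a: "a \<noteq> 0" using False by (auto simp: fract_collapse)
    then have "a \<in> Mge (ordm b)" using q ab by (simp add: ordm.val_ring_Fract Mge_iff_ordm)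
    then have "to_fract a / ordv.X 0 ^ ordm b \<in> chart" by (rule Mge_chart)
    moreover have "to_fract b / ordv.X 0 ^ ordm b \<in> chart_units" using ab(2) unfolding chart_units_def by blast
    moreover have "q = (to_fract a / ordv.X 0 ^ ordm b) / (to_fract b / ordv.X 0 ^ ordm b)"
      unfolding ab(1) Fract_eq_divide by simp
    ultimately show ?thesis by blast
  qed
next
  fix q :: "'k poly3 fract" assume "q \<in> {a / s | a s. a \<in> chart \<and> s \<in> chart_units}"
  then obtain a g where ag: "q = a / (to_fract g / ordv.X 0 ^ ordm g)" "a \<in> chart" "g \<noteq> 0"
    by (auto simp: chart_units_def)
  let ?s = "to_fract g / ordv.X 0 ^ ordm g"
  have s: "?s \<noteq> 0" "ordv ?s = 0" using ag(3) ordv_unit[OF ag(3)] by simp_all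
  have "a \<in> val_ring ordv" using ag(2) chart_subset_val_ring by blast
  moreover have "ordv (a / ?s) = ordv a - ordv ?s" if "a \<noteq> 0" using that s(1) by (rule ordm.v_divide)
  ultimately show "q \<in> val_ring ordv" unfolding ag(1) using s(2) by (cases "a = 0") (simp_all add: val_ring_def)
qed

lemma chart_units:
  "chart_units \<subseteq> (chart :: 'k::field poly3 fract set)" "1 \<in> (chart_units :: 'k poly3 fract set)" "0 \<notin> (chart_units :: 'k poly3 fract set)"
  "\<forall>s\<in>chart_units. \<forall>t\<in>chart_units. s * t \<in> (chart_units :: 'k poly3 fract set)"
proof -
  show "chart_units \<subseteq> (chart :: 'k poly3 fract set)"
    by (auto simp: chart_units_def Mge_iff_ordm intro!: Mge_chart)
  have "to_fract (1 :: 'k poly3) / ordv.X 0 ^ ordm (1 :: 'k poly3) = 1" by (simp add: ordm.w_1)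
  then show "1 \<in> (chart_units :: 'k poly3 fract set)" unfolding chart_units_def by (intro CollectI exI[of _ 1]) simp
  show "0 \<notin> (chart_units :: 'k poly3 fract set)" by (auto simp: chart_units_def)
  show "\<forall>s\<in>chart_units. \<forall>t\<in>chart_units. s * t \<in> (chart_units :: 'k poly3 fract set)"
  proof (intro ballI)
    fix s t :: "'k poly3 fract" assume "s \<in> chart_units" "t \<in> chart_units"
    then obtain g h where gh: "s = to_fract g / ordv.X 0 ^ ordm g" "g \<noteq> 0" "t = to_fract h / ordv.X 0 ^ ordm h" "h \<noteq> 0"
      by (auto simp: chart_units_def)
    have "s * t = to_fract (g * h) / ordv.X 0 ^ ordm (g * h)" using gh by (simp add: ordm.w_mult power_add)
    then show "s * t \<in> chart_units" using gh unfolding chart_units_def by (intro CollectI exI[of _ "g * h"]) simp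
  qed
qed

lemma ord_ess_finite_type: "ess_finite_type (range to_fract) (val_ring (ordv :: 'k::field poly3 fract \<Rightarrow> int))"
  unfolding ess_finite_type_def
  using chart_units val_ring_ordv unfolding chart_def
  by (intro exI[of _ "set [ordv.X 1 / ordv.X 0, ordv.X 2 / ordv.X 0]"] exI[of _ chart_units] conjI) (rule finite_set | assumption)+

text \<open>\<open>x\<close> is a common denominator of both generators of the chart, hence
  \<open>x^2\<close> is obtained from \<open>Jacobian_contains\<close>.\<close>

lemma ord_Jacobian:
  "val_ideal ordv (Jacobian_ideal (range to_fract) (val_ring (ordv :: 'k::field poly3 fract \<Rightarrow> int))) \<le> 2"
proof -
  let ?G = "[ordv.X 1 / ordv.X 0, ordv.X 2 / ordv.X 0 :: 'k poly3 fract]"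
  interpret kaehler "range to_fract" "val_ring (ordv :: 'k poly3 fract \<Rightarrow> int)"
    by standard (rule ordm.subring_val_ring, rule subring_range_to_fract, rule ordm.nonneg_fv)
  have "prod_list (map (\<lambda>_. ordv.X 0) ?G) \<in> Jacobian_ideal (range to_fract) (val_ring (ordv :: 'k poly3 fract \<Rightarrow> int))"
    by (rule Jacobian_contains[OF chart_units(1)[unfolded chart_def] chart_units(2,3) val_ring_ordv[unfolded chart_def]]) auto
  then have "ordv.X 0 * ordv.X 0 \<in> Jacobian_ideal (range to_fract) (val_ring (ordv :: 'k poly3 fract \<Rightarrow> int))" by simp
  from ordm.val_ideal_le[OF this _ Jacobian_subset]
  have "val_ideal ordv (Jacobian_ideal (range to_fract) (val_ring (ordv :: 'k poly3 fract \<Rightarrow> int))) \<le> ordv (ordv.X 0 * ordv.X 0 :: 'k poly3 fract)"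
    by simp
  also have "\<dots> = 2" using ordv_X[where 'k = 'k] by (simp add: ordm.v_mult)
  finally show ?thesis .
qed

section \<open>Valuations at prime elements\<close>

text \<open>Unique factorization is used through an isomorphism onto a ring of the factorial class,
  in which multiplicities at primes are computed. The instance used is \<open>nest\<close>.\<close>

locale factorial_iso = ring_map psi for psi :: "'a::idom \<Rightarrow> 'b::factorial_ring_gcd" +
  assumes psi_inj: "inj psi" and psi_surj: "surj psi"
begin

lemma psi_eq_0_iff [simp]: "psi a = 0 \<longleftrightarrow> a = 0"
  using psi_inj by (metis h_0 injD)

end

locale prime_val = factorial_iso psi for psi :: "'a::idom \<Rightarrow> 'b::factorial_ring_gcd" +
  fixes P :: 'b
  assumes P: "prime P"
begin

definition w where "w a = multiplicity P (psi a)"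

lemma P_nz: "P \<noteq> 0" and P_unit: "\<not> is_unit P"
  using P by (auto simp: not_prime_unit)

lemma w_eq_0_iff: "a \<noteq> 0 \<Longrightarrow> w a = 0 \<longleftrightarrow> \<not> P dvd psi a"
  using P_unit by (simp add: w_def multiplicity_eq_zero_iff)

sublocale w: order_fun w
proof
  fix a b :: 'a assume nz: "a \<noteq> 0" "b \<noteq> 0"
  then show "w (a * b) = w a + w b"
    using P by (simp add: w_def h_mult prime_elem_multiplicity_mult_distrib)
  assume s: "a + b \<noteq> 0"
  have "P ^ min (w a) (w b) dvd psi a" "P ^ min (w a) (w b) dvd psi b"
    by (auto simp: w_def intro: multiplicity_dvd')
  then have "P ^ min (w a) (w b) dvd psi (a + b)" unfolding h_add by (rule dvd_add)
  then show "min (w a) (w b) \<le> w (a + b)"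
    unfolding w_def[of "a + b"] using s P_unit by (intro multiplicity_geI) simp_all
next
  obtain p where "psi p = P" using psi_surj by (metis surjD)
  then show "\<exists>a. a \<noteq> 0 \<and> w a = 1" using P P_nz by (intro exI[of _ p]) (auto simp: w_def)
qed

text \<open>Cancelling powers of \<open>P\<close> shows that the valuation ring is a localization of
  the ring itself. No generators are adjoined, so \<open>Jacobian_contains\<close> for the empty
  list puts 1 into the Jacobian ideal.\<close>

lemma reduced:
  assumes "q \<in> val_ring w.fv"
  shows "\<exists>a s. q = to_fract a / to_fract s \<and> s \<noteq> 0 \<and> \<not> P dvd psi s"
proof (cases "q = 0")
  case True
  then show ?thesis using P_unit by (intro exI[of _ 0] exI[of _ 1]) (simp add: h_1)
next
  case False
  obtain a b where ab: "q = Fract a b" "b \<noteq> 0" by (cases q rule: Fract_cases)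
  then have a: "a \<noteq> 0" using False by (auto simp: fract_collapse)
  have le: "w b \<le> w a" using assms ab a by (simp add: w.val_ring_Fract)
  obtain s' where s': "psi b = P ^ w b * s'" "\<not> P dvd s'"
    using multiplicity_decompose'[of "psi b" P] ab(2) P_unit unfolding w_def by auto
  have "P ^ w b dvd psi a" using le unfolding w_def by (rule multiplicity_dvd')
  then obtain a' where a': "psi a = P ^ w b * a'" by blast
  obtain a0 s0 where 0: "psi a0 = a'" "psi s0 = s'" using psi_surj by (metis surjD)
  have "psi (a * s0) = psi (b * a0)" using s' a' 0 by (simp add: h_mult)
  then have "a * s0 = b * a0" using psi_inj by (simp add: inj_eq)
  moreover have "s0 \<noteq> 0" using 0 s'(2) by auto
  ultimately have "q = Fract a0 s0" using ab by (simp add: eq_fract mult.commute)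
  then show ?thesis using s'(2) 0 \<open>s0 \<noteq> 0\<close> Fract_eq_divide by blast
qed

lemma val_ring_eq:
  "val_ring w.fv = {a / s | a s. a \<in> range to_fract \<and> s \<in> to_fract ` {s. \<not> P dvd psi s}}"
proof (intro equalityI subsetI)
  fix q assume "q \<in> val_ring w.fv"
  then show "q \<in> {a / s | a s. a \<in> range to_fract \<and> s \<in> to_fract ` {s. \<not> P dvd psi s}}"
    using reduced by blast
next
  fix q assume "q \<in> {a / s | a s. a \<in> range to_fract \<and> s \<in> to_fract ` {s. \<not> P dvd psi s}}"
  then obtain a s where q: "q = to_fract a / to_fract s" "\<not> P dvd psi s" by blast
  have s: "s \<noteq> 0" using q(2) by auto
  show "q \<in> val_ring w.fv"
    by (cases "a = 0") (use q s w_eq_0_iff[of s] in \<open>auto simp: val_ring_def w.v_divide w.fv_to_fract\<close>)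
qed

lemma hull_range: "is_subring hull (range to_fract \<union> {}) = range (to_fract :: 'a \<Rightarrow> 'a fract)"
proof -
  have "is_subring (range (to_fract :: 'a \<Rightarrow> 'a fract))"
    unfolding is_subring_def by (auto simp flip: to_fract_mult to_fract_diff to_fract_1)
  then show ?thesis by (simp add: hull_same)
qed

lemma units:
  "to_fract ` {s. \<not> P dvd psi s} \<subseteq> is_subring hull (range to_fract \<union> {})" "1 \<in> to_fract ` {s. \<not> P dvd psi s}"
  "0 \<notin> to_fract ` {s. \<not> P dvd psi s}"
  "\<forall>s\<in>to_fract ` {s. \<not> P dvd psi s}. \<forall>t\<in>to_fract ` {s. \<not> P dvd psi s}. s * t \<in> to_fract ` {s. \<not> P dvd psi s}"
proof -
  show "to_fract ` {s. \<not> P dvd psi s} \<subseteq> is_subring hull (range to_fract \<union> {})" unfolding hull_range by blast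
  have "to_fract 1 \<in> to_fract ` {s. \<not> P dvd psi s}" using P_unit by (intro imageI) (simp add: h_1)
  then show "1 \<in> to_fract ` {s. \<not> P dvd psi s}" by simp
  show "0 \<notin> to_fract ` {s. \<not> P dvd psi s}" by auto
  show "\<forall>s\<in>to_fract ` {s. \<not> P dvd psi s}. \<forall>t\<in>to_fract ` {s. \<not> P dvd psi s}. s * t \<in> to_fract ` {s. \<not> P dvd psi s}"
  proof (intro ballI)
    fix s t assume "s \<in> to_fract ` {s. \<not> P dvd psi s}" "t \<in> to_fract ` {s. \<not> P dvd psi s}"
    then obtain a b where ab: "s = to_fract a" "t = to_fract b" "\<not> P dvd psi a" "\<not> P dvd psi b" by blast
    then have "\<not> P dvd psi (a * b)" using P by (simp add: h_mult prime_dvd_mult_iff)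
    then show "s * t \<in> to_fract ` {s. \<not> P dvd psi s}" using ab by (intro image_eqI[of _ _ "a * b"]) auto
  qed
qed

lemma ess: "ess_finite_type (range to_fract) (val_ring w.fv)"
  unfolding ess_finite_type_def
  using units val_ring_eq unfolding hull_range
  by (intro exI[of _ "{}"] exI[of _ "to_fract ` {s. \<not> P dvd psi s}"]) (simp add: hull_range[unfolded Un_empty_right])

lemma Jacobian: "val_ideal w.fv (Jacobian_ideal (range to_fract) (val_ring w.fv)) \<le> 0"
proof -
  have "is_subring (range (to_fract :: 'a \<Rightarrow> 'a fract))" using is_subring_hull[of "range (to_fract :: 'a \<Rightarrow> 'a fract) \<union> {}"] unfolding hull_range .
  then interpret kaehler "range to_fract" "val_ring w.fv"
    by unfold_locales (rule w.subring_val_ring, assumption, rule w.nonneg_fv)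
  have "prod_list (map (\<lambda>_. 1) ([] :: 'a fract list)) \<in> Jacobian_ideal (range to_fract) (val_ring w.fv)"
    by (rule Jacobian_contains[where G = "[]" and W = "to_fract ` {s. \<not> P dvd psi s}"], unfold list.set(1))
      (use units val_ring_eq hull_range in auto)
  then have "1 \<in> Jacobian_ideal (range to_fract) (val_ring w.fv)" by simp
  from w.val_ideal_le[OF this _ Jacobian_subset] show ?thesis by simp
qed

lemma to_fract_center: "to_fract a \<in> val_max w.fv \<longleftrightarrow> P dvd psi a"
  using w_eq_0_iff[of a] by (cases "a = 0") (auto simp: w.to_fract_val_max, simp add: val_max_def)

lemma center: "range to_fract \<inter> val_max w.fv = to_fract ` {a. P dvd psi a}"
  using to_fract_center by blast

lemma prime_center: "prime_ideal {a. P dvd psi a}"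
  unfolding prime_ideal_def ideal.subspace_def
  using P P_unit by (auto simp: h_add h_mult h_1 prime_dvd_mult_iff)

text \<open>A nonzero element of \<open>Q\<close> is written as \<open>p * b\<close>; as long as
  \<open>p\<close> is not in \<open>Q\<close>, primality puts \<open>b\<close> into
  \<open>Q\<close>, with smaller multiplicity. This descent must end, so \<open>p\<close> is in
  \<open>Q\<close>.\<close>

lemma center_minimal:
  assumes Q: "prime_ideal Q" "Q \<subseteq> {a. P dvd psi a}" and nz: "a \<in> Q" "a \<noteq> 0"
  shows "{a. P dvd psi a} \<subseteq> Q"
proof -
  have id: "is_ideal Q" and pr: "\<And>x y. x * y \<in> Q \<Longrightarrow> x \<in> Q \<or> y \<in> Q" using Q(1) by (auto simp: prime_ideal_def)
  obtain p where p: "psi p = P" using psi_surj by (metis surjD)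
  then have p_nz: "p \<noteq> 0" and wp: "w p = 1" using P P_nz by (auto simp: w_def)
  have "p \<in> Q" using nz
  proof (induction "w a" arbitrary: a rule: less_induct)
    case less
    have "P dvd psi a" using less.prems Q(2) by blast
    then obtain b' where "psi a = P * b'" by blast
    moreover obtain b where "b' = psi b" using psi_surj by (metis surjD)
    ultimately have "psi a = psi (p * b)" using p by (simp add: h_mult)
    then have a: "a = p * b" using psi_inj by (simp add: inj_eq)
    then have b: "b \<noteq> 0" using less.prems by auto
    then have "w b < w a" unfolding a using p_nz wp by (simp add: w.w_mult)
    moreover have "p \<in> Q \<or> b \<in> Q" using pr less.prems(1) unfolding a by blast
    ultimately show ?case using less.hyps b by blast
  qed
  show ?thesis
  proof
    fix x assume "x \<in> {a. P dvd psi a}"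
    then obtain y' where "psi x = P * y'" by blast
    moreover obtain y where "y' = psi y" using psi_surj by (metis surjD)
    ultimately have "psi x = psi (y * p)" using p by (simp add: h_mult mult.commute)
    then have "x = y * p" using psi_inj by (simp add: inj_eq)
    then show "x \<in> Q" using ideal.subspace_scale[OF id \<open>p \<in> Q\<close>] by simp
  qed
qed

lemma height: "height (range to_fract) (range to_fract \<inter> val_max w.fv) = 1"
proof (rule antisym)
  have "r \<le> 1" if c: "\<forall>i\<le>r. is_prime_in (range to_fract) (c i)" "\<forall>i<r. c i \<subset> c (Suc i)" "c r = to_fract ` {a. P dvd psi a}"
    for r and c :: "nat \<Rightarrow> 'a fract set"
  proof (rule ccontr)
    assume "\<not> r \<le> 1"
    then obtain m where m: "r = Suc (Suc m)" by (metis Suc_le_D not_less_eq_eq One_nat_def)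
    define Q where "Q = {a. to_fract a \<in> c (Suc m)}"
    have Q: "prime_ideal Q" "c (Suc m) = to_fract ` Q"
      using c(1) m unfolding is_prime_in_iff Q_def by (auto dest!: spec[of _ "Suc m"])
    have sub: "c (Suc m) \<subset> to_fract ` {a. P dvd psi a}" using c(2,3) m by (metis lessI)
    then have QP: "Q \<subseteq> {a. P dvd psi a}" unfolding Q(2) by auto
    have "prime_ideal {a. to_fract a \<in> c m}" "c m \<subseteq> range to_fract" using c(1) m unfolding is_prime_in_iff by auto
    then have "to_fract 0 \<in> c m" unfolding prime_ideal_def using ideal.subspace_0 by blast
    moreover have "c m \<subset> c (Suc m)" using c(2) m by simp
    then obtain x where "x \<in> c (Suc m)" "x \<notin> c m" by blast
    ultimately obtain a where "a \<in> Q" "a \<noteq> 0" unfolding Q(2) by blast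
    then have "{a. P dvd psi a} \<subseteq> Q" using center_minimal[OF Q(1) QP] by blast
    then show False using sub unfolding Q(2) by blast
  qed
  then have "enat r \<le> 1" if "\<forall>i\<le>r. is_prime_in (range to_fract) (c i)" "\<forall>i<r. c i \<subset> c (Suc i)" "c r = to_fract ` {a. P dvd psi a}"
    for r and c :: "nat \<Rightarrow> 'a fract set" using that by (simp add: one_enat_def)
  then show "height (range to_fract) (range to_fract \<inter> val_max w.fv) \<le> 1"
    unfolding height_def center by (intro Sup_least) blast
  let ?c = "\<lambda>i. if i = 0 then to_fract ` {0 :: 'a} else to_fract ` {a. P dvd psi a}"
  have zero: "prime_ideal {0 :: 'a}" by (auto simp: prime_ideal_def ideal.subspace_def)
  obtain p where "psi p = P" using psi_surj by (metis surjD)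
  then have p: "to_fract p \<in> to_fract ` {a. P dvd psi a}" "to_fract p \<notin> to_fract ` {0 :: 'a}" using P_nz by auto
  have "to_fract ` {0 :: 'a} \<subset> to_fract ` {a. P dvd psi a}"
  proof (intro psubsetI notI)
    show "to_fract ` {0 :: 'a} \<subseteq> to_fract ` {a. P dvd psi a}" by (intro image_mono) simp
    assume "to_fract ` {0 :: 'a} = to_fract ` {a. P dvd psi a}"
    then have "to_fract p \<in> to_fract ` {0 :: 'a}" by (rule ssubst) (rule p(1))
    then show False using p(2) by contradiction
  qed
  then have "enat 1 \<in> {enat r | r c. (\<forall>i\<le>r. is_prime_in (range to_fract) (c i)) \<and> (\<forall>i<r. c i \<subset> c (Suc i)) \<and> c r = to_fract ` {a. P dvd psi a}}"
    using prime_in_image[OF zero] prime_in_image[OF prime_center]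
    by (intro CollectI exI[of _ "1::nat"] exI[of _ ?c] conjI refl allI impI) auto
  then have "enat 1 \<le> height (range to_fract) (to_fract ` {a. P dvd psi a})" unfolding height_def by (rule Sup_upper)
  then show "1 \<le> height (range to_fract) (range to_fract \<inter> val_max w.fv)" unfolding center by (simp add: one_enat_def)
qed

lemma residue_trdeg_0: "residue_trdeg (range to_fract) w.fv = 0"
proof -
  have "us = []" if us: "set us \<subseteq> val_ring w.fv" "residues_alg_indep (range to_fract) w.fv us" for us
  proof (rule ccontr)
    assume "us \<noteq> []"
    then have len: "0 < length us" and "us ! 0 \<in> val_ring w.fv" using us(1) by auto
    then obtain a s where as: "us ! 0 = to_fract a / to_fract s" "s \<noteq> 0" "\<not> P dvd psi s" using reduced by blast
    \<comment> \<open>The relation \<open>s T - a\<close> satisfied by \<open>a / s\<close>. Its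
      leading coefficient \<open>s\<close> is a unit of the valuation ring, so the residue is
      algebraic.\<close>
    define f where "f = single (single (0::nat) (1::nat)) (to_fract s) + single 0 (- to_fract a)"
    have look: "lookup f e = (if e = single 0 1 then to_fract s else if e = 0 then to_fract (- a) else 0)" for e
      unfolding f_def by (auto simp: lookup_add lookup_single when_def)
    have "(\<Prod>i<length us. us ! i ^ lookup (single (0::nat) (1::nat)) i) = (\<Prod>i<length us. if i = 0 then us ! i else 1)"
      by (rule prod.cong) (auto simp: lookup_single when_def)
    also have "\<dots> = us ! 0" using len by (simp add: prod.delta)
    finally have "mpoly_eval us f = 0"
      unfolding f_def mpoly_eval_add mpoly_eval_single using as by simp
    then have "mpoly_eval us f \<in> val_max w.fv" by (simp add: val_max_def)
    moreover have "lookup f e \<in> range to_fract" for e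
      unfolding look using to_fract_0 by (metis rangeI)
    moreover have "keys e \<subseteq> {..<length us}" if "e \<in> keys f" for e
      using that len by (auto simp: in_keys_iff look split: if_splits)
    ultimately have "lookup f (single 0 1) \<in> val_max w.fv"
      using us(2) unfolding residues_alg_indep_def by blast
    then show False using as(3) unfolding look by (simp add: to_fract_center)
  qed
  then have "residue_trdeg (range to_fract) w.fv \<le> 0"
    unfolding residue_trdeg_def by (intro Sup_least) (auto simp: zero_enat_def)
  then show ?thesis by simp
qed

lemma divisorial: "divisorial_valuation (range to_fract) w.fv"
  unfolding divisorial_valuation_def height residue_trdeg_0 using w.dv_fv w.nonneg_fv by simp

lemma adjoint_val:
  fixes L :: "'a set"
  assumes "r \<in> adjoint (range to_fract) (to_fract ` L)" "r \<noteq> 0" "a \<in> L" "a \<noteq> 0"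
  shows "0 \<le> w.fv r"
proof -
  have "val_ideal w.fv (to_fract ` L) - val_ideal w.fv (Jacobian_ideal (range to_fract) (val_ring w.fv)) \<le> w.fv r"
    using assms(1,2) divisorial ess unfolding adjoint_def by blast
  moreover have "0 \<le> val_ideal w.fv (to_fract ` L)"
    using assms(3,4) w.nonneg_fv by (intro w.val_ideal_ge[of "to_fract a"]) (auto simp flip: w.val_ring_vge)
  ultimately show ?thesis using Jacobian by simp
qed

end

context factorial_iso
begin

text \<open>At each prime the Jacobian ideal contains 1 and \<open>L\<close> has nonnegative value,
  so \<open>r\<close> has nonnegative value there. By unique factorization its denominator divides
  its numerator.\<close>

lemma adjoint_integral:
  fixes L :: "'a set"
  assumes r: "r \<in> adjoint (range to_fract) (to_fract ` L)" and L: "l \<in> L" "l \<noteq> 0"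
  shows "r \<in> range to_fract"
proof (cases "r = 0")
  case True
  then show ?thesis by (metis rangeI to_fract_0)
next
  case False
  obtain a b where ab: "r = Fract a b" "b \<noteq> 0" by (cases r rule: Fract_cases)
  then have a: "a \<noteq> 0" using False by (auto simp: fract_collapse)
  have "multiplicity P (psi b) \<le> multiplicity P (psi a)" if "prime P" for P
  proof -
    interpret prime_val psi P by standard (rule that)
    have "0 \<le> w.fv r" by (rule adjoint_val[OF r False L])
    then show ?thesis using ab a by (simp add: w.fv_Fract w_def)
  qed
  then have "psi b dvd psi a" using ab(2) by (intro multiplicity_le_imp_dvd) simp_all
  then obtain c' where "psi a = psi b * c'" by blast
  moreover obtain c where "c' = psi c" using psi_surj by (metis surjD)
  ultimately have "psi a = psi (b * c)" by (simp add: h_mult)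
  then have "a = b * c" using psi_inj by (simp add: inj_eq)
  then have "r = to_fract c" using ab by (simp add: to_fract_def eq_fract)
  then show ?thesis by blast
qed

end

text \<open>Reads a polynomial as an iterated univariate one, with \<open>z\<close> outermost and
  \<open>x\<close> innermost, and coefficients copied to \<open>fc\<close>, where the factorial
  structure is available.\<close>

definition nest :: "'k::field poly3 \<Rightarrow> 'k fc poly poly poly" where
  "nest = ev (\<lambda>c. [:[:[:Abs_fc c:]:]:]) (\<lambda>i. if i = 0 then [:[:[:0, 1:]:]:] else if i = 1 then [:[:0, 1:]:] else [:0, 1:])"

interpretation nest_const: ring_map "\<lambda>c :: 'k::field. [:[:[:Abs_fc c:]:]:]"
  by standard (simp_all add: Abs_fc_simps one_pCons)

interpretation nest: ring_map "nest :: 'k::field poly3 \<Rightarrow> 'k fc poly poly poly"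
  unfolding nest_def by (rule nest_const.ev_ring_map)

lemma nest_single: "nest (single e c) =
  monom (monom (monom (Abs_fc c) (lookup e 0)) (lookup e 1)) (lookup e 2)"
  unfolding nest_def nest_const.ev_single prod_3
  by (simp add: monom_altdef smult_power[symmetric] poly_const_pow mult.assoc)

lemma coeff_nest: "coeff (coeff (coeff (nest f) l) j) i = Abs_fc (lookup f (ex i j l))"
proof (induction f rule: pm_induct)
  case (single e c)
  show ?case
    unfolding nest_single by (auto simp: lookup_single when_def ex_iff Abs_fc_simps)
qed (simp add: nest.h_add lookup_add Abs_fc_simps)

interpretation nest: factorial_iso "nest :: 'k::field poly3 \<Rightarrow> 'k fc poly poly poly"
proof
  show "inj (nest :: 'k poly3 \<Rightarrow> _)"
  proof (rule injI)
    fix f g :: "'k poly3" assume fg: "nest f = nest g"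
    show "f = g"
    proof (rule poly_mapping_eqI)
      fix e :: ex3
      have e: "e = ex (lookup e 0) (lookup e 1) (lookup e 2)" by (simp add: ex_iff)
      have "Abs_fc (lookup f e) = Abs_fc (lookup g e)"
        by (subst (1 2) e) (simp only: coeff_nest[symmetric] fg)
      then show "lookup f e = lookup g e" by (simp add: Abs_fc_inject)
    qed
  qed
  have plus: "F + G \<in> range nest" if "F \<in> range nest" "G \<in> range nest" for F G :: "'k fc poly poly poly"
    using that by (auto simp flip: nest.h_add)
  have times: "F * G \<in> range nest" if "F \<in> range nest" "G \<in> range nest" for F G :: "'k fc poly poly poly"
    using that by (auto simp flip: nest.h_mult)
  have "nest (mo (eps 0) :: 'k poly3) = [:[:[:0, 1:]:]:]" "nest (mo (eps 1) :: 'k poly3) = [:[:0, 1:]:]"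
    "nest (mo (eps 2) :: 'k poly3) = [:0, 1:]"
    by (simp_all add: nest_single lookup_single monom_altdef Abs_fc_simps one_pCons)
  then have vars: "[:[:[:0, 1:]:]:] \<in> range (nest :: 'k poly3 \<Rightarrow> _)" "[:[:0, 1:]:] \<in> range (nest :: 'k poly3 \<Rightarrow> _)" "[:0, 1:] \<in> range (nest :: 'k poly3 \<Rightarrow> _)"
    by (metis rangeI)+
  have c: "[:[:[:c:]:]:] \<in> range (nest :: 'k poly3 \<Rightarrow> _)" for c
  proof -
    have "nest (cst (Rep_fc c)) = [:[:[:c:]:]:]" by (simp add: nest_single Rep_fc_inverse monom_0)
    then show ?thesis by (metis rangeI)
  qed
  have A: "[:[:G:]:] \<in> range (nest :: 'k poly3 \<Rightarrow> _)" for G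
  proof (induction G)
    case (pCons a p)
    have "[:[:pCons a p:]:] = [:[:[:a:]:]:] + [:[:[:0, 1:]:]:] * [:[:p:]:]" by simp
    then show ?case using pCons plus times c vars(1) by metis
  qed (use c[of 0] in simp)
  have B: "[:G:] \<in> range (nest :: 'k poly3 \<Rightarrow> _)" for G
  proof (induction G)
    case (pCons a p)
    have "[:pCons a p:] = [:[:a:]:] + [:[:0, 1:]:] * [:p:]" by simp
    then show ?case using pCons plus times A vars(2) by metis
  qed (use A[of 0] in simp)
  have "G \<in> range (nest :: 'k poly3 \<Rightarrow> _)" for G
  proof (induction G)
    case (pCons a p)
    have "pCons a p = [:a:] + [:0, 1:] * p" by simp
    then show ?case using pCons plus times B vars(3) by metis
  qed (use B[of 0] in simp)
  then show "surj (nest :: 'k poly3 \<Rightarrow> _)" by blast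
qed

context edge_exponents
begin

lemma adjoint_subset:
  "adjoint (range to_fract) (to_fract ` ideal_pow (mi E :: 'k::field poly3 set) 3) \<subseteq> to_fract ` Mge (3 * n - 2)"
proof
  fix r :: "'k poly3 fract"
  let ?I = "ideal_pow (mi E :: 'k poly3 set) 3"
  let ?J = "Jacobian_ideal (range to_fract) (val_ring (ordv :: 'k poly3 fract \<Rightarrow> int))"
  assume r: "r \<in> adjoint (range to_fract) (to_fract ` ?I)"
  have mem: "mo (single 0 (3 * n)) \<in> ?I" by (rule pure_in_I3)
  then obtain f where f: "r = to_fract f" using nest.adjoint_integral[OF r mem] by auto
  show "r \<in> to_fract ` Mge (3 * n - 2)"
  proof (cases "f = 0")
    case True
    then show ?thesis using f ideal.subspace_0[OF ideal_Mge] by blast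
  next
    case False
    have "val_ideal ordv (to_fract ` ?I) - val_ideal ordv ?J \<le> ordv r"
      using r False f ord_divisorial[where 'k = 'k] ord_ess_finite_type[where 'k = 'k] unfolding adjoint_def by auto
    moreover have "int (3 * n) \<le> val_ideal ordv (to_fract ` ?I)"
    proof (rule ordm.val_ideal_ge)
      show "to_fract (mo (single 0 (3 * n))) \<in> to_fract ` ?I" using mem by blast
      show "to_fract ` ?I \<subseteq> ordm.vge (int (3 * n))"
      proof safe
        fix g :: "'k poly3" assume "g \<in> ?I"
        then have "g \<in> Mge (3 * n)" using I3_subset by blast
        then show "to_fract g \<in> ordm.vge (int (3 * n))"
          by (cases "g = 0") (auto simp: ordm.vge_def ordm.fv_to_fract Mge_iff_ordm)
      qed
    qed simp
    ultimately have "int (3 * n) - 2 \<le> int (ordm f)" using ord_Jacobian[where 'k = 'k] False f by (simp add: ordm.fv_to_fract)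
    then have "f \<in> Mge (3 * n - 2)" using False by (simp add: Mge_iff_ordm)
    then show ?thesis using f by blast
  qed
qed

end

theorem corollary7p11:
  fixes n :: nat and ks ls ms :: "nat set" and a b c :: nat
    and I K L S :: "'k::field poly3 set"
  assumes "infinite (UNIV :: 'k set)"
    and "ks \<subseteq> {0..n}" "ls \<subseteq> {0..n}" "ms \<subseteq> {0..n}"
    and "I = edge_ideal n ks ls ms" and "I \<noteq> UNIV"
    and "a = Gcd (insert n (ks \<union> ls))"
    and "b = Gcd (insert n (ks \<union> ms))"
    and "c = Gcd (insert n (ls \<union> ms))"
    and "S = subalg a b c"
    and "K = K_ideal n S" and "L = L_ideal n S"
    and "a = 1" "b = 1" "c = 1"
  shows "(first_coeff_ideal (pure_power_ideal n) I = K \<and> K = L \<and> L = ideal_pow max_ideal n) \<and>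
         (core I = ideal_pow max_ideal (3 * n - 2) \<and>
          to_fract ` ideal_pow max_ideal (3 * n - 2)
            = adjoint (range to_fract) (to_fract ` ideal_pow I 3))"
proof -
  have I: "I = mi (edge_exps n ks ls ms)" unfolding assms(5) by (rule edge_ideal_mi)
  have "n > 0"
  proof (rule ccontr)
    assume "\<not> n > 0"
    then have "(1 :: 'k poly3) \<in> {mon n 0 0, mon 0 n 0, mon 0 0 n}" by (simp add: mon_def single_one)
    then have "1 \<in> I" unfolding assms(5) edge_ideal_def by (intro ideal.span_base) blast
    moreover have "is_ideal I" unfolding assms(5) edge_ideal_def by (rule ideal.subspace_span)
    ultimately have "x * 1 \<in> I" for x by (rule ideal.subspace_scale[rotated])
    then show False using assms(6) by auto
  qed
  then interpret edge_exponents n "edge_exps n ks ls ms"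
    using assms(2-4,7-9,13-15) by (intro edge_exponents_edge_exps) auto
  have KL: "K = Mge n" "L = Mge n"
    unfolding assms(11,12,10,13-15) subalg_1 by (rule K_ideal_UNIV, rule L_ideal_UNIV)
  have "Mge (3 * n - 2) \<subseteq> core I"
    unfolding core_def I using reduction_superset[OF assms(1)] by blast
  then have "core I = Mge (3 * n - 2)"
    using core_subset[OF assms(1)] unfolding I by blast
  then show ?thesis
    using KL Mge_subset_adjoint adjoint_subset first_coeff
    unfolding max_ideal_pow pure_power_ideal_mi I by (intro conjI) auto
qed

end
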